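(* Let $\omega\subset\mathbb{R}^2$ be a bounded and connected open set whose boundary is Lipschitz-continuous, and let $\nu=(\nu_1,\nu_2)$ denote the unit outer normal vector field to $\partial\omega$ (defined almost everywhere on $\partial\omega$). Assume that the set $V(\omega)=V_H(\omega)\times V_3(\omega)$, where $V_H(\omega)\subset H^1(\omega)\times H^1(\omega)$ and $V_3(\omega)\subset H^2(\omega)$, satisfies the following two conditions: $$u_3\in V_3(\omega)\ \text{ and }\ \partial_\alpha u_3=0\text{ in }\omega\text{ for all }\alpha\in\{1,2\}\quad\text{imply}\quad u_3=0\text{ in }\omega,$$ and there exists a non-zero vector $(e_1,e_2)\in\mathbb{R}^2$ such that $$(u_\alpha)\in V_H(\omega)\quad\text{implies}\quad u_\alpha\,(\nu_1e_1+\nu_2e_2)=0\text{ on }\partial\omega\text{ for all }\alpha\in\{1,2\}.$$ Then the set $V(\omega)$ satisfies the following rigidity property: $$\boldsymbol{u}\in V(\omega)\ \text{ and }\ \boldsymbol{E}(\boldsymbol{u})=\boldsymbol{0}\text{ in }\omega\quad\text{imply}\quad\boldsymbol{u}=\boldsymbol{0}\text{ in }\omega.$$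
   Context: For $\boldsymbol{u}=(u_1,u_2,u_3)\in H^1(\omega)\times H^1(\omega)\times H^2(\omega)$, the symmetric matrix field $\boldsymbol{E}(\boldsymbol{u})=(E_{\alpha\beta}(\boldsymbol{u}))_{\alpha,\beta\in\{1,2\}}$ is defined by $$E_{\alpha\beta}(\boldsymbol{u})=\tfrac12(\partial_\alpha u_\beta+\partial_\beta u_\alpha+\partial_\alpha u_3\,\partial_\beta u_3),$$ where $\partial_\alpha=\partial/\partial y_\alpha$ are distributional derivatives. Boundary values are understood in the sense of traces, and equalities on $\partial\omega$ hold almost everywhere with respect to the arc-length measure. *)

theory Defs
  imports "HOL-Analysis.Analysis"
begin

section \<open>Classical derivatives and smooth functions on the plane\<close>

definition partial :: "2 \<Rightarrow> (real^2 \<Rightarrow> real) \<Rightarrow> real^2 \<Rightarrow> real" where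
  "partial \<alpha> f x = frechet_derivative f (at x) (axis \<alpha> 1)"

primrec C_k :: "nat \<Rightarrow> (real^2 \<Rightarrow> real) \<Rightarrow> bool" where
  "C_k 0 f \<longleftrightarrow> continuous_on UNIV f"
| "C_k (Suc k) f \<longleftrightarrow> f differentiable_on UNIV \<and> (\<forall>\<alpha>. C_k k (partial \<alpha> f))"

definition smooth :: "(real^2 \<Rightarrow> real) \<Rightarrow> bool" where
  "smooth f \<longleftrightarrow> (\<forall>k. C_k k f)"

definition test_functions :: "(real^2) set \<Rightarrow> (real^2 \<Rightarrow> real) set" where
  "test_functions \<omega> = {\<phi>. smooth \<phi> \<and> compact (closure {x. \<phi> x \<noteq> 0}) \<and> closure {x. \<phi> x \<noteq> 0} \<subseteq> \<omega>}"


section \<open>Distributional derivatives and Sobolev spaces\<close>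

text \<open>Elements of Lebesgue and Sobolev spaces are represented by functions; equality in the
  space is equality almost everywhere in \<^term>\<open>lebesgue_on \<omega>\<close>.\<close>

definition square_integrable :: "'a measure \<Rightarrow> ('a \<Rightarrow> real) set" where
  "square_integrable M = {f \<in> borel_measurable M. integrable M (\<lambda>x. (f x)\<^sup>2)}"

definition tendsto_L2 :: "'a measure \<Rightarrow> (nat \<Rightarrow> 'a \<Rightarrow> real) \<Rightarrow> ('a \<Rightarrow> real) \<Rightarrow> bool" where
  "tendsto_L2 M F f \<longleftrightarrow> (\<lambda>n. \<integral>\<^sup>+x. ennreal ((F n x - f x)\<^sup>2) \<partial>M) \<longlonglongrightarrow> 0"

definition locally_integrable :: "(real^2) set \<Rightarrow> (real^2 \<Rightarrow> real) \<Rightarrow> bool" where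
  "locally_integrable \<omega> f \<longleftrightarrow> (\<forall>K. compact K \<and> K \<subseteq> \<omega> \<longrightarrow> f absolutely_integrable_on K)"

definition has_weak_partial :: "(real^2) set \<Rightarrow> 2 \<Rightarrow> (real^2 \<Rightarrow> real) \<Rightarrow> (real^2 \<Rightarrow> real) \<Rightarrow> bool" where
  "has_weak_partial \<omega> \<alpha> f g \<longleftrightarrow> locally_integrable \<omega> f \<and> locally_integrable \<omega> g \<and>
     (\<forall>\<phi>\<in>test_functions \<omega>.
        (LINT x|lebesgue_on \<omega>. f x * partial \<alpha> \<phi> x) = - (LINT x|lebesgue_on \<omega>. g x * \<phi> x))"

definition weak_partial :: "(real^2) set \<Rightarrow> 2 \<Rightarrow> (real^2 \<Rightarrow> real) \<Rightarrow> real^2 \<Rightarrow> real" where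
  "weak_partial \<omega> \<alpha> f = (SOME g. has_weak_partial \<omega> \<alpha> f g)"

text \<open>\<open>sobolev k \<omega>\<close> is the space $H^k(\omega)$.\<close>

primrec sobolev :: "nat \<Rightarrow> (real^2) set \<Rightarrow> (real^2 \<Rightarrow> real) set" where
  "sobolev 0 \<omega> = square_integrable (lebesgue_on \<omega>)"
| "sobolev (Suc k) \<omega> = {f \<in> square_integrable (lebesgue_on \<omega>).
     \<forall>\<alpha>. (\<exists>g. has_weak_partial \<omega> \<alpha> f g) \<and> weak_partial \<omega> \<alpha> f \<in> sobolev k \<omega>}"


section \<open>Arc-length measure\<close>

text \<open>The arc-length measure on the boundary of a plane Lipschitz domain is the restriction to the
  boundary of the one-dimensional Hausdorff measure.  Covering sets are required to be bounded
  because \<^const>\<open>diameter\<close> has no meaning for unbounded sets.\<close>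

definition hausdorff1_content :: "real \<Rightarrow> 'a::metric_space set \<Rightarrow> ennreal" where
  "hausdorff1_content \<delta> A =
     (INF C\<in>{C :: nat \<Rightarrow> 'a set. A \<subseteq> (\<Union>i. C i) \<and> (\<forall>i. bounded (C i) \<and> diameter (C i) \<le> \<delta>)}.
        \<Sum>i. ennreal (diameter (C i)))"

definition hausdorff1_outer :: "'a::metric_space set \<Rightarrow> ennreal" where
  "hausdorff1_outer A = (SUP \<delta>\<in>{0<..}. hausdorff1_content \<delta> A)"

definition hausdorff1 :: "'a::metric_space measure" where
  "hausdorff1 = measure_of UNIV (sets borel) hausdorff1_outer"

text \<open>Since \<^const>\<open>measure_of\<close> yields the zero measure when the given set function is not countably
  additive, we prove Caratheodory's criterion: \<open>hausdorff1_outer\<close> is a metric outer measure, hence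
  a measure on the Borel sets (\<open>emeasure_hausdorff1\<close> below).\<close>

lemma hausdorff1_content_le:
  assumes "A \<subseteq> (\<Union>i. C i)" "\<And>i. bounded (C i)" "\<And>i. diameter (C i) \<le> \<delta>"
  shows "hausdorff1_content \<delta> A \<le> (\<Sum>i::nat. ennreal (diameter (C i)))"
  unfolding hausdorff1_content_def using assms by (intro INF_lower) auto

lemma hausdorff1_content_empty: "0 < \<delta> \<Longrightarrow> hausdorff1_content \<delta> {} = 0"
  using hausdorff1_content_le[of "{}" "\<lambda>_. {}" \<delta>] by simp

lemma hausdorff1_content_mono: "A \<subseteq> B \<Longrightarrow> hausdorff1_content \<delta> A \<le> hausdorff1_content \<delta> B"
  unfolding hausdorff1_content_def by (intro INF_superset_mono) auto

lemma hausdorff1_content_antimono: "\<delta> \<le> \<epsilon> \<Longrightarrow> hausdorff1_content \<epsilon> A \<le> hausdorff1_content \<delta> A"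
  unfolding hausdorff1_content_def by (intro INF_superset_mono) (auto intro: order_trans)

lemma hausdorff1_content_UN:
  fixes A :: "nat \<Rightarrow> 'a::metric_space set"
  shows "hausdorff1_content \<delta> (\<Union>i. A i) \<le> (\<Sum>i. hausdorff1_content \<delta> (A i))"
proof (rule ennreal_le_epsilon)
  fix e :: real
  assume e: "0 < e" and fin: "(\<Sum>i. hausdorff1_content \<delta> (A i)) < top"
  have "hausdorff1_content \<delta> (A n) < hausdorff1_content \<delta> (A n) + e * (1/2)^Suc n" for n
    using e ennreal_suminf_lessD[OF fin, of n] by (auto simp: less_top)
  then have "\<exists>C::nat \<Rightarrow> 'a set. A n \<subseteq> (\<Union>i. C i) \<and> (\<forall>i. bounded (C i) \<and> diameter (C i) \<le> \<delta>) \<and>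
      (\<Sum>i. ennreal (diameter (C i))) < hausdorff1_content \<delta> (A n) + e * (1/2)^Suc n" for n
    by (subst (asm) (1) hausdorff1_content_def) (auto simp: INF_less_iff)
  then obtain B :: "nat \<Rightarrow> nat \<Rightarrow> 'a set" where B: "\<And>n. A n \<subseteq> (\<Union>i. B n i)"
      "\<And>n i. bounded (B n i)" "\<And>n i. diameter (B n i) \<le> \<delta>"
      and Ble: "\<And>n. (\<Sum>i. ennreal (diameter (B n i))) < hausdorff1_content \<delta> (A n) + e * (1/2)^Suc n"
    by metis
  define C where "C = case_prod B o prod_decode"
  have "hausdorff1_content \<delta> (\<Union>i. A i) \<le> (\<Sum>i. ennreal (diameter (C i)))"
  proof (rule hausdorff1_content_le)
    show "(\<Union>i. A i) \<subseteq> (\<Union>i. C i)"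
      using B(1) by (auto simp: C_def subset_eq) (metis prod.case prod_encode_inverse)
  qed (auto simp: C_def B split: prod.splits)
  also have "\<dots> = (\<Sum>n. \<Sum>i. ennreal (diameter (B n i)))"
    unfolding C_def comp_def
    using suminf_ennreal_2dimen[of "\<lambda>n. \<Sum>i. ennreal (diameter (B n i))" "\<lambda>p. ennreal (diameter (case_prod B p))"]
    by simp
  also have "\<dots> \<le> (\<Sum>n. hausdorff1_content \<delta> (A n) + e * (1/2) ^ Suc n)"
    using Ble by (intro suminf_le suminf_nonneg allI less_imp_le) auto
  also have "... = (\<Sum>n. hausdorff1_content \<delta> (A n)) + (\<Sum>n. ennreal e * ennreal ((1/2) ^ Suc n))"
    using \<open>0 < e\<close> by (subst suminf_add[symmetric])
       (auto simp del: ennreal_suminf_cmult simp add: ennreal_mult[symmetric])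
  also have "\<dots> = (\<Sum>n. hausdorff1_content \<delta> (A n)) + e"
    unfolding ennreal_suminf_cmult
    by (subst suminf_ennreal_eq[OF zero_le_power power_half_series]) auto
  finally show "hausdorff1_content \<delta> (\<Union>i. A i) \<le> (\<Sum>n. hausdorff1_content \<delta> (A n)) + e" .
qed

lemma hausdorff1_outer_ge: "0 < \<delta> \<Longrightarrow> hausdorff1_content \<delta> A \<le> hausdorff1_outer A"
  unfolding hausdorff1_outer_def by (intro SUP_upper) auto

lemma hausdorff1_outer_mono: "A \<subseteq> B \<Longrightarrow> hausdorff1_outer A \<le> hausdorff1_outer B"
  unfolding hausdorff1_outer_def by (intro SUP_mono') (simp add: hausdorff1_content_mono)

lemma hausdorff1_outer_empty: "hausdorff1_outer {} = 0"
  unfolding hausdorff1_outer_def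
  by (rule antisym, rule SUP_least) (auto simp: hausdorff1_content_empty)

lemma hausdorff1_outer_UN: "hausdorff1_outer (\<Union>i. A i) \<le> (\<Sum>i::nat. hausdorff1_outer (A i))"
  unfolding hausdorff1_outer_def[of "\<Union>i. A i"]
proof (rule SUP_least)
  fix \<delta> :: real assume "\<delta> \<in> {0<..}"
  then show "hausdorff1_content \<delta> (\<Union>i. A i) \<le> (\<Sum>i. hausdorff1_outer (A i))"
    by (intro order_trans[OF hausdorff1_content_UN] suminf_le) (auto intro: hausdorff1_outer_ge)
qed

lemma hausdorff1_outer_Un_le: "hausdorff1_outer (A \<union> B) \<le> hausdorff1_outer A + hausdorff1_outer B"
  using hausdorff1_outer_UN[of "binaryset A B"]
  by (simp add: UN_binaryset_eq suminf_binaryset_eq[of hausdorff1_outer, OF hausdorff1_outer_empty])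

lemma outer_measure_space_hausdorff1: "outer_measure_space UNIV hausdorff1_outer"
  by (auto simp: outer_measure_space_def positive_def increasing_def countably_subadditive_def
      hausdorff1_outer_empty hausdorff1_outer_mono hausdorff1_outer_UN)

lemma hausdorff1_outer_Un_separated:
  assumes "0 < d" and d: "\<And>x y. x \<in> A \<Longrightarrow> y \<in> B \<Longrightarrow> d \<le> dist x y"
  shows "hausdorff1_outer A + hausdorff1_outer B \<le> hausdorff1_outer (A \<union> B)"
proof -
  have content: "hausdorff1_content \<delta> A + hausdorff1_content \<delta> B \<le> hausdorff1_content \<delta> (A \<union> B)"
    if \<delta>: "\<delta> < d" "0 < \<delta>" for \<delta>
    unfolding hausdorff1_content_def[of _ "A \<union> B"]
  proof (rule INF_greatest, clarify)
    fix C :: "nat \<Rightarrow> 'a set" assume C: "A \<union> B \<subseteq> (\<Union>i. C i)" "\<forall>i. bounded (C i) \<and> diameter (C i) \<le> \<delta>"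
    define CA CB where "CA i = (if C i \<inter> A \<noteq> {} then C i else {})"
      and "CB i = (if C i \<inter> B \<noteq> {} then C i else {})" for i
    have "hausdorff1_content \<delta> A \<le> (\<Sum>i. ennreal (diameter (CA i)))"
      using C \<delta> by (intro hausdorff1_content_le) (fastforce simp: CA_def)+
    moreover have "hausdorff1_content \<delta> B \<le> (\<Sum>i. ennreal (diameter (CB i)))"
      using C \<delta> by (intro hausdorff1_content_le) (fastforce simp: CB_def)+
    ultimately have "hausdorff1_content \<delta> A + hausdorff1_content \<delta> B \<le>
        (\<Sum>i. ennreal (diameter (CA i)) + ennreal (diameter (CB i)))"
      by (subst suminf_add[symmetric]) (auto intro: add_mono)
    also have "\<dots> \<le> (\<Sum>i. ennreal (diameter (C i)))"
    proof (rule suminf_le)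
      fix i
      have "\<not> (C i \<inter> A \<noteq> {} \<and> C i \<inter> B \<noteq> {})"
      proof
        assume "C i \<inter> A \<noteq> {} \<and> C i \<inter> B \<noteq> {}"
        then obtain x y where xy: "x \<in> C i" "x \<in> A" "y \<in> C i" "y \<in> B" by auto
        then have "dist x y \<le> \<delta>"
          using C(2) diameter_bounded_bound[of "C i" x y] order_trans by blast
        with d[OF xy(2,4)] \<delta> show False by simp
      qed
      then show "ennreal (diameter (CA i)) + ennreal (diameter (CB i)) \<le> ennreal (diameter (C i))"
        by (auto simp: CA_def CB_def)
    qed auto
    finally show "hausdorff1_content \<delta> A + hausdorff1_content \<delta> B \<le> (\<Sum>i. ennreal (diameter (C i)))" .
  qed
  have "hausdorff1_outer A + hausdorff1_outer B =
      (SUP \<delta>\<in>{0<..}. SUP \<epsilon>\<in>{0<..}. hausdorff1_content \<delta> A + hausdorff1_content \<epsilon> B)"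
    unfolding hausdorff1_outer_def
    by (subst ennreal_SUP_add_left[symmetric], auto) (subst ennreal_SUP_add_right[symmetric], auto)
  also have "\<dots> \<le> hausdorff1_outer (A \<union> B)"
  proof (intro SUP_least)
    fix \<delta> \<epsilon> :: real assume "\<delta> \<in> {0<..}" "\<epsilon> \<in> {0<..}"
    define m where "m = min (min \<delta> \<epsilon>) (d/2)"
    have m: "0 < m" "m < d" "m \<le> \<delta>" "m \<le> \<epsilon>"
      using \<open>0 < d\<close> \<open>\<delta> \<in> _\<close> \<open>\<epsilon> \<in> _\<close> by (auto simp: m_def)
    have "hausdorff1_content \<delta> A + hausdorff1_content \<epsilon> B \<le> hausdorff1_content m A + hausdorff1_content m B"
      using m by (intro add_mono hausdorff1_content_antimono) auto
    also have "\<dots> \<le> hausdorff1_content m (A \<union> B)" using m by (intro content)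
    also have "\<dots> \<le> hausdorff1_outer (A \<union> B)" using m by (intro hausdorff1_outer_ge)
    finally show "hausdorff1_content \<delta> A + hausdorff1_content \<epsilon> B \<le> hausdorff1_outer (A \<union> B)" .
  qed
  finally show ?thesis .
qed

lemma closed_lambda_system_hausdorff1:
  fixes F :: "'a::metric_space set"
  assumes "closed F"
  shows "F \<in> lambda_system UNIV UNIV hausdorff1_outer"
proof -
  have le: "hausdorff1_outer (A \<inter> F) + hausdorff1_outer (A - F) \<le> hausdorff1_outer A"
    if fin: "hausdorff1_outer A < top" and "F \<noteq> {}" for A
  proof -
    let ?H = "hausdorff1_outer :: 'a set \<Rightarrow> ennreal"
    let ?d = "\<lambda>x. infdist x F"
    define S where "S n = {x \<in> A. inverse (real (Suc n)) \<le> ?d x}" for n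
    define R where "R n = S (Suc n) - S n" for n
    have dist: "?d x - ?d y \<le> dist x y" for x y
      using infdist_triangle[of x F y] by (simp add: dist_commute)
    have S_sub: "S n \<subseteq> A" for n by (auto simp: S_def)
    have R_sub: "R n \<subseteq> A" for n by (auto simp: S_def R_def)
    have S_mono: "S n \<subseteq> S m" if "n \<le> m" for n m
    proof -
      have "inverse (real (Suc m)) \<le> inverse (real (Suc n))"
        using that by (intro le_imp_inverse_le) auto
      then show ?thesis unfolding S_def by (blast intro: order_trans)
    qed
    have half: "(\<Sum>k<n. ?H (R (2*k+a))) \<le> ?H (\<Union>k<n. R (2*k+a))" for n a
    proof (induction n)
      case 0 then show ?case by simp
    next
      case (Suc n)
      let ?U = "\<Union>k<n. R (2*k+a)"
      have "?H ?U + ?H (R (2*n+a)) \<le> ?H (?U \<union> R (2*n+a))"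
      proof (cases n)
        case 0
        then show ?thesis by (simp add: hausdorff1_outer_empty)
      next
        case (Suc m)
        have U: "?U \<subseteq> S (2*m+a+1)"
        proof
          fix x assume "x \<in> ?U"
          then obtain k where k: "k < n" "x \<in> R (2*k+a)" by auto
          then have "x \<in> S (Suc (2*k+a))" by (auto simp: R_def)
          then show "x \<in> S (2*m+a+1)" using S_mono[of "Suc (2*k+a)" "2*m+a+1"] k Suc by auto
        qed
        show ?thesis
        proof (rule hausdorff1_outer_Un_separated)
          show "0 < inverse (real (Suc (2*m+a+1))) - inverse (real (Suc (2*n+a)))"
            using less_imp_inverse_less[of "real (Suc (2*m+a+1))" "real (Suc (2*n+a))"] Suc by simp
          fix x y assume x: "x \<in> ?U" and y: "y \<in> R (2*n+a)"
          have "inverse (real (Suc (2*m+a+1))) \<le> ?d x" using x U by (auto simp: S_def)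
          moreover have "?d y < inverse (real (Suc (2*n+a)))" using y by (auto simp: S_def R_def)
          ultimately show "inverse (real (Suc (2*m+a+1))) - inverse (real (Suc (2*n+a))) \<le> dist x y"
            using dist[of x y] by linarith
        qed
      qed
      moreover have "?U \<union> R (2*n+a) = (\<Union>k<Suc n. R (2*k+a))" by (auto simp: less_Suc_eq)
      ultimately show ?case
        using order_trans[OF add_right_mono[OF Suc, of "?H (R (2*n+a))"]] by simp
    qed
    have half': "(\<Sum>k<n. ?H (R (2*k+a))) \<le> ?H A" for n a
      using R_sub by (intro order_trans[OF half] hausdorff1_outer_mono) auto
    have split: "(\<Sum>k<2*n. ?H (R k)) = (\<Sum>k<n. ?H (R (2*k+0))) + (\<Sum>k<n. ?H (R (2*k+1)))" for n
      by (induction n) (auto simp: algebra_simps)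
    define T where "T = (\<Sum>k. ?H (R k))"
    have "T \<le> ?H A + ?H A"
      unfolding T_def
    proof (rule suminf_le_const)
      fix n
      have "(\<Sum>k<n. ?H (R k)) \<le> (\<Sum>k<2*n. ?H (R k))" by (intro sum_mono2) auto
      also have "\<dots> \<le> ?H A + ?H A" unfolding split by (intro add_mono half')
      finally show "(\<Sum>k<n. ?H (R k)) \<le> ?H A + ?H A" .
    qed auto
    also have "\<dots> < top" using fin by (metis ennreal_add_eq_top less_top)
    finally have T: "T < top" .
    have "(\<lambda>n. \<Sum>k<n. ?H (R k)) \<longlonglongrightarrow> T" unfolding T_def by (intro summable_LIMSEQ) auto
    then have lim: "(\<lambda>n. T - (\<Sum>k<n. ?H (R k))) \<longlonglongrightarrow> T - T"
      using T by (intro tendsto_diff_ennreal tendsto_const) auto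
    have bound: "?H (A \<inter> F) + ?H (A - F) \<le> ?H A + (T - (\<Sum>k<n. ?H (R k)))" for n
    proof -
      have tail: "T - (\<Sum>k<n. ?H (R k)) = (\<Sum>k. ?H (R (k+n)))"
      proof -
        have "T = (\<Sum>k. ?H (R (k+n))) + (\<Sum>k<n. ?H (R k))"
          unfolding T_def by (rule suminf_offset) auto
        moreover have "(\<Sum>k<n. ?H (R k)) < top"
          using T calculation by (metis add.commute ennreal_add_eq_top less_top)
        ultimately show ?thesis by (simp add: ennreal_add_diff_cancel_right less_top[symmetric])
      qed
      have sub: "A - F \<subseteq> S n \<union> (\<Union>k. R (k+n))"
      proof
        fix x assume x: "x \<in> A - F"
        then have "0 < ?d x" using infdist_pos_not_in_closed[OF \<open>closed F\<close> \<open>F \<noteq> {}\<close>] by auto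
        then obtain m where m: "inverse (real (Suc m)) < ?d x" using reals_Archimedean by blast
        then have xm: "x \<in> S (m + n)" using x S_mono[of m "m+n"] by (force simp: S_def)
        show "x \<in> S n \<union> (\<Union>k. R (k+n))"
        proof (rule ccontr)
          assume neg: "x \<notin> S n \<union> (\<Union>k. R (k+n))"
          have "x \<notin> S (k + n)" for k
            using neg by (induction k) (auto simp: R_def)
          with xm show False by auto
        qed
      qed
      have "?H (A - F) \<le> ?H (S n \<union> (\<Union>k. R (k+n)))" by (rule hausdorff1_outer_mono[OF sub])
      also have "\<dots> \<le> ?H (S n) + ?H (\<Union>k. R (k+n))" by (rule hausdorff1_outer_Un_le)
      also have "?H (\<Union>k. R (k+n)) \<le> (\<Sum>k. ?H (R (k+n)))"
        by (rule hausdorff1_outer_UN)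
      finally have 1: "?H (A - F) \<le> ?H (S n) + (T - (\<Sum>k<n. ?H (R k)))"
        by (simp add: tail add_left_mono)
      have "?H (A \<inter> F) + ?H (S n) \<le> ?H ((A \<inter> F) \<union> S n)"
      proof (rule hausdorff1_outer_Un_separated)
        show "0 < inverse (real (Suc n))" by simp
        fix x y assume "x \<in> A \<inter> F" "y \<in> S n"
        then show "inverse (real (Suc n)) \<le> dist x y"
          using dist[of y x] by (auto simp: S_def dist_commute)
      qed
      also have "\<dots> \<le> ?H A" using S_sub by (intro hausdorff1_outer_mono) auto
      finally have 2: "?H (A \<inter> F) + ?H (S n) \<le> ?H A" .
      have "?H (A \<inter> F) + ?H (A - F) \<le> (?H (A \<inter> F) + ?H (S n)) + (T - (\<Sum>k<n. ?H (R k)))"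
        using add_left_mono[OF 1, of "?H (A \<inter> F)"] by (simp add: add.assoc)
      also have "\<dots> \<le> ?H A + (T - (\<Sum>k<n. ?H (R k)))" by (rule add_right_mono[OF 2])
      finally show ?thesis .
    qed
    have "(\<lambda>n. ?H A + (T - (\<Sum>k<n. ?H (R k)))) \<longlonglongrightarrow> ?H A + (T - T)"
      by (intro tendsto_add tendsto_const lim)
    then have "?H (A \<inter> F) + ?H (A - F) \<le> ?H A + (T - T)"
      by (rule LIMSEQ_le_const) (use bound in auto)
    then show ?thesis using T by simp
  qed
  have "hausdorff1_outer (A \<inter> F) + hausdorff1_outer (A - F) = hausdorff1_outer A" for A
  proof (rule antisym)
    show "hausdorff1_outer (A \<inter> F) + hausdorff1_outer (A - F) \<le> hausdorff1_outer A"
      using le[of A] by (cases "hausdorff1_outer A < top"; cases "F = {}")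
        (auto simp: hausdorff1_outer_empty not_less top_unique)
    show "hausdorff1_outer A \<le> hausdorff1_outer (A \<inter> F) + hausdorff1_outer (A - F)"
      using hausdorff1_outer_Un_le[of "A \<inter> F" "A - F"] by (simp add: Int_Diff_Un)
  qed
  then show ?thesis
    by (simp add: lambda_system_def Int_commute Diff_eq)
qed

lemma measure_space_hausdorff1: "measure_space UNIV (sets borel) hausdorff1_outer"
proof -
  have *: "measure_space UNIV (lambda_system UNIV UNIV hausdorff1_outer) (hausdorff1_outer :: 'a set \<Rightarrow> _)"
    using sigma_algebra.caratheodory_lemma[OF sigma_algebra_Pow, of UNIV "hausdorff1_outer :: 'a set \<Rightarrow> _"]
      outer_measure_space_hausdorff1 by (simp add: Pow_UNIV)
  have "sets borel \<subseteq> lambda_system UNIV UNIV (hausdorff1_outer :: 'a set \<Rightarrow> _)"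
    unfolding borel_eq_closed
    by (subst sets_measure_of, simp)
       (intro sigma_algebra.sigma_sets_subset, use * in \<open>auto simp: measure_space_def closed_lambda_system_hausdorff1\<close>)
  then show ?thesis
    using * sets.sigma_algebra_axioms[of "borel :: 'a measure"]
    by (auto simp: measure_space_def positive_def countably_additive_def subset_eq)
qed

lemma sets_hausdorff1 [simp, measurable_cong]: "sets hausdorff1 = sets borel"
  and space_hausdorff1 [simp]: "space hausdorff1 = UNIV"
  unfolding hausdorff1_def by (auto simp: sets_measure_of_conv space_measure_of_conv sets.sigma_sets_eq[of borel, simplified])

lemma emeasure_hausdorff1:
  "A \<in> sets borel \<Longrightarrow> emeasure hausdorff1 A = hausdorff1_outer A"
  using measure_space_hausdorff1
  by (auto simp: hausdorff1_def measure_space_def sets.sigma_sets_eq[of borel, simplified]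
      intro!: emeasure_measure_of_sigma)

definition arc_length :: "(real^2) set \<Rightarrow> (real^2) measure" where
  "arc_length \<omega> = restrict_space hausdorff1 (frontier \<omega>)"


section \<open>Lipschitz boundary and unit outer normal\<close>

text \<open>Near \<open>x\<close>, in the orthonormal coordinates $(p \cdot y, q \cdot y)$, the set \<open>\<omega>\<close> is the part of
  the plane strictly above the graph of the Lipschitz function \<open>\<gamma>\<close>.\<close>

definition lipschitz_chart ::
  "(real^2) set \<Rightarrow> real^2 \<Rightarrow> real^2 \<Rightarrow> real^2 \<Rightarrow> real \<Rightarrow> (real \<Rightarrow> real) \<Rightarrow> bool" where
  "lipschitz_chart \<omega> x p q r \<gamma> \<longleftrightarrow>
     norm p = 1 \<and> norm q = 1 \<and> p \<bullet> q = 0 \<and> 0 < r \<and> (\<exists>L. L-lipschitz_on UNIV \<gamma>) \<and>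
     \<omega> \<inter> ball x r = {y \<in> ball x r. \<gamma> (p \<bullet> y) < q \<bullet> y}"

definition lipschitz_boundary :: "(real^2) set \<Rightarrow> bool" where
  "lipschitz_boundary \<omega> \<longleftrightarrow> (\<forall>x\<in>frontier \<omega>. \<exists>p q r \<gamma>. lipschitz_chart \<omega> x p q r \<gamma>)"

text \<open>The normalized gradient of $\gamma(p \cdot y) - q \cdot y$, which is negative inside \<open>\<omega>\<close>.\<close>

definition outer_unit_normal_at :: "(real^2) set \<Rightarrow> real^2 \<Rightarrow> real^2 \<Rightarrow> bool" where
  "outer_unit_normal_at \<omega> x n \<longleftrightarrow>
     (\<exists>p q r \<gamma> d. lipschitz_chart \<omega> x p q r \<gamma> \<and> (\<gamma> has_real_derivative d) (at (p \<bullet> x)) \<and>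
        n = (1 / sqrt (1 + d\<^sup>2)) *\<^sub>R (d *\<^sub>R p - q))"

definition outer_unit_normal_field :: "(real^2) set \<Rightarrow> (real^2 \<Rightarrow> real^2) \<Rightarrow> bool" where
  "outer_unit_normal_field \<omega> \<nu> \<longleftrightarrow> (AE x in arc_length \<omega>. outer_unit_normal_at \<omega> x (\<nu> x))"


section \<open>Traces\<close>

text \<open>The trace operator is the continuous extension to $H^1(\omega)$, with values in
  $L^2(\partial\omega)$, of the restriction map $\phi \mapsto \phi|_{\partial\omega}$ on functions
  smooth up to the boundary; \<open>has_trace \<omega> u g\<close> says that its value at \<open>u\<close> is \<open>g\<close>.\<close>

definition has_trace :: "(real^2) set \<Rightarrow> (real^2 \<Rightarrow> real) \<Rightarrow> (real^2 \<Rightarrow> real) \<Rightarrow> bool" where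
  "has_trace \<omega> u g \<longleftrightarrow> u \<in> sobolev 1 \<omega> \<and> g \<in> square_integrable (arc_length \<omega>) \<and>
     (\<exists>\<phi>. (\<forall>n. smooth (\<phi> n)) \<and>
        tendsto_L2 (lebesgue_on \<omega>) \<phi> u \<and>
        (\<forall>\<alpha>. tendsto_L2 (lebesgue_on \<omega>) (\<lambda>n. partial \<alpha> (\<phi> n)) (weak_partial \<omega> \<alpha> u)) \<and>
        tendsto_L2 (arc_length \<omega>) \<phi> g)"


section \<open>The strain field\<close>

text \<open>A displacement field is a pair \<open>(u\<^sub>H, u\<^sub>3)\<close>, where \<open>u\<^sub>H \<alpha>\<close> is the horizontal component of
  index \<open>\<alpha>\<close>.\<close>

definition strain ::
  "(real^2) set \<Rightarrow> (2 \<Rightarrow> real^2 \<Rightarrow> real) \<times> (real^2 \<Rightarrow> real) \<Rightarrow> real^2 \<Rightarrow> real^2^2" where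
  "strain \<omega> u y = (\<chi> \<alpha> \<beta>. 1/2 *
     (weak_partial \<omega> \<alpha> (fst u \<beta>) y + weak_partial \<omega> \<beta> (fst u \<alpha>) y
      + weak_partial \<omega> \<alpha> (snd u) y * weak_partial \<omega> \<beta> (snd u) y))"

end

theory Submission
  imports Defs
begin

text \<open>
  Let $a$ be the unit vector along $e$ and $b$ orthogonal to $a$.  Contracting the strain with
  $a \otimes a$ gives $\partial_a(u \cdot a) = -\frac12(\partial_a u_3)^2$, and the left-hand side has
  integral $\int_{\partial\omega}(u \cdot a)(\nu \cdot a) = 0$; hence $\partial_a u_3 = 0$ and
  $\partial_a(u \cdot a) = 0$.  A function with $\partial_a v = 0$ and $v(\nu \cdot a) = 0$ on
  $\partial\omega$ vanishes, since
  $\int_\omega v^2 = \int_{\partial\omega}(a \cdot x)v^2(\nu \cdot a)$.  So $u \cdot a = 0$; the mixed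
  component of the strain then gives $\partial_a(u \cdot b) = 0$, so $u \cdot b = 0$, and the
  $b \otimes b$ component gives $\partial_b u_3 = 0$.

  Instead of the Gauss--Green formula it suffices to bound, on almost every line parallel to $a$,
  the integral of $\partial_a F$ over the slice of $\omega$ by the sum of $|F|$ over the boundary
  points on that line.  The integral of such sums over all lines is controlled by the arc-length
  integral of $|F|$ (Eilenberg's inequality), and the boundary points with $\nu \cdot a = 0$ lie on a
  null set of lines (Sard), so a trace $g$ with $g\,(\nu \cdot a) = 0$ vanishes at all boundary
  points of almost every line.
\<close>

section \<open>Convergence in the mean square\<close>

text \<open>The trace is known to vanish only where the normal is not orthogonal to a. A side of the
  boundary parallel to a may carry any trace, so the arc-length integral of |F| alone gives nothing;
  such a side is harmless because it meets only a null set of the lines. The smooth functions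
  approximating the trace need not vanish on the boundary either, but at the boundary points of
  almost every line their modulus is the distance from the trace, which tends to 0 in the mean. Only
  limits equal to 0 are drawn from these bounds, so the constants in them do not matter.

  Passing from u . a = 0 to a vanishing derivative of u . a along b needs an argument of its own,
  since the derivative field is handled only as a limit in the mean: this is closability of the
  directional derivative, obtained by slicing once more, with cutoff functions of boxes.

  The start is the component along a twice, because its nonlinear term is a square and is therefore
  determined by a zero integral. After that the mixed component is linear, and in the last one the
  square is left alone.\<close>

definition L2conv :: "'a measure \<Rightarrow> (nat \<Rightarrow> 'a \<Rightarrow> real) \<Rightarrow> ('a \<Rightarrow> real) \<Rightarrow> bool" where
  "L2conv M F f \<longleftrightarrow> (\<forall>n. F n \<in> square_integrable M) \<and> f \<in> square_integrable M \<and> tendsto_L2 M F f"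

lemma square_integrable_measurable: "f \<in> square_integrable M \<Longrightarrow> f \<in> borel_measurable M"
  by (simp add: square_integrable_def)

lemma square_integrable_mult:
  assumes f: "f \<in> square_integrable M" and g: "g \<in> square_integrable M"
  shows "integrable M (\<lambda>x. f x * g x)"
proof (rule Bochner_Integration.integrable_bound)
  show "integrable M (\<lambda>x. (f x)\<^sup>2 + (g x)\<^sup>2)"
    using f g by (simp add: square_integrable_def)
  show "(\<lambda>x. f x * g x) \<in> borel_measurable M"
    by (intro borel_measurable_times square_integrable_measurable f g)
  have "\<bar>a * b\<bar> \<le> a\<^sup>2 + b\<^sup>2" for a b :: real
  proof -
    have "2 * (\<bar>a\<bar> * \<bar>b\<bar>) \<le> a\<^sup>2 + b\<^sup>2" "0 \<le> \<bar>a\<bar> * \<bar>b\<bar>"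
      using sum_squares_bound[of "\<bar>a\<bar>" "\<bar>b\<bar>"] by auto
    then show ?thesis unfolding abs_mult by linarith
  qed
  then show "AE x in M. norm (f x * g x) \<le> norm ((f x)\<^sup>2 + (g x)\<^sup>2)"
    by simp
qed

lemma square_integrable_cmult:
  assumes f: "f \<in> square_integrable M"
    and b: "b \<in> borel_measurable M" "\<And>x. x \<in> space M \<Longrightarrow> \<bar>b x\<bar> \<le> C"
  shows "(\<lambda>x. b x * f x) \<in> square_integrable M"
proof -
  have "integrable M (\<lambda>x. (b x * f x)\<^sup>2)"
  proof (rule Bochner_Integration.integrable_bound)
    show "integrable M (\<lambda>x. C\<^sup>2 * (f x)\<^sup>2)"
      using f by (simp add: square_integrable_def)
    show "(\<lambda>x. (b x * f x)\<^sup>2) \<in> borel_measurable M"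
      by (intro borel_measurable_power borel_measurable_times square_integrable_measurable f b)
    show "AE x in M. norm ((b x * f x)\<^sup>2) \<le> norm (C\<^sup>2 * (f x)\<^sup>2)"
      using b by (intro AE_I2) (auto simp: power_mult_distrib abs_le_square_iff[symmetric] intro!: mult_right_mono order_trans[OF _ abs_ge_self])
  qed
  moreover have "(\<lambda>x. b x * f x) \<in> borel_measurable M"
    by (intro borel_measurable_times square_integrable_measurable f b)
  ultimately show ?thesis
    by (simp add: square_integrable_def)
qed

lemma square_integrable_add:
  assumes f: "f \<in> square_integrable M" and g: "g \<in> square_integrable M"
  shows "(\<lambda>x. f x + g x) \<in> square_integrable M"
proof -
  have "integrable M (\<lambda>x. (f x)\<^sup>2 + 2 * (f x * g x) + (g x)\<^sup>2)"
    using f g square_integrable_mult[OF f g] by (simp add: square_integrable_def)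
  moreover have "(\<lambda>x. f x + g x) \<in> borel_measurable M"
    by (intro borel_measurable_add square_integrable_measurable f g)
  ultimately show ?thesis
    by (simp add: square_integrable_def power2_sum algebra_simps)
qed

lemma square_integrable_scale:
  "f \<in> square_integrable M \<Longrightarrow> (\<lambda>x. c * f x) \<in> square_integrable M"
  by (rule square_integrable_cmult[where C="\<bar>c\<bar>"]) auto

lemma square_integrable_diff:
  assumes f: "f \<in> square_integrable M" and g: "g \<in> square_integrable M"
  shows "(\<lambda>x. f x - g x) \<in> square_integrable M"
  using square_integrable_add[OF f square_integrable_scale[OF g, of "-1"]] by simp

lemma square_integrable_sum:
  "(\<And>i. i \<in> I \<Longrightarrow> f i \<in> square_integrable M) \<Longrightarrow> (\<lambda>x. \<Sum>i\<in>I. f i x) \<in> square_integrable M"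
proof (induction I rule: infinite_finite_induct)
  case (insert i I)
  then show ?case using square_integrable_add[of "f i" M "\<lambda>x. \<Sum>i\<in>I. f i x"] by simp
qed (auto simp: square_integrable_def)

lemma (in finite_measure) square_integrable_bounded:
  assumes "f \<in> borel_measurable M" "\<And>x. x \<in> space M \<Longrightarrow> \<bar>f x\<bar> \<le> C"
  shows "f \<in> square_integrable M"
  using square_integrable_cmult[of "\<lambda>_. 1" M f C] assms by (simp add: square_integrable_def)

text \<open>\<open>tendsto_L2\<close> uses the nonnegative integral and by itself implies no
  integrability. The square integrability bundled into \<open>L2conv\<close> makes the distances
  finite, so that limits can be computed with Bochner integrals.\<close>

lemma tendsto_L2_iff:
  assumes F: "\<And>n. F n \<in> square_integrable M" and f: "f \<in> square_integrable M"
  shows "tendsto_L2 M F f \<longleftrightarrow> (\<lambda>n. \<integral>x. (F n x - f x)\<^sup>2 \<partial>M) \<longlonglongrightarrow> 0"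
proof -
  have "(\<integral>\<^sup>+x. ennreal ((F n x - f x)\<^sup>2) \<partial>M) = ennreal (\<integral>x. (F n x - f x)\<^sup>2 \<partial>M)" for n
    using square_integrable_diff[OF F[of n] f]
    by (intro nn_integral_eq_integral) (auto simp: square_integrable_def)
  then show ?thesis
    unfolding tendsto_L2_def by (simp flip: ennreal_0 add: tendsto_ennreal_iff)
qed

lemma L2conv_iff:
  "L2conv M F f \<longleftrightarrow> (\<forall>n. F n \<in> square_integrable M) \<and> f \<in> square_integrable M \<and>
     (\<lambda>n. \<integral>x. (F n x - f x)\<^sup>2 \<partial>M) \<longlonglongrightarrow> 0"
  unfolding L2conv_def using tendsto_L2_iff by blast

lemma L2conv_const: "f \<in> square_integrable M \<Longrightarrow> L2conv M (\<lambda>_. f) f"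
  by (simp add: L2conv_iff)

lemma L2conv_cmult:
  assumes F: "L2conv M F f"
    and b: "b \<in> borel_measurable M" "\<And>x. x \<in> space M \<Longrightarrow> \<bar>b x\<bar> \<le> C"
  shows "L2conv M (\<lambda>n x. b x * F n x) (\<lambda>x. b x * f x)"
proof -
  have sq: "F n \<in> square_integrable M" "f \<in> square_integrable M" for n
    using F by (auto simp: L2conv_iff)
  note d = square_integrable_diff[OF sq]
  have "(\<lambda>n. \<integral>x. (b x * F n x - b x * f x)\<^sup>2 \<partial>M) \<longlonglongrightarrow> 0"
  proof (rule Lim_null_comparison)
    show "\<forall>\<^sub>F n in sequentially. norm (\<integral>x. (b x * F n x - b x * f x)\<^sup>2 \<partial>M) \<le> C\<^sup>2 * (\<integral>x. (F n x - f x)\<^sup>2 \<partial>M)"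
    proof (rule always_eventually, rule allI)
      fix n
      have "(\<integral>x. (b x * F n x - b x * f x)\<^sup>2 \<partial>M) \<le> (\<integral>x. C\<^sup>2 * (F n x - f x)\<^sup>2 \<partial>M)"
      proof (rule integral_mono)
        show "integrable M (\<lambda>x. (b x * F n x - b x * f x)\<^sup>2)"
          using square_integrable_cmult[OF d b] by (simp add: square_integrable_def right_diff_distrib)
        show "integrable M (\<lambda>x. C\<^sup>2 * (F n x - f x)\<^sup>2)"
          using d by (simp add: square_integrable_def)
        show "(b x * F n x - b x * f x)\<^sup>2 \<le> C\<^sup>2 * (F n x - f x)\<^sup>2" if "x \<in> space M" for x
          using b(2)[OF that]
          by (simp add: right_diff_distrib[symmetric] power_mult_distrib abs_le_square_iff[symmetric] mult_right_mono)
      qed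
      then show "norm (\<integral>x. (b x * F n x - b x * f x)\<^sup>2 \<partial>M) \<le> C\<^sup>2 * (\<integral>x. (F n x - f x)\<^sup>2 \<partial>M)"
        by (simp add: integral_nonneg_AE)
    qed
    show "(\<lambda>n. C\<^sup>2 * (\<integral>x. (F n x - f x)\<^sup>2 \<partial>M)) \<longlonglongrightarrow> 0"
      using F tendsto_mult_left[of _ 0 sequentially "C\<^sup>2"] by (simp add: L2conv_iff)
  qed
  then show ?thesis
    unfolding L2conv_iff using square_integrable_cmult[OF _ b] sq by blast
qed

lemma L2conv_scale: "L2conv M F f \<Longrightarrow> L2conv M (\<lambda>n x. c * F n x) (\<lambda>x. c * f x)"
  by (rule L2conv_cmult[where C="\<bar>c\<bar>"]) auto

lemma L2conv_add:
  assumes F: "L2conv M F f" and G: "L2conv M G g"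
  shows "L2conv M (\<lambda>n x. F n x + G n x) (\<lambda>x. f x + g x)"
proof -
  have sq: "F n \<in> square_integrable M" "f \<in> square_integrable M"
    "G n \<in> square_integrable M" "g \<in> square_integrable M" for n
    using F G by (auto simp: L2conv_iff)
  note d = square_integrable_diff[OF sq(1,2)] square_integrable_diff[OF sq(3,4)]
  have "(\<lambda>n. \<integral>x. (F n x + G n x - (f x + g x))\<^sup>2 \<partial>M) \<longlonglongrightarrow> 0"
  proof (rule Lim_null_comparison)
    let ?R = "\<lambda>n. 2 * (\<integral>x. (F n x - f x)\<^sup>2 \<partial>M) + 2 * (\<integral>x. (G n x - g x)\<^sup>2 \<partial>M)"
    show "\<forall>\<^sub>F n in sequentially. norm (\<integral>x. (F n x + G n x - (f x + g x))\<^sup>2 \<partial>M) \<le> ?R n"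
    proof (rule always_eventually, rule allI)
      fix n
      have "(\<integral>x. (F n x + G n x - (f x + g x))\<^sup>2 \<partial>M)
          \<le> (\<integral>x. 2 * (F n x - f x)\<^sup>2 + 2 * (G n x - g x)\<^sup>2 \<partial>M)"
      proof (rule integral_mono)
        show "integrable M (\<lambda>x. (F n x + G n x - (f x + g x))\<^sup>2)"
          using square_integrable_add[OF d(1)[of n] d(2)[of n]] by (simp add: square_integrable_def algebra_simps)
        show "integrable M (\<lambda>x. 2 * (F n x - f x)\<^sup>2 + 2 * (G n x - g x)\<^sup>2)"
          using d by (simp add: square_integrable_def)
        have "(a + b - (c + e))\<^sup>2 \<le> 2 * (a - c)\<^sup>2 + 2 * (b - e)\<^sup>2" for a b c e :: real
        proof -
          have "2 * (a - c)\<^sup>2 + 2 * (b - e)\<^sup>2 - (a + b - (c + e))\<^sup>2 = ((a - c) - (b - e))\<^sup>2"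
            by (simp add: power2_eq_square algebra_simps)
          then show ?thesis by (metis diff_ge_0_iff_ge zero_le_power2)
        qed
        then show "(F n x + G n x - (f x + g x))\<^sup>2 \<le> 2 * (F n x - f x)\<^sup>2 + 2 * (G n x - g x)\<^sup>2" for x .
      qed
      also have "\<dots> = ?R n"
        using d by (simp add: square_integrable_def)
      finally show "norm (\<integral>x. (F n x + G n x - (f x + g x))\<^sup>2 \<partial>M) \<le> ?R n"
        by (simp add: integral_nonneg_AE)
    qed
    show "?R \<longlonglongrightarrow> 0"
      using F G by (auto simp: L2conv_iff intro!: tendsto_eq_intros)
  qed
  then show ?thesis
    unfolding L2conv_iff using square_integrable_add sq by blast
qed

lemma L2conv_sum:
  "(\<And>i. i \<in> I \<Longrightarrow> L2conv M (F i) (f i)) \<Longrightarrow> L2conv M (\<lambda>n x. \<Sum>i\<in>I. F i n x) (\<lambda>x. \<Sum>i\<in>I. f i x)"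
proof (induction I rule: infinite_finite_induct)
  case (insert i I)
  then show ?case using L2conv_add[of M "F i" "f i" "\<lambda>n x. \<Sum>i\<in>I. F i n x"] by simp
qed (auto simp: L2conv_iff square_integrable_def)

text \<open>From a^2 - b^2 = (a - b)^2 + 2 (a - b) b and Young's inequality, |a^2 - b^2| is at most
  (1 + 1/\<epsilon>) (a - b)^2 + \<epsilon> b^2. This pointwise bound takes the place of the
  triangle inequality for the norm.\<close>

lemma L2conv_integral_square:
  assumes "L2conv M F f"
  shows "(\<lambda>n. \<integral>x. (F n x)\<^sup>2 \<partial>M) \<longlonglongrightarrow> (\<integral>x. (f x)\<^sup>2 \<partial>M)"
proof -
  have sq: "F n \<in> square_integrable M" "f \<in> square_integrable M" for n
    using assms by (auto simp: L2conv_iff)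
  note d = square_integrable_diff[OF sq]
  define K where "K = (\<integral>x. (f x)\<^sup>2 \<partial>M)"
  have K: "0 \<le> K" by (simp add: K_def integral_nonneg_AE)
  have bound: "\<bar>(\<integral>x. (F n x)\<^sup>2 \<partial>M) - K\<bar> \<le> (1 + 1/\<epsilon>) * (\<integral>x. (F n x - f x)\<^sup>2 \<partial>M) + \<epsilon> * K"
    if "0 < \<epsilon>" for n \<epsilon>
  proof -
    have "\<bar>(\<integral>x. (F n x)\<^sup>2 \<partial>M) - K\<bar> = \<bar>\<integral>x. (F n x)\<^sup>2 - (f x)\<^sup>2 \<partial>M\<bar>"
      using sq by (simp add: K_def square_integrable_def)
    also have "\<dots> \<le> (\<integral>x. \<bar>(F n x)\<^sup>2 - (f x)\<^sup>2\<bar> \<partial>M)"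
      by (rule integral_abs_bound)
    also have "\<dots> \<le> (\<integral>x. (1 + 1/\<epsilon>) * (F n x - f x)\<^sup>2 + \<epsilon> * (f x)\<^sup>2 \<partial>M)"
    proof (rule integral_mono)
      show "integrable M (\<lambda>x. \<bar>(F n x)\<^sup>2 - (f x)\<^sup>2\<bar>)"
        "integrable M (\<lambda>x. (1 + 1/\<epsilon>) * (F n x - f x)\<^sup>2 + \<epsilon> * (f x)\<^sup>2)"
        using sq d by (auto simp: square_integrable_def)
      have "\<bar>a\<^sup>2 - b\<^sup>2\<bar> \<le> (1 + 1/\<epsilon>) * (a - b)\<^sup>2 + \<epsilon> * b\<^sup>2" for a b :: real
      proof -
        have "2 * ((a - b) * b) \<le> (a - b)\<^sup>2 / \<epsilon> + \<epsilon> * b\<^sup>2" "- (2 * ((a - b) * b)) \<le> (a - b)\<^sup>2 / \<epsilon> + \<epsilon> * b\<^sup>2"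
        proof -
          have "0 \<le> (1/\<epsilon>) * ((a - b) - \<epsilon> * b)\<^sup>2" "0 \<le> (1/\<epsilon>) * ((a - b) + \<epsilon> * b)\<^sup>2"
            using that by auto
          moreover have "(1/\<epsilon>) * ((a - b) - \<epsilon> * b)\<^sup>2 = (a - b)\<^sup>2 / \<epsilon> + \<epsilon> * b\<^sup>2 - 2 * ((a - b) * b)"
            "(1/\<epsilon>) * ((a - b) + \<epsilon> * b)\<^sup>2 = (a - b)\<^sup>2 / \<epsilon> + \<epsilon> * b\<^sup>2 + 2 * ((a - b) * b)"
            using that by (simp_all add: field_simps power2_eq_square)
          ultimately show "2 * ((a - b) * b) \<le> (a - b)\<^sup>2 / \<epsilon> + \<epsilon> * b\<^sup>2" "- (2 * ((a - b) * b)) \<le> (a - b)\<^sup>2 / \<epsilon> + \<epsilon> * b\<^sup>2"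
            by linarith+
        qed
        moreover have "a\<^sup>2 - b\<^sup>2 = (a - b)\<^sup>2 + 2 * ((a - b) * b)"
          by (simp add: power2_eq_square algebra_simps)
        moreover have "(1 + 1/\<epsilon>) * (a - b)\<^sup>2 = (a - b)\<^sup>2 + (a - b)\<^sup>2 / \<epsilon>"
          by (simp add: algebra_simps)
        moreover have "0 \<le> (a - b)\<^sup>2" by simp
        ultimately show ?thesis by linarith
      qed
      then show "\<bar>(F n x)\<^sup>2 - (f x)\<^sup>2\<bar> \<le> (1 + 1/\<epsilon>) * (F n x - f x)\<^sup>2 + \<epsilon> * (f x)\<^sup>2" for x .
    qed
    also have "\<dots> = (1 + 1/\<epsilon>) * (\<integral>x. (F n x - f x)\<^sup>2 \<partial>M) + \<epsilon> * K"
      using sq d by (simp add: K_def square_integrable_def)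
    finally show ?thesis .
  qed
  show ?thesis
  proof (rule LIMSEQ_I)
    fix r :: real assume r: "0 < r"
    \<comment> \<open>The summand 1 keeps the denominator positive when K = 0; the choice makes the
      term \<epsilon> K at most r/2.\<close>
    define \<epsilon> where "\<epsilon> = r / (2 * (K + 1))"
    have \<epsilon>: "0 < \<epsilon>" using r K by (simp add: \<epsilon>_def)
    have "\<epsilon> * K \<le> r / 2" using r K by (simp add: \<epsilon>_def field_simps)
    have "(\<lambda>n. (1 + 1/\<epsilon>) * (\<integral>x. (F n x - f x)\<^sup>2 \<partial>M)) \<longlonglongrightarrow> 0"
      using assms tendsto_mult_left[of _ 0 sequentially "1 + 1/\<epsilon>"] by (simp add: L2conv_iff)
    then have "\<forall>\<^sub>F n in sequentially. (1 + 1/\<epsilon>) * (\<integral>x. (F n x - f x)\<^sup>2 \<partial>M) < r / 2"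
      using r by (intro order_tendstoD(2)) auto
    then have "\<forall>\<^sub>F n in sequentially. norm ((\<integral>x. (F n x)\<^sup>2 \<partial>M) - (\<integral>x. (f x)\<^sup>2 \<partial>M)) < r"
    proof eventually_elim
      case (elim n)
      then show ?case
        using bound[OF \<epsilon>, of n] \<open>\<epsilon> * K \<le> r / 2\<close> unfolding K_def[symmetric] real_norm_def by linarith
    qed
    then show "\<exists>no. \<forall>n\<ge>no. norm ((\<integral>x. (F n x)\<^sup>2 \<partial>M) - (\<integral>x. (f x)\<^sup>2 \<partial>M)) < r"
      by (simp add: eventually_sequentially)
  qed
qed

text \<open>Polarization reduces products to squares.\<close>

lemma L2conv_integral_mult:
  assumes F: "L2conv M F f" and G: "L2conv M G g"
  shows "(\<lambda>n. \<integral>x. F n x * G n x \<partial>M) \<longlonglongrightarrow> (\<integral>x. f x * g x \<partial>M)"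
proof -
  have sq: "F n \<in> square_integrable M" "f \<in> square_integrable M"
    "G n \<in> square_integrable M" "g \<in> square_integrable M" for n
    using F G by (auto simp: L2conv_iff)
  have pol: "(\<integral>x. (a x + b x)\<^sup>2 \<partial>M) - (\<integral>x. (a x)\<^sup>2 \<partial>M) - (\<integral>x. (b x)\<^sup>2 \<partial>M) = 2 * (\<integral>x. a x * b x \<partial>M)"
    if "a \<in> square_integrable M" "b \<in> square_integrable M" for a b
    using that square_integrable_mult[OF that]
    by (simp add: power2_sum square_integrable_def mult.assoc)
  have "(\<lambda>n. ((\<integral>x. (F n x + G n x)\<^sup>2 \<partial>M) - (\<integral>x. (F n x)\<^sup>2 \<partial>M) - (\<integral>x. (G n x)\<^sup>2 \<partial>M)) / 2)
      \<longlonglongrightarrow> ((\<integral>x. (f x + g x)\<^sup>2 \<partial>M) - (\<integral>x. (f x)\<^sup>2 \<partial>M) - (\<integral>x. (g x)\<^sup>2 \<partial>M)) / 2"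
    by (intro tendsto_intros L2conv_integral_square F G L2conv_add) simp
  then show ?thesis using pol sq by simp
qed

lemma square_integral_zero_AE:
  assumes "f \<in> square_integrable M" "(\<integral>x. (f x)\<^sup>2 \<partial>M) = 0"
  shows "AE x in M. f x = 0"
  using assms integral_nonneg_eq_0_iff_AE[of M "\<lambda>x. (f x)\<^sup>2"] by (simp add: square_integrable_def)

section \<open>Integrals of derivatives over slices\<close>

text \<open>An endpoint belonging to \<open>U\<close> could be added to the component without
  destroying connectedness, against maximality. As limits of points of \<open>U\<close> the
  endpoints therefore lie on its frontier.\<close>

lemma component_open_bounded_real:
  fixes U :: "real set"
  assumes "open U" "bounded U" "c \<in> components U"
  shows "c = {Inf c<..<Sup c} \<and> Inf c < Sup c \<and> Inf c \<in> frontier U \<and> Sup c \<in> frontier U"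
proof -
  have c: "open c" "connected c" "c \<noteq> {}" "c \<subseteq> U"
    using assms by (auto simp: open_components in_components_connected in_components_nonempty in_components_subset)
  have bc: "bounded c" using c assms bounded_subset by blast
  have bdd: "bdd_above c" "bdd_below c" using bc bounded_imp_bdd_above bounded_imp_bdd_below by auto
  have ninf: "x \<noteq> Inf c" "x \<noteq> Sup c" if x: "x \<in> c" for x
  proof -
    obtain e where e: "e > 0" "ball x e \<subseteq> c" using openE[OF c(1) x] by metis
    then have "x - e/2 \<in> c" "x + e/2 \<in> c" by (force simp: dist_real_def)+
    then have "Inf c \<le> x - e/2" "x + e/2 \<le> Sup c" by (auto intro: cInf_lower cSup_upper bdd)
    then show "x \<noteq> Inf c" "x \<noteq> Sup c" using e by auto
  qed
  have eq: "c = {Inf c<..<Sup c}"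
  proof (intro set_eqI iffI)
    fix x assume x: "x \<in> c"
    then have "Inf c \<le> x" "x \<le> Sup c" by (auto intro: cInf_lower cSup_upper bdd)
    then show "x \<in> {Inf c<..<Sup c}" using ninf[OF x] by auto
  next
    fix x assume x: "x \<in> {Inf c<..<Sup c}"
    obtain y z where "y \<in> c" "y < x" "z \<in> c" "x < z"
      using x cInf_less_iff[OF c(3) bdd(2)] less_cSup_iff[OF c(3) bdd(1)] by auto
    then show "x \<in> c"
      using connectedD_interval[OF c(2), of y z x] by auto
  qed
  then have lt: "Inf c < Sup c" using c(3) by (metis greaterThanLessThan_empty not_less)
  have cl: "Inf c \<in> closure U" "Sup c \<in> closure U"
    using closure_contains_Inf[OF c(3) bdd(2)] closure_contains_Sup[OF c(3) bdd(1)] closure_mono[OF c(4)] by auto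
  obtain m where mid: "m \<in> c" "Inf c < m" "m < Sup c"
    using c(3) eq by (metis ex_in_conv greaterThanLessThan_iff)
  have "Inf c \<notin> U"
  proof
    assume "Inf c \<in> U"
    moreover have "connected {Inf c..<Sup c}" by simp
    ultimately have "{Inf c..<Sup c} \<subseteq> c"
      using lt c(4) eq mid
      by (intro components_maximal[OF assms(3)]) (fastforce simp: less_le)+
    then show False using lt ninf(1)[of "Inf c"] by auto
  qed
  moreover have "Sup c \<notin> U"
  proof
    assume "Sup c \<in> U"
    moreover have "connected {Inf c<..Sup c}" by simp
    ultimately have "{Inf c<..Sup c} \<subseteq> c"
      using lt c(4) eq mid
      by (intro components_maximal[OF assms(3)]) (fastforce simp: less_le)+
    then show False using lt ninf(2)[of "Sup c"] by auto
  qed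
  ultimately show ?thesis
    using eq lt cl assms(1) by (auto simp: frontier_def interior_open)
qed

text \<open>Relabels sums of nonnegative terms: from components to their endpoints, from points of a
  line to points of the plane, and from a fibre of the frontier to the whole fibre of a
  projection.\<close>

lemma nn_integral_count_space_inj_le:
  fixes f :: "'b \<Rightarrow> ennreal"
  assumes "inj_on g A" "g ` A \<subseteq> B"
  shows "(\<integral>\<^sup>+x. f (g x) \<partial>count_space A) \<le> (\<integral>\<^sup>+y. f y \<partial>count_space B)"
proof -
  have "(\<integral>\<^sup>+x. f (g x) \<partial>count_space A) = (\<integral>\<^sup>+y. f y \<partial>count_space (g ` A))"
    by (rule nn_integral_bij_count_space) (use assms in \<open>auto intro: inj_on_imp_bij_betw\<close>)
  also have "\<dots> = (\<integral>\<^sup>+y. f y * indicator (g ` A) y \<partial>count_space UNIV)"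
    by (simp add: nn_integral_count_space_indicator)
  also have "\<dots> \<le> (\<integral>\<^sup>+y. f y * indicator B y \<partial>count_space UNIV)"
    using assms by (intro nn_integral_mono) (auto simp: indicator_def)
  finally show ?thesis by (simp add: nn_integral_count_space_indicator)
qed

text \<open>A boundary point is an endpoint of at most two components of \<open>U\<close>, whence the factor 2.\<close>

lemma FTC_open_set_bound:
  fixes F D :: "real \<Rightarrow> real"
  assumes U: "open U" "bounded U"
    and F: "\<And>s. (F has_real_derivative D s) (at s)" and D: "continuous_on UNIV D"
  shows "ennreal \<bar>LINT s:U|lborel. D s\<bar> \<le> 2 * (\<integral>\<^sup>+s. ennreal \<bar>F s\<bar> \<partial>count_space (frontier U))"
proof -
  let ?C = "components U"
  have countC: "countable ?C"
  proof (rule countable_disjoint_open_subsets)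
    show "\<And>S. S \<in> ?C \<Longrightarrow> open S" using U open_components by blast
    show "disjoint ?C" using components_nonoverlap by (auto simp: disjoint_def)
  qed
  note comp = component_open_bounded_real[OF U]
  have intU: "set_integrable lborel U D"
  proof -
    obtain a b where "U \<subseteq> cbox a b" using bounded_subset_cbox_symmetric[OF U(2)] by blast
    moreover have "set_integrable lborel (cbox a b) D"
      unfolding set_integrable_def
      by (rule borel_integrable_compact) (auto intro: continuous_on_subset[OF D])
    ultimately show ?thesis
      using U(1) by (auto intro: set_integrable_subset)
  qed
  have int_c: "\<bar>LINT s:c|lborel. D s\<bar> \<le> \<bar>F (Sup c)\<bar> + \<bar>F (Inf c)\<bar>" if c: "c \<in> ?C" for c
  proof -
    let ?a = "Inf c" and ?b = "Sup c"
    have ab: "c = {?a<..<?b}" "?a < ?b" using comp[OF c] by auto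
    have "(LINT s:{?a..?b}|lborel. D s) = F ?b - F ?a"
      unfolding set_lebesgue_integral_def
      using ab F by (intro integral_FTC_Icc)
       (auto intro: continuous_on_subset[OF D] simp: has_real_derivative_iff_has_vector_derivative
             intro: has_vector_derivative_at_within)
    moreover have "(LINT s:{?a..?b}|lborel. D s) = (LINT s:{?a<..<?b}|lborel. D s)"
      unfolding set_lebesgue_integral_def
    proof (rule integral_cong_AE)
      have "AE s in lborel. s \<noteq> ?a" "AE s in lborel. s \<noteq> ?b" by (auto intro: AE_lborel_singleton)
      then show "AE s in lborel. indicator {?a..?b} s *\<^sub>R D s = indicator {?a<..<?b} s *\<^sub>R D s"
        by eventually_elim (auto simp: indicator_def)
    qed (use borel_measurable_continuous_onI[OF D] in auto)
    ultimately show ?thesis using ab by (metis abs_triangle_ineq4)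
  qed
  show ?thesis
  proof (cases "?C = {}")
    case True
    then have "U = {}" by simp
    then show ?thesis by (simp add: set_lebesgue_integral_def)
  next
    case False
    \<comment> \<open>Indices that belong to no component get the empty set:
      \<open>from_nat_into\<close> would return some component there, and the family would no longer
      be disjoint.\<close>
    define A where "A n = (if \<exists>c\<in>?C. to_nat_on ?C c = n then from_nat_into ?C n else {})" for n
    have A: "A (to_nat_on ?C c) = c" if "c \<in> ?C" for c
      using that countC by (auto simp: A_def)
    have A': "A n \<in> ?C" if "A n \<noteq> {}" for n
      using that False by (auto simp: A_def from_nat_into split: if_splits)
    have An: "to_nat_on ?C c = n" if c: "c \<in> ?C" and eq: "A n = c" for n c
    proof -
      have "A n \<noteq> {}" using eq in_components_nonempty[OF c] by simp
      then obtain c' where c': "c' \<in> ?C" "to_nat_on ?C c' = n"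
        unfolding A_def by (metis (lifting))
      then show ?thesis using A[OF c'(1)] eq by simp
    qed
    have UA: "(\<Union>n. A n) = U"
    proof -
      have "\<Union>?C \<subseteq> (\<Union>n. A n)" using A by (metis UN_upper UNIV_I Union_least)
      moreover have "A n \<subseteq> U" for n
        using A'[of n] in_components_subset by (cases "A n = {}") auto
      ultimately show ?thesis using Union_components[of U] by auto
    qed
    have meas: "A n \<in> sets lborel" for n
      using A'[of n] open_components[OF U(1)] by (cases "A n = {}") auto
    have disj: "A i \<inter> A j = {}" if "i \<noteq> j" for i j
    proof (cases "A i = {} \<or> A j = {}")
      case False
      then have "A i \<in> ?C" "A j \<in> ?C" using A' by auto
      moreover have "A i \<noteq> A j" using An that calculation by metis
      ultimately show ?thesis using components_nonoverlap by metis
    qed auto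
    \<comment> \<open>The empty set is treated apart because the values of \<open>F\<close> at
      \<open>Sup {}\<close> and \<open>Inf {}\<close> must not be counted.\<close>
    define w where "w n = (if A n = {} then 0 else ennreal \<bar>F (Sup (A n))\<bar> + ennreal \<bar>F (Inf (A n))\<bar>)" for n
    have w: "ennreal \<bar>LINT s:A n|lborel. D s\<bar> \<le> w n" for n
      using int_c[of "A n"] A'[of n] by (auto simp: w_def set_lebesgue_integral_def simp flip: ennreal_plus intro: ennreal_leI)
    have "ennreal \<bar>LINT s:U|lborel. D s\<bar> \<le> (\<Sum>n. ennreal \<bar>LINT s:A n|lborel. D s\<bar>)"
    \<comment> \<open>A divergent series makes the bound trivial; otherwise the series is absolutely
      summable and the triangle inequality for series applies.\<close>
    proof (cases "(\<Sum>n. ennreal \<bar>LINT s:A n|lborel. D s\<bar>) = top")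
      case False
      have s: "summable (\<lambda>n. \<bar>LINT s:A n|lborel. D s\<bar>)"
        using False by (intro summable_suminf_not_top) auto
      have "(LINT s:U|lborel. D s) = (\<Sum>n. LINT s:A n|lborel. D s)"
        using lebesgue_integral_countable_add[where f=D and A=A, OF meas disj] intU by (simp add: UA)
      also have "\<bar>\<dots>\<bar> \<le> (\<Sum>n. \<bar>LINT s:A n|lborel. D s\<bar>)"
        by (rule summable_rabs[OF s])
      finally show ?thesis
        using s by (subst suminf_ennreal2) (auto intro: ennreal_leI)
    qed simp
    also have "\<dots> \<le> (\<Sum>n. w n)" by (intro suminf_le w) auto
    also have "\<dots> = (\<integral>\<^sup>+n. w n \<partial>count_space UNIV)"
      by (simp add: nn_integral_count_space_nat)
    also have "\<dots> = (\<integral>\<^sup>+n. w n \<partial>count_space (to_nat_on ?C ` ?C))"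
    proof (rule nn_integral_count_space_eq)
      fix n assume n: "n \<in> UNIV - to_nat_on ?C ` ?C"
      have "A n = {}"
      proof (rule ccontr)
        assume "A n \<noteq> {}"
        then have "A n \<in> ?C" by (rule A')
        then have "n = to_nat_on ?C (A n)" using An by simp
        then show False using n \<open>A n \<in> ?C\<close> by blast
      qed
      then show "w n = 0" by (simp add: w_def)
    qed auto
    also have "\<dots> = (\<integral>\<^sup>+c. w (to_nat_on ?C c) \<partial>count_space ?C)"
      using countC by (subst nn_integral_bij_count_space[symmetric]) (auto intro!: inj_on_imp_bij_betw)
    also have "\<dots> = (\<integral>\<^sup>+c. ennreal \<bar>F (Sup c)\<bar> + ennreal \<bar>F (Inf c)\<bar> \<partial>count_space ?C)"
      by (rule nn_integral_cong) (use in_components_nonempty in \<open>auto simp: w_def A\<close>)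
    also have "\<dots> = (\<integral>\<^sup>+c. ennreal \<bar>F (Sup c)\<bar> \<partial>count_space ?C) + (\<integral>\<^sup>+c. ennreal \<bar>F (Inf c)\<bar> \<partial>count_space ?C)"
      by (rule nn_integral_add) auto
    also have "\<dots> \<le> (\<integral>\<^sup>+s. ennreal \<bar>F s\<bar> \<partial>count_space (frontier U)) + (\<integral>\<^sup>+s. ennreal \<bar>F s\<bar> \<partial>count_space (frontier U))"
    proof -
      have inj: "inj_on Inf ?C" "inj_on Sup ?C"
      proof -
        have "c = c'" if c: "c \<in> ?C" "c' \<in> ?C" and "Inf c = Inf c' \<or> Sup c = Sup c'" for c c'
        proof -
          have "c \<inter> c' \<noteq> {}"
          proof (cases "Inf c = Inf c'")
            case True
            \<comment> \<open>The midpoint between the common left endpoint and the nearer right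
              endpoint lies in both intervals. The other case is the mirror image.\<close>
            then have "(Inf c + min (Sup c) (Sup c')) / 2 \<in> {Inf c<..<Sup c} \<inter> {Inf c'<..<Sup c'}"
              using comp[OF c(1)] comp[OF c(2)] by (auto simp: min_def field_simps)
            then show ?thesis using comp[OF c(1)] comp[OF c(2)] by auto
          next
            case False
            then have "(Sup c + max (Inf c) (Inf c')) / 2 \<in> {Inf c<..<Sup c} \<inter> {Inf c'<..<Sup c'}"
              using comp[OF c(1)] comp[OF c(2)] that(3) by (auto simp: max_def field_simps)
            then show ?thesis using comp[OF c(1)] comp[OF c(2)] by auto
          qed
          then show ?thesis using components_nonoverlap c by metis
        qed
        then show "inj_on Inf ?C" "inj_on Sup ?C" by (auto simp: inj_on_def)
      qed
      show ?thesis
        by (intro add_mono nn_integral_count_space_inj_le[where f="\<lambda>s. ennreal \<bar>F s\<bar>"]) (use inj comp in auto)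
    qed
    finally show ?thesis by (simp add: mult_2)
  qed
qed


section \<open>Lebesgue measure of the plane in orthonormal coordinates\<close>

lemma axis_basis_real2: "(Basis :: (real^2) set) = {axis 1 1, axis 2 1}"
  by (auto simp: Basis_vec_def) (metis exhaust_2)

text \<open>Lebesgue measure is determined by its values on boxes, and the preimage of a box is the
  box with the same side lengths. This connects \<open>real^2\<close> with the product measure, for
  which Fubini's theorem is available.\<close>

lemma distr_lborel_pair_axis:
  "distr (lborel :: (real \<times> real) measure) borel (\<lambda>(t, s). t *\<^sub>R axis 1 1 + s *\<^sub>R axis 2 1) = (lborel :: (real^2) measure)"
    (is "distr _ _ ?T = _")
proof (rule lborel_eqI[symmetric])
  fix l u :: "real^2" assume lu: "\<And>b. b \<in> Basis \<Longrightarrow> l \<bullet> b \<le> u \<bullet> b"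
  have T: "?T = (\<lambda>p. fst p *\<^sub>R axis 1 1 + snd p *\<^sub>R axis 2 1)"
    by (auto simp: fun_eq_iff)
  have meas: "?T \<in> borel_measurable lborel"
    unfolding T by (auto intro!: borel_measurable_continuous_onI continuous_intros)
  have ne: "axis 1 (1::real) \<noteq> (axis 2 1 :: real^2)"
    by (simp add: axis_eq_axis)
  have "box (l $ 1, l $ 2) (u $ 1, u $ 2) = box (l $ 1) (u $ 1) \<times> box (l $ 2) (u $ 2)"
    by (auto simp: box_def Basis_prod_def)
  then have "?T -` box l u = box (l $ 1, l $ 2) (u $ 1, u $ 2)"
    unfolding T by (auto simp: mem_box_cart forall_2 axis_def)
  then have "emeasure (distr lborel borel ?T) (box l u) = emeasure lborel (box (l $ 1, l $ 2) (u $ 1, u $ 2))"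
    using meas by (simp add: emeasure_distr)
  also have "\<dots> = (\<Prod>b\<in>Basis. (u - l) \<bullet> b)"
    using lu[of "axis 1 1"] lu[of "axis 2 1"] by (subst emeasure_lborel_box)
      (auto simp: Basis_prod_def axis_basis_real2 inner_axis ne mult.commute)
  finally show "emeasure (distr lborel borel ?T) (box l u) = (\<Prod>b\<in>Basis. (u - l) \<bullet> b)" .
qed simp

text \<open>The preimage of a box is a rotated or reflected box, so its measure is obtained from the
  invariance of Lebesgue measure under orthogonal images.\<close>

lemma distr_lborel_orthogonal:
  fixes R :: "real^2 \<Rightarrow> real^2"
  assumes R: "orthogonal_transformation R"
  shows "distr lborel borel R = lborel"
proof (rule lborel_eqI[symmetric])
  fix l u :: "real^2" assume lu: "\<And>b. b \<in> Basis \<Longrightarrow> l \<bullet> b \<le> u \<bullet> b"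
  have bij: "bij R" and R': "orthogonal_transformation (inv R)"
    using R by (auto simp: orthogonal_transformation_bij orthogonal_transformation_inv)
  have meas: "R \<in> borel_measurable lborel"
    using R by (auto intro!: borel_measurable_continuous_onI linear_continuous_on
        simp: orthogonal_transformation_linear linear_conv_bounded_linear[symmetric])
  have im: "R -` box l u = inv R ` box l u"
    by (rule bij_vimage_eq_inv_image[OF bij])
  have lm: "inv R ` box l u \<in> lmeasurable" "measure lebesgue (inv R ` box l u) = measure lebesgue (box l u)"
    using measurable_orthogonal_image[OF R'] measure_orthogonal_image[OF R'] by auto
  have "R -` box l u \<in> sets borel"
    using measurable_sets[OF meas, of "box l u"] by simp
  then have "emeasure (distr lborel borel R) (box l u) = emeasure lebesgue (R -` box l u)"
    using meas by (simp add: emeasure_distr)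
  also have "\<dots> = emeasure lebesgue (box l u)"
    by (simp only: im emeasure_eq_measure2[OF lm(1)] emeasure_eq_measure2[OF lmeasurable_box] lm(2))
  also have "\<dots> = (\<Prod>b\<in>Basis. (u - l) \<bullet> b)"
    using lu by simp
  finally show "emeasure (distr lborel borel R) (box l u) = (\<Prod>b\<in>Basis. (u - l) \<bullet> b)" .
qed simp

text \<open>The first coordinate belongs to \<open>b\<close> and the second to \<open>a\<close>: in
  the pair (t, s) to which Fubini's theorem is applied, the outer variable t then labels a line
  parallel to \<open>a\<close> and s runs along it.\<close>

lemma orthogonal_transformation_orthonormal:
  fixes a b :: "real^2"
  assumes ab: "norm a = 1" "norm b = 1" "a \<bullet> b = 0"
  shows "orthogonal_transformation (\<lambda>x :: real^2. (x $ 2) *\<^sub>R a + (x $ 1) *\<^sub>R b)" (is "orthogonal_transformation ?R")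
proof -
  have "linear ?R"
    by (rule linearI) (auto simp: algebra_simps)
  moreover have "?R v \<bullet> ?R w = v \<bullet> w" for v w
  proof -
    have "a \<bullet> a = 1" "b \<bullet> b = 1" "b \<bullet> a = 0"
      using ab by (auto simp: norm_eq_1 inner_commute)
    moreover have "v \<bullet> w = v $ 1 * w $ 1 + v $ 2 * w $ 2"
      by (simp add: inner_vec_def sum_2)
    ultimately show ?thesis
      using ab(3) by (simp add: inner_add_left inner_add_right)
  qed
  ultimately show ?thesis
    by (simp add: orthogonal_transformation_def)
qed

lemma orthonormal_expansion:
  fixes a b :: "real^2"
  assumes ab: "norm a = 1" "norm b = 1" "a \<bullet> b = 0"
  shows "x = (a \<bullet> x) *\<^sub>R a + (b \<bullet> x) *\<^sub>R b"
proof -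
  obtain y :: "real^2" where y: "x = (y $ 2) *\<^sub>R a + (y $ 1) *\<^sub>R b"
    using surjD[OF orthogonal_transformation_surj[OF orthogonal_transformation_orthonormal[OF ab]], of x] by blast
  then have "a \<bullet> x = y $ 2" "b \<bullet> x = y $ 1"
    using ab by (auto simp: inner_add_right norm_eq_1 inner_commute[of b a])
  with y show ?thesis by simp
qed

lemma distr_lborel_pair_orthonormal:
  fixes a b :: "real^2"
  assumes ab: "norm a = 1" "norm b = 1" "a \<bullet> b = 0"
  shows "distr (lborel \<Otimes>\<^sub>M lborel) borel (\<lambda>(t, s). s *\<^sub>R a + t *\<^sub>R b) = lborel"
proof -
  define R where "R x = (x $ 2) *\<^sub>R a + (x $ 1) *\<^sub>R b" for x :: "real^2"
  have R: "orthogonal_transformation R"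
    unfolding R_def by (rule orthogonal_transformation_orthonormal[OF ab])
  have mR: "R \<in> borel_measurable borel"
    using orthogonal_transformation_linear[OF R] by (auto intro!: borel_measurable_continuous_onI linear_continuous_on
        simp: linear_conv_bounded_linear[symmetric])
  have mT: "(\<lambda>(t, s). t *\<^sub>R axis 1 1 + s *\<^sub>R axis 2 1 :: real^2) \<in> borel_measurable borel"
    unfolding split_beta by (auto intro!: borel_measurable_continuous_onI continuous_intros)
  have "lborel = distr (distr lborel borel (\<lambda>(t, s). t *\<^sub>R axis 1 1 + s *\<^sub>R axis 2 1)) borel R"
    using distr_lborel_orthogonal[OF R] by (simp add: distr_lborel_pair_axis)
  also have "\<dots> = distr lborel borel (R \<circ> (\<lambda>(t, s). t *\<^sub>R axis 1 1 + s *\<^sub>R axis 2 1))"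
    using mR mT by (intro distr_distr) auto
  also have "R \<circ> (\<lambda>(t, s). t *\<^sub>R axis 1 1 + s *\<^sub>R axis 2 1) = (\<lambda>(t, s). s *\<^sub>R a + t *\<^sub>R b)"
    by (auto simp: fun_eq_iff R_def axis_def)
  finally show ?thesis by (simp add: lborel_prod)
qed

text \<open>Fubini's theorem over the lines parallel to \<open>a\<close>, with the one-dimensional
  bound on each slice. A slice is an arbitrary bounded open set and may have infinitely many
  components. The measurable function \<open>G\<close> is there because the fibre sums are not known
  to be measurable in t.\<close>

lemma slicing_bound:
  fixes F D :: "real^2 \<Rightarrow> real"
  assumes \<omega>: "open \<omega>" "bounded \<omega>" and ab: "norm a = 1" "norm b = 1" "a \<bullet> b = 0"
    and F: "\<And>x. ((\<lambda>h. F (x + h *\<^sub>R a)) has_real_derivative D x) (at 0)"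
    and D: "continuous_on UNIV D"
    and G: "G \<in> borel_measurable lborel"
    and le: "AE t in lborel. (\<integral>\<^sup>+x. ennreal \<bar>F x\<bar> \<partial>count_space {x \<in> frontier \<omega>. b \<bullet> x = t}) \<le> G t"
  shows "ennreal \<bar>LINT x|lebesgue_on \<omega>. D x\<bar> \<le> 2 * (\<integral>\<^sup>+t. G t \<partial>lborel)"
proof -
  let ?T = "\<lambda>(t, s). s *\<^sub>R a + t *\<^sub>R b"
  let ?f = "\<lambda>x. indicator \<omega> x *\<^sub>R D x"
  have Dm: "D \<in> borel_measurable borel" using D by (rule borel_measurable_continuous_onI)
  have \<omega>m: "\<omega> \<in> sets borel" using \<omega> by simp
  have fm: "?f \<in> borel_measurable borel" using Dm \<omega>m by simp
  have Tm: "?T \<in> lborel \<Otimes>\<^sub>M lborel \<rightarrow>\<^sub>M borel"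
    unfolding split_beta by measurable
  have intf: "integrable lborel ?f"
  proof -
    obtain c where "\<omega> \<subseteq> cbox (-c) c" using bounded_subset_cbox_symmetric[OF \<omega>(2)] by blast
    moreover have "set_integrable lborel (cbox (-c) c) D"
      unfolding set_integrable_def
      by (rule borel_integrable_compact) (auto intro: continuous_on_subset[OF D])
    ultimately show ?thesis
      using \<omega>m unfolding set_integrable_def[symmetric] by (auto intro: set_integrable_subset)
  qed
  have dist: "distr (lborel \<Otimes>\<^sub>M lborel) borel ?T = lborel"
    by (rule distr_lborel_pair_orthonormal[OF ab])
  have intT: "integrable (lborel \<Otimes>\<^sub>M lborel) (\<lambda>p. ?f (?T p))"
    using intf fm Tm unfolding dist[symmetric] by (subst (asm) integrable_distr_eq) auto
  have "(LINT x|lebesgue_on \<omega>. D x) = (LINT x|lebesgue. ?f x)"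
    using \<omega>m by (subst integral_restrict_space) auto
  also have "\<dots> = (LINT x|lborel. ?f x)"
    using fm by (intro integral_completion) simp
  also have "\<dots> = (LINT p|(lborel \<Otimes>\<^sub>M lborel). ?f (?T p))"
    using fm Tm by (subst dist[symmetric], subst integral_distr) auto
  also have "\<dots> = (LINT t|lborel. LINT s|lborel. ?f (?T (t, s)))"
    using lborel_pair.integral_fst'[OF intT] by simp
  finally have eq: "(LINT x|lebesgue_on \<omega>. D x) = (LINT t|lborel. LINT s|lborel. ?f (?T (t, s)))" .
  have slice: "ennreal \<bar>LINT s|lborel. ?f (?T (t, s))\<bar> \<le>
      2 * (\<integral>\<^sup>+x. ennreal \<bar>F x\<bar> \<partial>count_space {x \<in> frontier \<omega>. b \<bullet> x = t})" for t
  proof -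
    let ?c = "\<lambda>s. s *\<^sub>R a + t *\<^sub>R b"
    define U where "U = ?c -` \<omega>"
    have cont: "continuous_on UNIV ?c" by (intro continuous_intros)
    have oU: "open U" unfolding U_def using \<omega>(1) cont by (rule open_vimage)
    have inner: "a \<bullet> ?c s = s" "b \<bullet> ?c s = t" for s
      using ab by (auto simp: inner_add_right norm_eq_1 inner_commute[of b a])
    have bU: "bounded U"
    proof -
      obtain B where B: "\<And>x. x \<in> \<omega> \<Longrightarrow> norm x \<le> B" using \<omega>(2) bounded_iff by blast
      have "norm s \<le> B" if "s \<in> U" for s
        using B[of "?c s"] that Cauchy_Schwarz_ineq2[of a "?c s"] ab(1) inner(1)[of s] by (auto simp: U_def)
      then show ?thesis using bounded_iff by blast
    qed
    \<comment> \<open>In general only this direction holds: a line may touch the frontier of the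
      domain at a point that is not in the frontier of the slice. An upper bound needs no
      more.\<close>
    have fr: "?c s \<in> frontier \<omega>" if "s \<in> frontier U" for s
    proof -
      have "s \<notin> U" "s \<in> closure U"
        using that oU by (auto simp: frontier_def interior_open)
      moreover have "?c ` closure U \<subseteq> closure (?c ` U)"
        by (rule image_closure_subset) (auto intro: continuous_on_subset[OF cont] closure_subset[THEN subsetD])
      moreover have "closure (?c ` U) \<subseteq> closure \<omega>"
        by (rule closure_mono) (auto simp: U_def)
      ultimately show ?thesis
        using \<omega>(1) by (auto simp: frontier_def interior_open U_def)
    qed
    have "ennreal \<bar>LINT s:U|lborel. D (?c s)\<bar> \<le> 2 * (\<integral>\<^sup>+s. ennreal \<bar>F (?c s)\<bar> \<partial>count_space (frontier U))"
    proof (rule FTC_open_set_bound[OF oU bU])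
      fix s
      have "((\<lambda>h. F (?c (h + s))) has_real_derivative D (?c s)) (at 0)"
        using F[of "?c s"] by (simp add: algebra_simps)
      then show "((\<lambda>s. F (?c s)) has_real_derivative D (?c s)) (at s)"
        using DERIV_shift[of "\<lambda>s. F (?c s)" "D (?c s)" 0 s] by simp
    next
      show "continuous_on UNIV (\<lambda>s. D (?c s))"
        by (rule continuous_on_compose2[OF D cont]) auto
    qed
    also have "(\<integral>\<^sup>+s. ennreal \<bar>F (?c s)\<bar> \<partial>count_space (frontier U)) \<le>
        (\<integral>\<^sup>+x. ennreal \<bar>F x\<bar> \<partial>count_space {x \<in> frontier \<omega>. b \<bullet> x = t})"
      by (rule nn_integral_count_space_inj_le[where g="?c" and f="\<lambda>x. ennreal \<bar>F x\<bar>"])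
        (use inner fr in \<open>auto intro!: inj_on_inverseI[where g="\<lambda>x. a \<bullet> x"]\<close>)
    also have "(LINT s:U|lborel. D (?c s)) = (LINT s|lborel. ?f (?T (t, s)))"
      by (simp add: set_lebesgue_integral_def U_def indicator_def)
    finally show ?thesis by (simp add: mult_left_mono)
  qed
  have "ennreal \<bar>LINT x|lebesgue_on \<omega>. D x\<bar> \<le> (\<integral>\<^sup>+t. ennreal (norm (LINT s|lborel. ?f (?T (t, s)))) \<partial>lborel)"
    unfolding eq real_norm_def[symmetric]
    by (rule integral_norm_bound_ennreal) (use lborel_pair.integrable_fst'[OF intT] in simp)
  also have "\<dots> \<le> (\<integral>\<^sup>+t. 2 * G t \<partial>lborel)"
    using le unfolding real_norm_def
    by (intro nn_integral_mono_AE) (elim eventually_mono order_trans[OF slice mult_left_mono], simp)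
  also have "\<dots> = 2 * (\<integral>\<^sup>+t. G t \<partial>lborel)"
    using G by (intro nn_integral_cmult) auto
  finally show ?thesis .
qed

section \<open>Projections and the Hausdorff measure\<close>

lemma less_add_ennreal:
  fixes a b :: ennreal
  shows "a < top \<Longrightarrow> 0 < b \<Longrightarrow> a < a + b"
  using ennreal_add_left_cancel_less[of a 0 b] by (simp add: less_top)

lemma hausdorff1_cover:
  assumes "hausdorff1_outer A < c" "0 < \<delta>"
  obtains C :: "nat \<Rightarrow> 'a::metric_space set" where "A \<subseteq> (\<Union>i. C i)" "\<And>i. bounded (C i)"
    "\<And>i. diameter (C i) \<le> \<delta>" "(\<Sum>i. ennreal (diameter (C i))) < c"
proof -
  have "hausdorff1_content \<delta> A < c"
    using hausdorff1_outer_ge[OF assms(2)] assms(1) by (rule le_less_trans)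
  then show ?thesis
    unfolding hausdorff1_content_def using that by (auto simp: INF_less_iff)
qed

text \<open>The interval is centred at the image of an arbitrary point of \<open>S\<close>, hence
  the factor 2. The set \<open>S\<close> is kept apart from \<open>C\<close> because in the Sard
  argument only some points of a covering set satisfy the Lipschitz bound.\<close>

lemma lipschitz_image_cover:
  fixes p :: "'a::metric_space \<Rightarrow> real"
  assumes "bounded C" "S \<subseteq> C" "0 \<le> \<epsilon>" "\<And>x y. x \<in> S \<Longrightarrow> y \<in> S \<Longrightarrow> \<bar>p x - p y\<bar> \<le> \<epsilon> * dist x y"
  obtains J where "J \<in> sets borel" "p ` S \<subseteq> J" "emeasure lborel J \<le> 2 * ennreal \<epsilon> * ennreal (diameter C)"
proof (cases "S = {}")
  case True
  then show ?thesis using that[of "{}"] by simp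
next
  case False
  then obtain c where c: "c \<in> S" by blast
  let ?r = "\<epsilon> * diameter C"
  have r: "0 \<le> ?r" using assms(3) diameter_ge_0[OF assms(1)] by simp
  have "\<bar>p x - p c\<bar> \<le> ?r" if "x \<in> S" for x
  proof -
    have "dist x c \<le> diameter C"
      using assms(1,2) c that by (intro diameter_bounded_bound) auto
    then show ?thesis
      using assms(4)[OF that c] mult_left_mono[OF _ assms(3)] by fastforce
  qed
  then have "p ` S \<subseteq> {p c - ?r .. p c + ?r}" by (auto simp: abs_le_iff) (smt (verit))+
  moreover have "emeasure lborel {p c - ?r .. p c + ?r} = 2 * ennreal \<epsilon> * ennreal (diameter C)"
    using r assms(3) diameter_ge_0[OF assms(1)] by (simp add: ennreal_mult mult.assoc)
  ultimately show ?thesis using that[of "{p c - ?r .. p c + ?r}"] by simp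
qed

text \<open>The sets \<open>G m\<close> need not be nested, but the intersections of their tails
  increase, so continuity from below applies. This serves points that are covered only from some
  index on.\<close>

lemma emeasure_eventually_le:
  assumes G: "\<And>m::nat. G m \<in> sets M" "\<And>m. emeasure M (G m) \<le> c"
  shows "emeasure M (\<Union>m. \<Inter>k\<in>{m..}. G k) \<le> c"
proof -
  have "(\<Union>m. \<Inter>k\<in>{m..}. G k) \<in> sets M" "(\<Inter>k\<in>{m..}. G k) \<in> sets M" for m
    using G by (auto intro!: sets.countable_INT')
  moreover have "incseq (\<lambda>m. \<Inter>k\<in>{m..}. G k)"
    by (auto simp: incseq_def)
  ultimately have "emeasure M (\<Union>m. \<Inter>k\<in>{m..}. G k) = (SUP m. emeasure M (\<Inter>k\<in>{m..}. G k))"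
    by (intro SUP_emeasure_incseq[symmetric]) auto
  also have "\<dots> \<le> c"
  proof (rule SUP_least)
    fix m
    have "emeasure M (\<Inter>k\<in>{m..}. G k) \<le> emeasure M (G m)"
      using G by (intro emeasure_mono) auto
    then show "emeasure M (\<Inter>k\<in>{m..}. G k) \<le> c" using G(2) order_trans by blast
  qed
  finally show ?thesis .
qed

text \<open>A one-dimensional Sard lemma; \<open>B\<close> need not be measurable.\<close>

lemma AE_lborel_notin_image_flat:
  fixes p :: "'a::metric_space \<Rightarrow> real"
  assumes fin: "hausdorff1_outer A < top" and "B \<subseteq> A"
    and flat: "\<And>x \<epsilon>. x \<in> B \<Longrightarrow> 0 < \<epsilon> \<Longrightarrow> \<exists>\<rho>>0. \<forall>y\<in>A. dist x y < \<rho> \<longrightarrow> \<bar>p x - p y\<bar> \<le> \<epsilon> * dist x y"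
  shows "AE t in lborel. t \<notin> p ` B"
proof -
  define c where "c = hausdorff1_outer A + 1"
  have c: "hausdorff1_outer A < c" "c < top"
    using fin by (auto simp: c_def less_add_ennreal)
  have ex: "\<exists>L\<in>sets borel. p ` B \<subseteq> L \<and> emeasure lborel L \<le> 2 * ennreal \<epsilon> * c" if \<epsilon>: "0 < \<epsilon>" for \<epsilon>
  proof -
    \<comment> \<open>The radius of flatness depends on the point. \<open>Bm m\<close> collects the
      points for which 1/(m+1) will do; every point of \<open>B\<close> lies in \<open>Bm m\<close>
      for all large m.\<close>
    define Bm where "Bm m = {x \<in> B. \<forall>y\<in>A. dist x y < 1 / Suc m \<longrightarrow> \<bar>p x - p y\<bar> \<le> \<epsilon> * dist x y}" for m :: nat
    have "\<exists>G\<in>sets borel. p ` Bm m \<subseteq> G \<and> emeasure lborel G \<le> 2 * ennreal \<epsilon> * c" for m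
    proof -
      \<comment> \<open>Diameter at most 1/(m+2) puts two points of one covering set strictly within
        the radius 1/(m+1) required in \<open>Bm m\<close>.\<close>
      obtain C :: "nat \<Rightarrow> 'a set" where C: "A \<subseteq> (\<Union>i. C i)" "\<And>i. bounded (C i)"
        "\<And>i. diameter (C i) \<le> 1 / Suc (Suc m)" "(\<Sum>i. ennreal (diameter (C i))) < c"
        by (rule hausdorff1_cover[OF c(1), of "1 / Suc (Suc m)"]) auto
      have "\<exists>J\<in>sets borel. p ` (C i \<inter> Bm m) \<subseteq> J \<and> emeasure lborel J \<le> 2 * ennreal \<epsilon> * ennreal (diameter (C i))" for i
      proof -
        have "\<bar>p x - p y\<bar> \<le> \<epsilon> * dist x y" if "x \<in> C i \<inter> Bm m" "y \<in> C i \<inter> Bm m" for x y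
        proof -
          have "dist x y \<le> 1 / Suc (Suc m)"
            using diameter_bounded_bound[of "C i" x y] that C(2,3)[of i] by auto
          also have "\<dots> < 1 / Suc m" by (simp add: field_simps)
          finally show ?thesis using that \<open>B \<subseteq> A\<close> by (auto simp: Bm_def)
        qed
        then show ?thesis
          using lipschitz_image_cover[of "C i" "C i \<inter> Bm m" \<epsilon> p] C(2)[of i] \<epsilon>
          by (metis inf_le1 less_imp_le)
      qed
      then obtain J where J: "\<And>i. J i \<in> sets borel" "\<And>i. p ` (C i \<inter> Bm m) \<subseteq> J i"
          "\<And>i. emeasure lborel (J i) \<le> 2 * ennreal \<epsilon> * ennreal (diameter (C i))"
        by metis
      have "emeasure lborel (\<Union>i. J i) \<le> (\<Sum>i. emeasure lborel (J i))"
        using J(1) by (intro emeasure_subadditive_countably) auto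
      also have "\<dots> \<le> (\<Sum>i. 2 * ennreal \<epsilon> * ennreal (diameter (C i)))"
        by (intro suminf_le J) auto
      also have "\<dots> = 2 * ennreal \<epsilon> * (\<Sum>i. ennreal (diameter (C i)))" by simp
      also have "\<dots> \<le> 2 * ennreal \<epsilon> * c" using C(4) by (intro mult_left_mono) auto
      finally have "emeasure lborel (\<Union>i. J i) \<le> 2 * ennreal \<epsilon> * c" .
      moreover have "p ` Bm m \<subseteq> (\<Union>i. J i)"
      proof
        fix t assume "t \<in> p ` Bm m"
        then obtain x where x: "x \<in> Bm m" "t = p x" by blast
        then have "x \<in> A" using \<open>B \<subseteq> A\<close> by (auto simp: Bm_def)
        then obtain i where "x \<in> C i" using C(1) by blast
        then show "t \<in> (\<Union>i. J i)" using x J(2)[of i] by blast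
      qed
      ultimately show ?thesis using J(1) by (intro bexI[of _ "\<Union>i. J i"]) auto
    qed
    then obtain G where G: "\<And>m. G m \<in> sets borel" "\<And>m. p ` Bm m \<subseteq> G m"
        "\<And>m. emeasure lborel (G m) \<le> 2 * ennreal \<epsilon> * c"
      by metis
    have "p ` B \<subseteq> (\<Union>m. \<Inter>k\<in>{m..}. G k)"
    proof
      fix t assume "t \<in> p ` B"
      then obtain x where x: "x \<in> B" "t = p x" by blast
      obtain \<rho> where \<rho>: "\<rho> > 0" "\<And>y. y \<in> A \<Longrightarrow> dist x y < \<rho> \<Longrightarrow> \<bar>p x - p y\<bar> \<le> \<epsilon> * dist x y"
        using flat[OF x(1) \<epsilon>] by blast
      obtain m where m: "1 / Suc m < \<rho>"
        using reals_Archimedean[OF \<rho>(1)] by (auto simp: inverse_eq_divide)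
      have "x \<in> Bm k" if "m \<le> k" for k
      proof -
        have "1 / Suc k \<le> 1 / Suc m" using that by (auto simp: field_simps)
        then show ?thesis using x(1) \<rho>(2) m by (auto simp: Bm_def)
      qed
      then have "t \<in> (\<Inter>k\<in>{m..}. G k)" using x(2) G(2) by blast
      then show "t \<in> (\<Union>m. \<Inter>k\<in>{m..}. G k)" by blast
    qed
    moreover have "emeasure lborel (\<Union>m. \<Inter>k\<in>{m..}. G k) \<le> 2 * ennreal \<epsilon> * c"
      using G by (intro emeasure_eventually_le) auto
    moreover have "(\<Union>m. \<Inter>k\<in>{m..}. G k) \<in> sets borel"
      using G(1) by (auto intro!: sets.countable_INT')
    ultimately show ?thesis by blast
  qed
  \<comment> \<open>Choosing \<epsilon> = 1/(j+1) gives Borel supersets of the image whose measures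
    tend to 0; their intersection is a Borel null set containing the image.\<close>
  have "\<forall>j::nat. \<exists>L. L \<in> sets borel \<and> p ` B \<subseteq> L \<and> emeasure lborel L \<le> 2 * ennreal (1 / Suc j) * c"
  proof
    fix j :: nat
    show "\<exists>L. L \<in> sets borel \<and> p ` B \<subseteq> L \<and> emeasure lborel L \<le> 2 * ennreal (1 / Suc j) * c"
      using ex[of "1 / Suc j"] by auto
  qed
  then obtain L where L: "\<And>j. L j \<in> sets borel" "\<And>j. p ` B \<subseteq> L j"
      "\<And>j::nat. emeasure lborel (L j) \<le> 2 * ennreal (1 / Suc j) * c"
    by metis
  have Lm: "(\<Inter>j. L j) \<in> sets borel" using L(1) by auto
  obtain c' where c': "0 \<le> c'" "c = ennreal c'" using c(2) by (cases c) auto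
  have "emeasure lborel (\<Inter>j. L j) \<le> ennreal (2 * c' * inverse (Suc j))" for j
  proof -
    have "emeasure lborel (\<Inter>j. L j) \<le> emeasure lborel (L j)"
      using L(1) by (intro emeasure_mono) auto
    also have "\<dots> \<le> 2 * ennreal (1 / Suc j) * c" by (rule L)
    also have "\<dots> = ennreal (2 * c' * inverse (Suc j))"
      using c' by (simp add: ennreal_mult[symmetric] inverse_eq_divide mult.commute flip: ennreal_numeral)
    finally show ?thesis .
  qed
  moreover have "(\<lambda>j. ennreal (2 * c' * inverse (Suc j))) \<longlonglongrightarrow> ennreal (2 * c' * 0)"
    by (intro tendsto_ennrealI tendsto_intros LIMSEQ_inverse_real_of_nat)
  ultimately have "emeasure lborel (\<Inter>j. L j) \<le> 0"
    by (intro LIMSEQ_le_const) auto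
  then have "(\<Inter>j. L j) \<in> null_sets lborel"
    using Lm by (auto simp: null_sets_def)
  then have "AE t in lborel. t \<notin> (\<Inter>j. L j)" by (rule AE_not_in)
  then show ?thesis using L(2) by (elim eventually_mono) blast
qed

text \<open>Once a covering is finer than d, distinct points of \<open>S\<close> lie in distinct
  covering sets. This lets coverings count the points of a fibre.\<close>

lemma finite_set_separated:
  fixes S :: "'a::metric_space set"
  assumes "finite S"
  obtains d where "d > 0" "\<And>x y. x \<in> S \<Longrightarrow> y \<in> S \<Longrightarrow> x \<noteq> y \<Longrightarrow> d \<le> dist x y"
proof -
  have "\<exists>d>0. \<forall>x\<in>S. \<forall>y\<in>S. x \<noteq> y \<longrightarrow> d \<le> dist x y"
    using assms
  proof (induction S rule: finite_induct)
    case empty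
    then show ?case by (auto intro: exI[of _ 1])
  next
    case (insert z S)
    then obtain d where d: "d > 0" "\<forall>x\<in>S. \<forall>y\<in>S. x \<noteq> y \<longrightarrow> d \<le> dist x y" by blast
    obtain e where e: "e > 0" "\<forall>x\<in>S. x \<noteq> z \<longrightarrow> e \<le> dist z x"
      using finite_set_avoid[OF insert(1), of z] by blast
    show ?case
      using d e by (intro exI[of _ "min d e"]) (auto simp: dist_commute min_le_iff_disj)
  qed
  then show ?thesis using that by blast
qed

text \<open>The fibre count need not be obviously measurable in \<open>t\<close>, hence the measurable majorant \<open>G\<close>.
  The constant is 2 instead of 1 because a covering set \<open>C\<close> is projected into an interval of length
  twice its diameter.\<close>

lemma eilenberg_set:
  fixes p :: "'a::metric_space \<Rightarrow> real"
  assumes p: "\<And>x y. \<bar>p x - p y\<bar> \<le> dist x y"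
  obtains G where "G \<in> borel_measurable lborel" "\<And>t. emeasure (count_space UNIV) (A \<inter> p -` {t}) \<le> G t"
    "(\<integral>\<^sup>+t. G t \<partial>lborel) \<le> 2 * hausdorff1_outer A"
proof (cases "hausdorff1_outer A < top")
  case False
  then have "2 * hausdorff1_outer A = top"
    by (auto simp: less_top[symmetric] ennreal_mult_eq_top_iff)
  then show ?thesis using that[of "\<lambda>_. top"] by auto
next
  case True
  let ?H = "hausdorff1_outer A"
  \<comment> \<open>The excess 1/(n+1) makes the infimum attainable by a covering and disappears in
    the limit, leaving exactly twice the outer measure.\<close>
  define c where "c n = ?H + ennreal (inverse (Suc n))" for n
  have c: "?H < c n" for n
    using True by (auto simp: c_def intro!: less_add_ennreal)
  have "\<exists>C. A \<subseteq> (\<Union>i. C i) \<and> (\<forall>i. bounded (C i)) \<and> (\<forall>i. diameter (C i) \<le> inverse (Suc n))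
     \<and> (\<Sum>i::nat. ennreal (diameter (C i))) < c n" for n
    by (rule hausdorff1_cover[OF c[of n], of "inverse (Suc n)"]) auto
  then obtain C :: "nat \<Rightarrow> nat \<Rightarrow> 'a set" where C: "\<And>n. A \<subseteq> (\<Union>i. C n i)" "\<And>n i. bounded (C n i)"
      "\<And>n i. diameter (C n i) \<le> inverse (Suc n)" "\<And>n. (\<Sum>i. ennreal (diameter (C n i))) < c n"
    by metis
  have "\<exists>J\<in>sets borel. p ` C n i \<subseteq> J \<and> emeasure lborel J \<le> 2 * ennreal 1 * ennreal (diameter (C n i))" for n i
    using lipschitz_image_cover[OF C(2)[of n i], of "C n i" 1 p] p by (metis mult_1 order_refl zero_le_one)
  then obtain J where J: "\<And>n i. J n i \<in> sets borel" "\<And>n i. p ` C n i \<subseteq> J n i"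
      "\<And>n i. emeasure lborel (J n i) \<le> 2 * ennreal (diameter (C n i))"
    by (metis ennreal_1 mult.right_neutral)
  define g where "g n t = (\<Sum>i. indicator (J n i) t :: ennreal)" for n t
  have g: "g n \<in> borel_measurable lborel" for n
    unfolding g_def using J(1) by measurable
  have int_g: "(\<integral>\<^sup>+t. g n t \<partial>lborel) \<le> 2 * c n" for n
  proof -
    have "(\<integral>\<^sup>+t. g n t \<partial>lborel) = (\<Sum>i. emeasure lborel (J n i))"
      unfolding g_def using J(1) by (subst nn_integral_suminf) auto
    also have "\<dots> \<le> (\<Sum>i. 2 * ennreal (diameter (C n i)))" by (intro suminf_le J) auto
    also have "\<dots> = 2 * (\<Sum>i. ennreal (diameter (C n i)))" by simp
    also have "\<dots> \<le> 2 * c n" using C(4) by (intro mult_left_mono less_imp_le) auto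
    finally show ?thesis .
  qed
  \<comment> \<open>\<open>g n t\<close> counts the intervals of the n-th covering that contain t.
    Since the mesh tends to 0, it is eventually at least the size of any given finite part of the
    fibre, while Fatou's lemma bounds the integral of the lower limit.\<close>
  define G where "G t = liminf (\<lambda>n. g n t)" for t
  have card: "of_nat (card S) \<le> G t" if S: "finite S" "S \<subseteq> A \<inter> p -` {t}" for S t
  proof -
    obtain d where d: "d > 0" "\<And>x y. x \<in> S \<Longrightarrow> y \<in> S \<Longrightarrow> x \<noteq> y \<Longrightarrow> d \<le> dist x y"
      by (rule finite_set_separated[OF S(1)]) blast
    have "\<forall>\<^sub>F n in sequentially. inverse (real (Suc n)) < d"
      using LIMSEQ_inverse_real_of_nat d(1) by (rule order_tendstoD)
    then have "\<forall>\<^sub>F n in sequentially. of_nat (card S) \<le> g n t"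
    proof eventually_elim
      case (elim n)
      have "\<forall>x\<in>S. \<exists>i. x \<in> C n i" using S(2) C(1)[of n] by blast
      then obtain i where i: "\<And>x. x \<in> S \<Longrightarrow> x \<in> C n (i x)" by metis
      have inj: "inj_on i S"
      proof (rule inj_onI, rule ccontr)
        fix x y assume xy: "x \<in> S" "y \<in> S" "i x = i y" "x \<noteq> y"
        then have "dist x y \<le> inverse (Suc n)"
          using i[OF xy(1)] i[OF xy(2)] diameter_bounded_bound[OF C(2)[of n "i x"], of x y] C(3)[of n "i x"] by auto
        then show False using elim d(2)[OF xy(1,2,4)] by linarith
      qed
      have "of_nat (card S) = (\<Sum>k\<in>i ` S. indicator (J n k) t :: ennreal)"
      proof -
        have "t \<in> J n (i x)" if "x \<in> S" for x
          using i[OF that] J(2)[of n "i x"] S(2) that by blast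
        then have "(\<Sum>k\<in>i ` S. indicator (J n k) t :: ennreal) = (\<Sum>k\<in>i ` S. 1)"
          by (intro sum.cong) auto
        then show ?thesis using inj by (simp add: card_image)
      qed
      also have "\<dots> \<le> g n t"
        unfolding g_def using S(1) by (intro sum_le_suminf) auto
      finally show ?case .
    qed
    then show ?thesis unfolding G_def by (rule Liminf_bounded)
  qed
  show ?thesis
  proof (rule that[of G])
    show "G \<in> borel_measurable lborel"
      unfolding G_def using g by measurable
    show "emeasure (count_space UNIV) (A \<inter> p -` {t}) \<le> G t" for t
    proof (cases "finite (A \<inter> p -` {t})")
      case True
      then show ?thesis using card[OF True order_refl] by simp
    next
      case False
      have "of_nat n \<le> G t" for n
        using infinite_arbitrarily_large[OF False, of n] card[of _ t] by blast
      then have "G t = top"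
        by (metis ennreal_SUP_of_nat_eq_top SUP_least top.extremum_unique)
      then show ?thesis by simp
    qed
    have "(\<integral>\<^sup>+t. G t \<partial>lborel) \<le> liminf (\<lambda>n. \<integral>\<^sup>+t. g n t \<partial>lborel)"
      unfolding G_def using g by (intro nn_integral_liminf) auto
    also have "\<dots> \<le> liminf (\<lambda>n. 2 * c n)"
      using int_g by (intro Liminf_mono always_eventually) auto
    also have "\<dots> = 2 * ?H"
    proof (rule lim_imp_Liminf)
      have "(\<lambda>n. 2 * c n) \<longlonglongrightarrow> 2 * (?H + ennreal 0)"
        unfolding c_def
        by (intro ennreal_tendsto_cmult tendsto_add tendsto_const tendsto_ennrealI LIMSEQ_inverse_real_of_nat) auto
      then show "(\<lambda>n. 2 * c n) \<longlonglongrightarrow> 2 * ?H" by simp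
    qed simp
    finally show "(\<integral>\<^sup>+t. G t \<partial>lborel) \<le> 2 * ?H" .
  qed
qed


text \<open>Induction on the construction of nonnegative measurable functions, carrying the majorant
  along. For an increasing limit the majorants of the single steps are chosen independently and need
  not increase, so \<open>liminf\<close> is taken and its integral is bounded by Fatou's
  lemma.\<close>

lemma eilenberg_inequality:
  fixes p :: "'a::metric_space \<Rightarrow> real" and h :: "'a \<Rightarrow> ennreal"
  assumes p: "\<And>x y. \<bar>p x - p y\<bar> \<le> dist x y" and h: "h \<in> borel_measurable hausdorff1"
  shows "\<exists>G\<in>borel_measurable lborel. (\<forall>t. (\<integral>\<^sup>+x. h x \<partial>count_space (p -` {t})) \<le> G t) \<and>
    (\<integral>\<^sup>+t. G t \<partial>lborel) \<le> 2 * (\<integral>\<^sup>+x. h x \<partial>hausdorff1)"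
  using h
proof (induction rule: borel_measurable_induct)
  case (cong f g)
  then show ?case by (simp cong: nn_integral_cong)
next
  case (set A)
  obtain G where G: "G \<in> borel_measurable lborel" "\<And>t. emeasure (count_space UNIV) (A \<inter> p -` {t}) \<le> G t"
    "(\<integral>\<^sup>+t. G t \<partial>lborel) \<le> 2 * hausdorff1_outer A"
    using eilenberg_set[OF p, of A] by blast
  have "(\<integral>\<^sup>+x. indicator A x \<partial>count_space (p -` {t})) = emeasure (count_space UNIV) (A \<inter> p -` {t})" for t
    by (subst nn_integral_count_space_indicator, simp)
       (simp add: indicator_inter_arith[symmetric] nn_integral_indicator[symmetric] del: nn_integral_indicator)
  moreover have "(\<integral>\<^sup>+x. indicator A x \<partial>hausdorff1) = hausdorff1_outer A"
    using set by (simp add: emeasure_hausdorff1)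
  ultimately show ?case using G by auto
next
  case (mult u c)
  then obtain G where G: "G \<in> borel_measurable lborel" "\<And>t. (\<integral>\<^sup>+x. u x \<partial>count_space (p -` {t})) \<le> G t"
    "(\<integral>\<^sup>+t. G t \<partial>lborel) \<le> 2 * (\<integral>\<^sup>+x. u x \<partial>hausdorff1)"
    by blast
  show ?case
  proof (intro bexI[of _ "\<lambda>t. c * G t"] conjI allI)
    show "(\<integral>\<^sup>+x. c * u x \<partial>count_space (p -` {t})) \<le> c * G t" for t
      using G(2) by (subst nn_integral_cmult) (auto intro: mult_left_mono)
    show "(\<integral>\<^sup>+t. c * G t \<partial>lborel) \<le> 2 * (\<integral>\<^sup>+x. c * u x \<partial>hausdorff1)"
      using G(1) mult(2) mult_left_mono[OF G(3), of c]
      by (simp add: nn_integral_cmult mult.left_commute)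
  qed (use G in measurable)
next
  case (add u v)
  obtain G where G: "G \<in> borel_measurable lborel" "\<And>t. (\<integral>\<^sup>+x. u x \<partial>count_space (p -` {t})) \<le> G t"
    "(\<integral>\<^sup>+t. G t \<partial>lborel) \<le> 2 * (\<integral>\<^sup>+x. u x \<partial>hausdorff1)"
    using add.IH(1) by blast
  obtain G' where G': "G' \<in> borel_measurable lborel" "\<And>t. (\<integral>\<^sup>+x. v x \<partial>count_space (p -` {t})) \<le> G' t"
    "(\<integral>\<^sup>+t. G' t \<partial>lborel) \<le> 2 * (\<integral>\<^sup>+x. v x \<partial>hausdorff1)"
    using add.IH(2) by blast
  show ?case
  proof (intro bexI[of _ "\<lambda>t. G' t + G t"] conjI allI)
    show "(\<integral>\<^sup>+x. v x + u x \<partial>count_space (p -` {t})) \<le> G' t + G t" for t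
      using G(2) G'(2) by (subst nn_integral_add) (auto intro: add_mono)
    show "(\<integral>\<^sup>+t. G' t + G t \<partial>lborel) \<le> 2 * (\<integral>\<^sup>+x. v x + u x \<partial>hausdorff1)"
      using add.hyps add_mono[OF G'(3) G(3)] G(1) G'(1)
      by (simp add: nn_integral_add distrib_left)
  qed (use G G' in measurable)
next
  case (seq U)
  obtain G where G: "\<And>i. G i \<in> borel_measurable lborel"
    "\<And>i t. (\<integral>\<^sup>+x. U i x \<partial>count_space (p -` {t})) \<le> G i t"
    "\<And>i. (\<integral>\<^sup>+t. G i t \<partial>lborel) \<le> 2 * (\<integral>\<^sup>+x. U i x \<partial>hausdorff1)"
    using seq.IH by metis
  have Um: "U i \<in> borel_measurable hausdorff1" for i using seq(1) .
  show ?case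
  proof (intro bexI[of _ "\<lambda>t. liminf (\<lambda>i. G i t)"] conjI allI)
    fix t
    have "(\<integral>\<^sup>+x. (SUP i. U i) x \<partial>count_space (p -` {t})) = (SUP i. \<integral>\<^sup>+x. U i x \<partial>count_space (p -` {t}))"
      unfolding SUP_apply by (rule nn_integral_monotone_convergence_SUP) (use seq in auto)
    also have "\<dots> = liminf (\<lambda>i. \<integral>\<^sup>+x. U i x \<partial>count_space (p -` {t}))"
      by (rule lim_imp_Liminf[symmetric], simp, rule LIMSEQ_SUP)
        (use seq in \<open>auto simp: incseq_def le_fun_def intro!: nn_integral_mono\<close>)
    also have "\<dots> \<le> liminf (\<lambda>i. G i t)"
      using G(2) by (intro Liminf_mono always_eventually) auto
    finally show "(\<integral>\<^sup>+x. (SUP i. U i) x \<partial>count_space (p -` {t})) \<le> liminf (\<lambda>i. G i t)" .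
  next
    have "(\<integral>\<^sup>+t. liminf (\<lambda>i. G i t) \<partial>lborel) \<le> liminf (\<lambda>i. \<integral>\<^sup>+t. G i t \<partial>lborel)"
      using G(1) by (intro nn_integral_liminf) auto
    also have "\<dots> \<le> liminf (\<lambda>i. 2 * (\<integral>\<^sup>+x. (SUP i. U i) x \<partial>hausdorff1))"
    proof (intro Liminf_mono always_eventually allI)
      fix i
      have "(\<integral>\<^sup>+x. U i x \<partial>hausdorff1) \<le> (\<integral>\<^sup>+x. (SUP i. U i) x \<partial>hausdorff1)"
        by (intro nn_integral_mono) (auto simp: SUP_apply intro: SUP_upper)
      then show "(\<integral>\<^sup>+t. G i t \<partial>lborel) \<le> 2 * (\<integral>\<^sup>+x. (SUP i. U i) x \<partial>hausdorff1)"
        using G(3)[of i] by (meson mult_left_mono order_trans zero_le)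
    qed
    also have "\<dots> = 2 * (\<integral>\<^sup>+x. (SUP i. U i) x \<partial>hausdorff1)"
      by (simp add: Liminf_const)
    finally show "(\<integral>\<^sup>+t. liminf (\<lambda>i. G i t) \<partial>lborel) \<le> 2 * (\<integral>\<^sup>+x. (SUP i. U i) x \<partial>hausdorff1)" .
  qed (use G(1) in measurable)
qed

text \<open>The number of exceptional points in a fibre has a majorant with integral 0, so almost
  every fibre contains none at all.\<close>

lemma AE_lborel_fibres:
  fixes p :: "'a::metric_space \<Rightarrow> real"
  assumes p: "\<And>x y. \<bar>p x - p y\<bar> \<le> dist x y" and P: "AE x in hausdorff1. P x"
  shows "AE t in lborel. \<forall>x. p x = t \<longrightarrow> P x"
proof -
  obtain N where N: "{x \<in> space hausdorff1. \<not> P x} \<subseteq> N" "emeasure hausdorff1 N = 0" "N \<in> sets hausdorff1"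
    using AE_E[OF P] by blast
  obtain G where G: "G \<in> borel_measurable lborel" "\<And>t. emeasure (count_space UNIV) (N \<inter> p -` {t}) \<le> G t"
    "(\<integral>\<^sup>+t. G t \<partial>lborel) \<le> 2 * hausdorff1_outer N"
    using eilenberg_set[OF p, of N] by blast
  have "hausdorff1_outer N = 0" using N by (simp add: emeasure_hausdorff1)
  then have "(\<integral>\<^sup>+t. G t \<partial>lborel) = 0" using G(3) by simp
  then have "AE t in lborel. G t = 0" using G(1) by (simp add: nn_integral_0_iff_AE)
  then show ?thesis
  proof eventually_elim
    case (elim t)
    then have "emeasure (count_space UNIV) (N \<inter> p -` {t}) = 0" using G(2)[of t] by simp
    then have "N \<inter> p -` {t} = {}" by (simp add: emeasure_count_space_eq_0)
    then show ?case using N(1) by auto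
  qed
qed

section \<open>Lipschitz boundaries\<close>

text \<open>A frontier point is not in the open set, so it cannot lie strictly above the graph; as a
  limit of points above the graph it cannot lie below.\<close>

lemma lipschitz_chart_frontier:
  assumes "open \<omega>" and chart: "lipschitz_chart \<omega> x p q r \<gamma>" and y: "y \<in> frontier \<omega>" "y \<in> ball x r"
  shows "q \<bullet> y = \<gamma> (p \<bullet> y)"
proof (rule antisym)
  have eq: "\<omega> \<inter> ball x r = {y \<in> ball x r. \<gamma> (p \<bullet> y) < q \<bullet> y}"
    using chart by (simp add: lipschitz_chart_def)
  obtain L where "L-lipschitz_on UNIV \<gamma>" using chart by (auto simp: lipschitz_chart_def)
  then have \<gamma>: "continuous_on UNIV \<gamma>" by (rule lipschitz_on_continuous_on)
  have "y \<notin> \<omega>" using y(1) \<open>open \<omega>\<close> by (simp add: frontier_def interior_open)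
  then show "q \<bullet> y \<le> \<gamma> (p \<bullet> y)" using y(2) eq by fastforce
  have "y \<in> closure \<omega>" using y(1) by (simp add: frontier_def)
  then have "y \<in> closure (\<omega> \<inter> ball x r)"
    using y(2) open_Int_closure_subset[of "ball x r" \<omega>] by (auto simp: Int_commute)
  moreover have "closed {y. \<gamma> (p \<bullet> y) \<le> q \<bullet> y}"
    by (intro closed_Collect_le continuous_on_compose2[OF \<gamma>] continuous_intros) auto
  then have "closure (\<omega> \<inter> ball x r) \<subseteq> {y. \<gamma> (p \<bullet> y) \<le> q \<bullet> y}"
    unfolding eq by (intro closure_minimal) auto
  ultimately show "\<gamma> (p \<bullet> y) \<le> q \<bullet> y" by blast
qed

text \<open>Cutting the interval into N equal pieces gives images of diameter at most L (b - a) / N.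
  For large N this is below \<delta>, and the total stays L (b - a) for every \<delta>.\<close>

lemma hausdorff1_outer_lipschitz_image:
  fixes f :: "real \<Rightarrow> 'a::metric_space"
  assumes f: "L-lipschitz_on {a..b} f" and "a \<le> b"
  shows "hausdorff1_outer (f ` {a..b}) \<le> ennreal (L * (b - a))"
  unfolding hausdorff1_outer_def
proof (rule SUP_least)
  fix \<delta> :: real assume "\<delta> \<in> {0<..}"
  then have \<delta>: "0 < \<delta>" by simp
  have L: "0 \<le> L" using f by (rule lipschitz_on_nonneg)
  obtain N0 :: nat where "L * (b - a) / \<delta> < N0" using reals_Archimedean2 by blast
  define N where "N = Suc N0"
  have N: "L * (b - a) / real N \<le> \<delta>" "0 < real N"
    using \<open>L * (b - a) / \<delta> < N0\<close> \<delta> by (auto simp: N_def field_simps)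
  define h where "h = (b - a) / N"
  have h: "0 \<le> h" "N * h = b - a" "L * h \<le> \<delta>"
    using N \<open>a \<le> b\<close> by (auto simp: h_def)
  define C where "C i = (if i < N then f ` {a + i * h .. a + Suc i * h} else {})" for i :: nat
  have sub: "{a + i * h .. a + Suc i * h} \<subseteq> {a..b}" if "i < N" for i
  proof -
    have "real (Suc i) * h \<le> N * h" using that h(1) by (intro mult_right_mono) auto
    moreover have "0 \<le> real i * h" using h(1) by simp
    ultimately show ?thesis using h(2) by auto
  qed
  have dist: "dist x y \<le> L * h" if xy: "x \<in> C i" "y \<in> C i" for x y i
  proof -
    have i: "i < N" using xy by (auto simp: C_def split: if_splits)
    then obtain s t where st: "s \<in> {a + i * h .. a + Suc i * h}" "t \<in> {a + i * h .. a + Suc i * h}" "x = f s" "y = f t"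
      using xy by (auto simp: C_def)
    then have "dist x y \<le> L * dist s t"
      using sub[OF i] lipschitz_onD[OF f, of s t] by auto
    also have "dist s t \<le> h" using st(1,2) by (auto simp: dist_real_def abs_le_iff algebra_simps)
    finally show ?thesis using L by (auto intro: mult_left_mono)
  qed
  have diam: "diameter (C i) \<le> L * h" for i
    using dist L h(1) unfolding diameter_def by (auto intro!: cSUP_least)
  have "hausdorff1_content \<delta> (f ` {a..b}) \<le> (\<Sum>i. ennreal (diameter (C i)))"
  proof (rule hausdorff1_content_le)
    show "f ` {a..b} \<subseteq> (\<Union>i. C i)"
    proof
      fix x assume "x \<in> f ` {a..b}"
      then obtain s where s: "a \<le> s" "s \<le> b" "x = f s" by auto
      show "x \<in> (\<Union>i. C i)"
      \<comment> \<open>For s = b the floor formula would give the index N, one too many, so the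
        right endpoint is put into the last piece. This case also covers a = b, where h = 0.\<close>
      proof (cases "s < b")
        case True
        then have hp: "0 < h" using s N by (simp add: h_def)
        define i where "i = nat \<lfloor>(s - a) / h\<rfloor>"
        have i: "real i \<le> (s - a) / h" "(s - a) / h < real i + 1"
          using s(1) hp by (auto simp: i_def)
        have "(s - a) / h < N" using True hp h(2) by (simp add: field_simps)
        then have "i < N" using i by linarith
        then have "x \<in> C i" using i hp s(3) by (auto simp: C_def field_simps)
        then show ?thesis by blast
      next
        case False
        then have "s = a + Suc N0 * h" using s h(2) by (simp add: N_def)
        then have "x \<in> C N0" using s(3) h(1) by (auto simp: C_def N_def algebra_simps)
        then show ?thesis by blast
      qed
    qed
    show "bounded (C i)" for i using dist unfolding bounded_two_points by blast
    show "diameter (C i) \<le> \<delta>" for i using diam[of i] h(3) by linarith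
  qed
  also have "\<dots> = (\<Sum>i<N. ennreal (diameter (C i)))"
    by (rule suminf_finite) (auto simp: C_def)
  also have "\<dots> \<le> (\<Sum>i<N. ennreal (L * h))"
    using diam by (intro sum_mono ennreal_leI)
  also have "\<dots> = ennreal (L * (N * h))"
    using L h(1) by (simp add: ennreal_of_nat_eq_real_of_nat ennreal_mult[symmetric] mult.left_commute)
  finally show "hausdorff1_content \<delta> (f ` {a..b}) \<le> ennreal (L * (b - a))"
    using h(2) by simp
qed

text \<open>By compactness finitely many charts suffice, and in each the frontier lies on a
  Lipschitz image of a bounded interval. Finiteness makes \<open>arc_length\<close> a finite measure
  and is a hypothesis of the Sard lemma.\<close>

lemma hausdorff1_outer_frontier_finite:
  assumes "open \<omega>" "bounded \<omega>" "lipschitz_boundary \<omega>"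
  shows "hausdorff1_outer (frontier \<omega>) < top"
proof -
  have loc: "\<exists>r>0. hausdorff1_outer (frontier \<omega> \<inter> ball x r) < top" if x: "x \<in> frontier \<omega>" for x
  proof -
    obtain p q r \<gamma> where chart: "lipschitz_chart \<omega> x p q r \<gamma>"
      using assms(3) x by (auto simp: lipschitz_boundary_def)
    then have pq: "norm p = 1" "norm q = 1" "p \<bullet> q = 0" "0 < r" by (auto simp: lipschitz_chart_def)
    obtain L where L: "L-lipschitz_on UNIV \<gamma>" using chart by (auto simp: lipschitz_chart_def)
    define f where "f s = s *\<^sub>R p + \<gamma> s *\<^sub>R q" for s
    let ?I = "{p \<bullet> x - r .. p \<bullet> x + r}"
    have f: "(1 + L)-lipschitz_on ?I f"
    proof (rule lipschitz_onI)
      fix s t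
      have "dist (f s) (f t) = norm ((s - t) *\<^sub>R p + (\<gamma> s - \<gamma> t) *\<^sub>R q)"
        by (simp add: f_def dist_norm algebra_simps)
      also have "\<dots> \<le> \<bar>s - t\<bar> + \<bar>\<gamma> s - \<gamma> t\<bar>"
        by (rule norm_triangle_le) (simp add: pq)
      also have "\<dots> \<le> (1 + L) * dist s t"
        using lipschitz_onD[OF L, of s t] by (simp add: dist_real_def algebra_simps)
      finally show "dist (f s) (f t) \<le> (1 + L) * dist s t" .
    qed (use lipschitz_on_nonneg[OF L] in simp)
    have "frontier \<omega> \<inter> ball x r \<subseteq> f ` ?I"
    proof
      fix y assume y: "y \<in> frontier \<omega> \<inter> ball x r"
      then have "q \<bullet> y = \<gamma> (p \<bullet> y)" using lipschitz_chart_frontier[OF assms(1) chart] by blast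
      then have "y = f (p \<bullet> y)" using orthonormal_expansion[OF pq(1-3), of y] by (simp add: f_def)
      moreover have "\<bar>p \<bullet> y - p \<bullet> x\<bar> \<le> r"
        using Cauchy_Schwarz_ineq2[of p "y - x"] y pq(1) by (simp add: inner_diff_right dist_norm norm_minus_commute)
      ultimately show "y \<in> f ` ?I" by (auto simp: abs_le_iff intro!: image_eqI[of _ _ "p \<bullet> y"])
    qed
    then have "hausdorff1_outer (frontier \<omega> \<inter> ball x r) \<le> hausdorff1_outer (f ` ?I)"
      by (rule hausdorff1_outer_mono)
    also have "\<dots> \<le> ennreal ((1 + L) * (p \<bullet> x + r - (p \<bullet> x - r)))"
      using pq(4) by (intro hausdorff1_outer_lipschitz_image f) auto
    also have "\<dots> < top" by simp
    finally show ?thesis using pq(4) by blast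
  qed
  then obtain r where r: "\<And>x. x \<in> frontier \<omega> \<Longrightarrow> 0 < r x"
    "\<And>x. x \<in> frontier \<omega> \<Longrightarrow> hausdorff1_outer (frontier \<omega> \<inter> ball x (r x)) < top" by metis
  have "compact (frontier \<omega>)" using assms(2) by (simp add: compact_frontier_bounded)
  then obtain X where X: "X \<subseteq> frontier \<omega>" "finite X" "frontier \<omega> \<subseteq> (\<Union>x\<in>X. ball x (r x))"
    using r(1) by (elim compactE_image[where C="frontier \<omega>" and f="\<lambda>x. ball x (r x)"]) auto
  have "hausdorff1_outer (\<Union>x\<in>Y. frontier \<omega> \<inter> ball x (r x)) < top" if "finite Y" "Y \<subseteq> frontier \<omega>" for Y
    using that
  proof (induction Y rule: finite_induct)
    case empty
    then show ?case by (simp add: hausdorff1_outer_empty)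
  next
    case (insert x Y)
    then have "hausdorff1_outer (frontier \<omega> \<inter> ball x (r x)) + hausdorff1_outer (\<Union>x\<in>Y. frontier \<omega> \<inter> ball x (r x)) < top"
      using r(2) by simp
    then show ?case
      by (simp only: UN_insert) (rule le_less_trans[OF hausdorff1_outer_Un_le])
  qed
  from this[OF X(2,1)] show ?thesis
    by (rule le_less_trans[OF hausdorff1_outer_mono, rotated]) (use X(3) in blast)
qed

text \<open>A normal orthogonal to \<open>a\<close> is parallel to \<open>b\<close>, so the tangent
  is orthogonal to \<open>b\<close> and the projection onto \<open>b\<close> is stationary along the
  frontier. This is the flatness hypothesis of the Sard lemma.\<close>

lemma frontier_flat_along_tangent:
  assumes "open \<omega>" and n: "outer_unit_normal_at \<omega> x n" "n \<bullet> a = 0"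
    and ab: "norm a = 1" "norm b = 1" "a \<bullet> b = 0" and x: "x \<in> frontier \<omega>" and "0 < \<epsilon>"
  shows "\<exists>\<rho>>0. \<forall>y\<in>frontier \<omega>. dist x y < \<rho> \<longrightarrow> \<bar>b \<bullet> x - b \<bullet> y\<bar> \<le> \<epsilon> * dist x y"
proof -
  obtain p q r \<gamma> d where chart: "lipschitz_chart \<omega> x p q r \<gamma>"
    and d: "(\<gamma> has_real_derivative d) (at (p \<bullet> x))"
    and n_eq: "n = (1 / sqrt (1 + d\<^sup>2)) *\<^sub>R (d *\<^sub>R p - q)"
    using n(1) by (auto simp: outer_unit_normal_at_def)
  have pq: "norm p = 1" "norm q = 1" "p \<bullet> q = 0" "0 < r" using chart by (auto simp: lipschitz_chart_def)
  have d2: "0 < 1 + d\<^sup>2" by (simp add: add_pos_nonneg)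
  define m where "m = d *\<^sub>R p - q"
  have "sqrt (1 + d\<^sup>2) \<noteq> 0" using d2 by simp
  then have "m \<bullet> a = 0" using n(2) unfolding n_eq m_def[symmetric] by simp
  then have m: "m = (b \<bullet> m) *\<^sub>R b"
    using orthonormal_expansion[OF ab, of m] by (simp add: inner_commute)
  have "m \<bullet> q = -1" using pq by (simp add: m_def inner_diff_left norm_eq_1)
  then have "b \<bullet> m \<noteq> 0" using m by (metis inner_zero_left scale_zero_left zero_neq_neg_one)
  \<comment> \<open>The tangent vector p + d q of the graph is orthogonal to m, and m is a nonzero
    multiple of \<open>b\<close>.\<close>
  moreover have "(b \<bullet> m) * (b \<bullet> (p + d *\<^sub>R q)) = 0"
  proof -
    have "m \<bullet> (p + d *\<^sub>R q) = 0"
      using pq by (simp add: m_def inner_diff_left inner_add_right norm_eq_1 inner_commute[of q p])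
    then show ?thesis by (subst (asm) m) simp
  qed
  ultimately have tang: "b \<bullet> p + d * (b \<bullet> q) = 0" by (simp add: inner_add_right)
  obtain \<rho> where \<rho>: "\<rho> > 0" "\<And>s. \<bar>s - p \<bullet> x\<bar> < \<rho> \<Longrightarrow> \<bar>\<gamma> s - \<gamma> (p \<bullet> x) - d * (s - p \<bullet> x)\<bar> \<le> \<epsilon> * \<bar>s - p \<bullet> x\<bar>"
    using d \<open>0 < \<epsilon>\<close> unfolding has_field_derivative_def has_derivative_at_alt by (auto simp: real_norm_def)
  have "\<bar>b \<bullet> x - b \<bullet> y\<bar> \<le> \<epsilon> * dist x y" if y: "y \<in> frontier \<omega>" "dist x y < min \<rho> r" for y
  proof -
    have gr: "q \<bullet> y = \<gamma> (p \<bullet> y)" "q \<bullet> x = \<gamma> (p \<bullet> x)"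
      using lipschitz_chart_frontier[OF assms(1) chart] x y pq(4) by auto
    define h where "h = p \<bullet> y - p \<bullet> x"
    define k where "k = q \<bullet> y - q \<bullet> x"
    have h: "\<bar>h\<bar> \<le> dist x y"
      using Cauchy_Schwarz_ineq2[of p "y - x"] pq(1) by (simp add: h_def inner_diff_right dist_norm norm_minus_commute)
    then have kh: "\<bar>k - d * h\<bar> \<le> \<epsilon> * \<bar>h\<bar>"
      using \<rho>(2)[of "p \<bullet> y"] y(2) gr by (simp add: h_def k_def)
    have "y - x = h *\<^sub>R p + k *\<^sub>R q"
      using orthonormal_expansion[OF pq(1-3), of "y - x"] by (simp add: h_def k_def inner_diff_right)
    \<comment> \<open>With b . p = - d (b . q) the linear part cancels, and only the remainder k - d
      h of the differentiable graph function is left.\<close>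
    then have "b \<bullet> y - b \<bullet> x = h * (b \<bullet> p) + k * (b \<bullet> q)"
      by (metis inner_diff_right inner_add_right inner_scaleR_right)
    also have "\<dots> = (k - d * h) * (b \<bullet> q)" using tang by algebra
    finally have "\<bar>b \<bullet> x - b \<bullet> y\<bar> = \<bar>k - d * h\<bar> * \<bar>b \<bullet> q\<bar>"
      by (metis abs_minus_commute abs_mult)
    also have "\<dots> \<le> \<bar>k - d * h\<bar> * 1"
      using Cauchy_Schwarz_ineq2[of b q] ab pq by (intro mult_left_mono) auto
    also have "\<dots> \<le> \<epsilon> * dist x y"
      using kh h \<open>0 < \<epsilon>\<close> by (smt (verit) mult_left_mono)
    finally show ?thesis .
  qed
  then show ?thesis using \<rho>(1) pq(4) by (intro exI[of _ "min \<rho> r"]) auto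
qed

lemma abs_inner_diff_le_dist: "norm b = 1 \<Longrightarrow> \<bar>b \<bullet> x - b \<bullet> y\<bar> \<le> dist x y"
  using Cauchy_Schwarz_ineq2[of b "x - y"] by (simp add: inner_diff_right dist_norm)

text \<open>Two exceptional sets are removed for different reasons. The points where the normal or
  the condition on \<open>g\<close> fails form an arc-length null set, which almost every line
  avoids. The set \<open>B\<close> may have positive arc length, and only its projection is
  null.\<close>

lemma trace_vanishes_on_lines:
  assumes \<omega>: "open \<omega>" "bounded \<omega>" "lipschitz_boundary \<omega>" and \<nu>: "outer_unit_normal_field \<omega> \<nu>"
    and ab: "norm a = 1" "norm b = 1" "a \<bullet> b = 0"
    and g: "AE y in arc_length \<omega>. g y * (\<nu> y \<bullet> a) = 0"
  shows "AE t in lborel. \<forall>x\<in>frontier \<omega>. b \<bullet> x = t \<longrightarrow> g x = 0"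
proof -
  have fr: "frontier \<omega> \<in> sets hausdorff1" by simp
  have "AE x in arc_length \<omega>. outer_unit_normal_at \<omega> x (\<nu> x) \<and> g x * (\<nu> x \<bullet> a) = 0"
    using \<nu> g unfolding outer_unit_normal_field_def by simp
  then have "AE x in hausdorff1. x \<in> frontier \<omega> \<longrightarrow> outer_unit_normal_at \<omega> x (\<nu> x) \<and> g x * (\<nu> x \<bullet> a) = 0"
    using fr unfolding arc_length_def by (subst (asm) AE_restrict_space_iff) auto
  then have 1: "AE t in lborel. \<forall>x. b \<bullet> x = t \<longrightarrow>
      (x \<in> frontier \<omega> \<longrightarrow> outer_unit_normal_at \<omega> x (\<nu> x) \<and> g x * (\<nu> x \<bullet> a) = 0)"
    by (rule AE_lborel_fibres[rotated]) (rule abs_inner_diff_le_dist[OF ab(2)])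
  define B where "B = {x \<in> frontier \<omega>. outer_unit_normal_at \<omega> x (\<nu> x) \<and> \<nu> x \<bullet> a = 0}"
  have 2: "AE t in lborel. t \<notin> (\<lambda>x. b \<bullet> x) ` B"
  proof (rule AE_lborel_notin_image_flat)
    show "hausdorff1_outer (frontier \<omega>) < top" by (rule hausdorff1_outer_frontier_finite[OF \<omega>])
    show "B \<subseteq> frontier \<omega>" by (auto simp: B_def)
    show "\<exists>\<rho>>0. \<forall>y\<in>frontier \<omega>. dist x y < \<rho> \<longrightarrow> \<bar>b \<bullet> x - b \<bullet> y\<bar> \<le> \<epsilon> * dist x y"
      if "x \<in> B" "0 < \<epsilon>" for x \<epsilon>
      using that frontier_flat_along_tangent[OF \<omega>(1) _ _ ab] by (auto simp: B_def)
  qed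
  from 1 2 show ?thesis
    by eventually_elim (auto simp: B_def)
qed

text \<open>The constant 4 is 2 from the endpoints of components times 2 from Eilenberg's
  inequality. The bound \<open>w\<close> is separate from \<open>F\<close> so that an estimate valid
  only on almost every line, such as |F| = |F - g| where g vanishes, can be used.\<close>

lemma slicing_bound_arc_length:
  fixes F D :: "real^2 \<Rightarrow> real" and w :: "real^2 \<Rightarrow> ennreal"
  assumes \<omega>: "open \<omega>" "bounded \<omega>" and ab: "norm a = 1" "norm b = 1" "a \<bullet> b = 0"
    and F: "\<And>x. ((\<lambda>h. F (x + h *\<^sub>R a)) has_real_derivative D x) (at 0)"
    and D: "continuous_on UNIV D"
    and w: "w \<in> borel_measurable (arc_length \<omega>)"
    and le: "AE t in lborel. \<forall>x\<in>frontier \<omega>. b \<bullet> x = t \<longrightarrow> ennreal \<bar>F x\<bar> \<le> w x"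
  shows "ennreal \<bar>LINT x|lebesgue_on \<omega>. D x\<bar> \<le> 4 * (\<integral>\<^sup>+x. w x \<partial>arc_length \<omega>)"
proof -
  let ?h = "\<lambda>x. w x * indicator (frontier \<omega>) x"
  have "?h \<in> borel_measurable hausdorff1"
    using w unfolding arc_length_def by (subst (asm) borel_measurable_restrict_space_iff_ennreal) (auto simp: space_hausdorff1)
  from eilenberg_inequality[OF abs_inner_diff_le_dist[OF ab(2)] this]
  obtain G where G: "G \<in> borel_measurable lborel"
    "\<And>t. (\<integral>\<^sup>+x. ?h x \<partial>count_space ((\<lambda>x. b \<bullet> x) -` {t})) \<le> G t"
    "(\<integral>\<^sup>+t. G t \<partial>lborel) \<le> 2 * (\<integral>\<^sup>+x. ?h x \<partial>hausdorff1)" by blast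
  have "ennreal \<bar>LINT x|lebesgue_on \<omega>. D x\<bar> \<le> 2 * (\<integral>\<^sup>+t. G t \<partial>lborel)"
  proof (rule slicing_bound[OF \<omega> ab F D G(1)])
    show "AE t in lborel. (\<integral>\<^sup>+x. ennreal \<bar>F x\<bar> \<partial>count_space {x \<in> frontier \<omega>. b \<bullet> x = t}) \<le> G t"
      using le
    proof eventually_elim
      case (elim t)
      have "(\<integral>\<^sup>+x. ennreal \<bar>F x\<bar> \<partial>count_space {x \<in> frontier \<omega>. b \<bullet> x = t})
          \<le> (\<integral>\<^sup>+x. ?h x \<partial>count_space {x \<in> frontier \<omega>. b \<bullet> x = t})"
        using elim by (intro nn_integral_mono) auto
      also have "\<dots> \<le> (\<integral>\<^sup>+x. ?h x \<partial>count_space ((\<lambda>x. b \<bullet> x) -` {t}))"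
        using nn_integral_count_space_inj_le[of "\<lambda>x. x" "{x \<in> frontier \<omega>. b \<bullet> x = t}" "(\<lambda>x. b \<bullet> x) -` {t}" ?h] by auto
      also have "\<dots> \<le> G t" by (rule G)
      finally show ?case .
    qed
  qed
  also have "\<dots> \<le> 2 * (2 * (\<integral>\<^sup>+x. ?h x \<partial>hausdorff1))"
    by (intro mult_left_mono G) simp
  also have "(\<integral>\<^sup>+x. ?h x \<partial>hausdorff1) = (\<integral>\<^sup>+x. w x \<partial>arc_length \<omega>)"
    unfolding arc_length_def by (subst nn_integral_restrict_space) auto
  finally show ?thesis by (simp add: mult.assoc[symmetric])
qed

section \<open>Directional derivatives and traces\<close>

text \<open>The approximating functions enter only through first derivatives, and this class is
  easily seen to be closed under linear combinations.\<close>

definition C1 :: "(real^2 \<Rightarrow> real) \<Rightarrow> bool" where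
  "C1 \<phi> \<longleftrightarrow> \<phi> differentiable_on UNIV \<and> (\<forall>\<alpha>. continuous_on UNIV (partial \<alpha> \<phi>))"

lemma smooth_imp_C1: "smooth \<phi> \<Longrightarrow> C1 \<phi>"
  unfolding smooth_def C1_def by (metis C_k.simps)

lemma C1_continuous: "C1 \<phi> \<Longrightarrow> continuous_on S \<phi>"
  unfolding C1_def by (meson continuous_on_subset differentiable_imp_continuous_on subset_UNIV)

lemma C1_continuous_partial: "C1 \<phi> \<Longrightarrow> continuous_on S (partial \<alpha> \<phi>)"
  unfolding C1_def by (meson continuous_on_subset subset_UNIV)

lemma C1_has_derivative: "C1 \<phi> \<Longrightarrow> (\<phi> has_derivative frechet_derivative \<phi> (at x)) (at x)"
  unfolding C1_def by (simp add: differentiable_on_def frechet_derivative_works[symmetric])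

lemma sum_axis_real2: "(a :: real^2) = (\<Sum>\<alpha>\<in>UNIV. (a $ \<alpha>) *\<^sub>R axis \<alpha> 1)"
  by (simp add: vec_eq_iff sum_2 forall_2 axis_def)

lemma C1_directional_derivative:
  assumes "C1 \<phi>"
  shows "((\<lambda>h. \<phi> (x + h *\<^sub>R a)) has_real_derivative (\<Sum>\<alpha>\<in>UNIV. a $ \<alpha> * partial \<alpha> \<phi> x)) (at 0)"
proof -
  let ?D = "frechet_derivative \<phi> (at x)"
  have D: "(\<phi> has_derivative ?D) (at (x + 0 *\<^sub>R a))" using C1_has_derivative[OF assms, of x] by simp
  then have lin: "linear ?D" by (simp add: has_derivative_linear)
  have "((\<lambda>h. x + h *\<^sub>R a) has_derivative (\<lambda>h. h *\<^sub>R a)) (at 0)"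
    by (auto intro!: derivative_eq_intros)
  then have "((\<lambda>h. \<phi> (x + h *\<^sub>R a)) has_derivative (\<lambda>h. ?D (h *\<^sub>R a))) (at 0)"
    using D by (rule has_derivative_compose[where g=\<phi>])
  moreover have "?D (h *\<^sub>R a) = (\<Sum>\<alpha>\<in>UNIV. a $ \<alpha> * partial \<alpha> \<phi> x) * h" for h
  proof -
    have "?D a = ?D (\<Sum>\<alpha>\<in>UNIV. (a $ \<alpha>) *\<^sub>R axis \<alpha> 1)"
      using sum_axis_real2[of a] by simp
    also have "\<dots> = (\<Sum>\<alpha>\<in>UNIV. a $ \<alpha> * partial \<alpha> \<phi> x)"
      by (simp only: linear_sum[OF lin] linear_cmul[OF lin] partial_def real_scaleR_def)
    finally show ?thesis by (simp add: linear_cmul[OF lin])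
  qed
  ultimately show ?thesis
    by (simp add: has_field_derivative_def)
qed

lemma C1_lincomb:
  assumes "\<And>i. i \<in> I \<Longrightarrow> C1 (\<phi> i)"
  shows "C1 (\<lambda>x. \<Sum>i\<in>I. c i * \<phi> i x)"
    and "partial \<alpha> (\<lambda>x. \<Sum>i\<in>I. c i * \<phi> i x) x = (\<Sum>i\<in>I. c i * partial \<alpha> (\<phi> i) x)"
proof -
  have D: "((\<lambda>x. \<Sum>i\<in>I. c i * \<phi> i x) has_derivative (\<lambda>h. \<Sum>i\<in>I. c i * frechet_derivative (\<phi> i) (at x) h)) (at x)" for x
    using assms by (intro has_derivative_sum has_derivative_mult_right C1_has_derivative) auto
  then show P: "partial \<alpha> (\<lambda>x. \<Sum>i\<in>I. c i * \<phi> i x) x = (\<Sum>i\<in>I. c i * partial \<alpha> (\<phi> i) x)" for \<alpha> x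
    unfolding partial_def by (simp add: frechet_derivative_at[OF D, symmetric])
  then have "partial \<alpha> (\<lambda>x. \<Sum>i\<in>I. c i * \<phi> i x) = (\<lambda>x. \<Sum>i\<in>I. c i * partial \<alpha> (\<phi> i) x)" for \<alpha>
    by (rule ext)
  moreover have "(\<lambda>x. \<Sum>i\<in>I. c i * \<phi> i x) differentiable_on UNIV"
    unfolding differentiable_on_def differentiable_def using D by blast
  moreover have "continuous_on UNIV (\<lambda>x. \<Sum>i\<in>I. c i * partial \<alpha> (\<phi> i) x)" for \<alpha>
    by (intro continuous_intros C1_continuous_partial assms)
  ultimately show "C1 (\<lambda>x. \<Sum>i\<in>I. c i * \<phi> i x)"
    by (simp add: C1_def)
qed

section \<open>Square integrability on the domain and on its boundary\<close>

lemma continuous_bounded_on_closure: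
  fixes f :: "real^2 \<Rightarrow> real"
  assumes "continuous_on UNIV f" "bounded \<omega>"
  obtains C where "0 \<le> C" "\<And>x. x \<in> closure \<omega> \<Longrightarrow> \<bar>f x\<bar> \<le> C"
proof -
  have "compact (f ` closure \<omega>)"
    using assms by (intro compact_continuous_image continuous_on_subset[OF assms(1)]) auto
  then obtain C where "\<forall>y\<in>f ` closure \<omega>. norm y \<le> C"
    using compact_imp_bounded bounded_iff by metis
  then show ?thesis using that[of "max 0 C"] by (auto simp: le_max_iff_disj)
qed

lemma finite_measure_lebesgue_on_bounded: "bounded \<omega> \<Longrightarrow> open (\<omega> :: (real^2) set) \<Longrightarrow> finite_measure (lebesgue_on \<omega>)"
  using emeasure_bounded_finite[of \<omega>]
  by (intro finite_measureI) (simp add: emeasure_restrict_space space_restrict_space)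

lemma square_integrable_lebesgue_on:
  assumes "continuous_on UNIV f" "bounded \<omega>" "open (\<omega> :: (real^2) set)"
  shows "f \<in> square_integrable (lebesgue_on \<omega>)"
proof -
  interpret finite_measure "lebesgue_on \<omega>" by (rule finite_measure_lebesgue_on_bounded) fact+
  obtain C where C: "\<And>x. x \<in> closure \<omega> \<Longrightarrow> \<bar>f x\<bar> \<le> C"
    using continuous_bounded_on_closure[OF assms(1,2)] by metis
  have "f \<in> borel_measurable (lebesgue_on \<omega>)"
    using assms by (intro continuous_imp_measurable_on_sets_lebesgue continuous_on_subset[OF assms(1)]) auto
  then show ?thesis
    using C closure_subset[of \<omega>] by (intro square_integrable_bounded[of f C]) (auto simp: space_restrict_space)
qed

lemma borel_measurable_arc_length:
  assumes "continuous_on UNIV (f :: real^2 \<Rightarrow> real)"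
  shows "f \<in> borel_measurable (arc_length \<omega>)"
  unfolding arc_length_def
  using borel_measurable_continuous_onI[OF assms] by (intro measurable_restrict_space1) (simp cong: measurable_cong_sets)

lemma square_integrable_arc_length:
  assumes "continuous_on UNIV f" and \<omega>: "open \<omega>" "bounded \<omega>" "lipschitz_boundary \<omega>"
  shows "finite_measure (arc_length \<omega>)" "f \<in> square_integrable (arc_length \<omega>)"
proof -
  show fin: "finite_measure (arc_length \<omega>)"
    using hausdorff1_outer_frontier_finite[OF \<omega>]
    by (intro finite_measureI) (simp add: arc_length_def emeasure_restrict_space space_restrict_space emeasure_hausdorff1 less_top)
  interpret finite_measure "arc_length \<omega>" by (rule fin)
  obtain C where C: "\<And>x. x \<in> closure \<omega> \<Longrightarrow> \<bar>f x\<bar> \<le> C"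
    using continuous_bounded_on_closure[OF assms(1) \<omega>(2)] by metis
  show "f \<in> square_integrable (arc_length \<omega>)"
    using C borel_measurable_arc_length[OF assms(1)]
    by (intro square_integrable_bounded[of f C]) (auto simp: arc_length_def space_restrict_space frontier_def)
qed

text \<open>Only the approximating sequence in the definition of the trace is used below; no distributional
  derivative is tested against a smooth function.\<close>

definition trace_approx ::
  "(real^2) set \<Rightarrow> (real^2 \<Rightarrow> real) \<Rightarrow> (2 \<Rightarrow> real^2 \<Rightarrow> real) \<Rightarrow> (real^2 \<Rightarrow> real) \<Rightarrow> (nat \<Rightarrow> real^2 \<Rightarrow> real) \<Rightarrow> bool" where
  "trace_approx \<omega> v W g \<phi> \<longleftrightarrow> (\<forall>n. C1 (\<phi> n)) \<and> L2conv (lebesgue_on \<omega>) \<phi> v \<and>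
     (\<forall>\<alpha>. L2conv (lebesgue_on \<omega>) (\<lambda>n. partial \<alpha> (\<phi> n)) (W \<alpha>)) \<and> L2conv (arc_length \<omega>) \<phi> g"

lemma trace_approxI:
  assumes \<omega>: "open \<omega>" "bounded \<omega>" "lipschitz_boundary \<omega>" and g: "has_trace \<omega> u g"
  shows "\<exists>\<phi>. trace_approx \<omega> u (\<lambda>\<alpha>. weak_partial \<omega> \<alpha> u) g \<phi>"
proof -
  obtain \<phi> where \<phi>: "\<And>n. smooth (\<phi> n)" "tendsto_L2 (lebesgue_on \<omega>) \<phi> u"
    "\<And>\<alpha>. tendsto_L2 (lebesgue_on \<omega>) (\<lambda>n. partial \<alpha> (\<phi> n)) (weak_partial \<omega> \<alpha> u)"
    "tendsto_L2 (arc_length \<omega>) \<phi> g" and u: "u \<in> sobolev 1 \<omega>" and g: "g \<in> square_integrable (arc_length \<omega>)"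
    using g unfolding has_trace_def by blast
  have "u \<in> square_integrable (lebesgue_on \<omega>)" "weak_partial \<omega> \<alpha> u \<in> square_integrable (lebesgue_on \<omega>)" for \<alpha>
    using u by auto
  moreover have C: "C1 (\<phi> n)" for n using \<phi>(1) smooth_imp_C1 by blast
  then have "\<phi> n \<in> square_integrable (lebesgue_on \<omega>)" "partial \<alpha> (\<phi> n) \<in> square_integrable (lebesgue_on \<omega>)"
     "\<phi> n \<in> square_integrable (arc_length \<omega>)" for \<alpha> n
    using \<omega> by (auto intro!: square_integrable_lebesgue_on square_integrable_arc_length C1_continuous C1_continuous_partial)
  ultimately show ?thesis
    using \<phi> g C unfolding trace_approx_def L2conv_def by blast
qed

text \<open>Linearity of derivative and trace, used to pass from the coordinates of the horizontal
  field to its component along a given vector.\<close>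

lemma trace_approx_lincomb:
  assumes "\<And>i. i \<in> I \<Longrightarrow> trace_approx \<omega> (v i) (W i) (g i) (\<phi> i)"
  shows "trace_approx \<omega> (\<lambda>x. \<Sum>i\<in>I. c i * v i x) (\<lambda>\<alpha> x. \<Sum>i\<in>I. c i * W i \<alpha> x) (\<lambda>x. \<Sum>i\<in>I. c i * g i x)
     (\<lambda>n x. \<Sum>i\<in>I. c i * \<phi> i n x)"
proof -
  have C: "C1 (\<phi> i n)" if "i \<in> I" for i n using assms[OF that] by (simp add: trace_approx_def)
  have "partial \<alpha> (\<lambda>x. \<Sum>i\<in>I. c i * \<phi> i n x) = (\<lambda>x. \<Sum>i\<in>I. c i * partial \<alpha> (\<phi> i n) x)" for \<alpha> n
    using C1_lincomb(2)[where \<phi>="\<lambda>i. \<phi> i n"] C by blast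
  then show ?thesis
    using assms C unfolding trace_approx_def
    by (auto intro!: C1_lincomb(1) L2conv_sum L2conv_scale)
qed

lemma L2conv_lebesgue_on_mult:
  fixes f :: "real^2 \<Rightarrow> real"
  assumes "continuous_on UNIV f" "bounded \<omega>" "open \<omega>" "L2conv (lebesgue_on \<omega>) F v"
  shows "L2conv (lebesgue_on \<omega>) (\<lambda>n x. f x * F n x) (\<lambda>x. f x * v x)"
proof -
  obtain C where C: "\<And>x. x \<in> closure \<omega> \<Longrightarrow> \<bar>f x\<bar> \<le> C"
    using continuous_bounded_on_closure[OF assms(1,2)] by metis
  show ?thesis
    using C closure_subset[of \<omega>] square_integrable_measurable[OF square_integrable_lebesgue_on[OF assms(1-3)]]
    by (intro L2conv_cmult[where C=C] assms(4)) (auto simp: space_restrict_space)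
qed

lemma trace_approx_directional:
  assumes "trace_approx \<omega> v W g \<phi>"
  shows "L2conv (lebesgue_on \<omega>) (\<lambda>n x. \<Sum>\<alpha>\<in>UNIV. a $ \<alpha> * partial \<alpha> (\<phi> n) x) (\<lambda>x. \<Sum>\<alpha>\<in>UNIV. a $ \<alpha> * W \<alpha> x)"
  using assms by (auto simp: trace_approx_def intro!: L2conv_sum L2conv_scale)

text \<open>On a finite measure space the constant 1 is square integrable; pairing it with |F n - f|
  turns convergence in the square mean into convergence in the mean.\<close>

lemma nn_integral_abs_L2conv:
  assumes "finite_measure M" "L2conv M F f"
  shows "(\<lambda>n. \<integral>\<^sup>+x. ennreal \<bar>F n x - f x\<bar> \<partial>M) \<longlonglongrightarrow> 0"
proof -
  interpret finite_measure M by fact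
  have sq: "F n \<in> square_integrable M" "f \<in> square_integrable M" for n
    using assms by (auto simp: L2conv_iff)
  note d = square_integrable_diff[OF sq]
  have "(\<lambda>x. \<bar>F n x - f x\<bar>) \<in> borel_measurable M" for n
    by (intro borel_measurable_abs square_integrable_measurable d)
  then have "(\<lambda>n x. \<bar>F n x - f x\<bar>) n \<in> square_integrable M" for n
    using d[of n] by (simp add: square_integrable_def)
  then have "L2conv M (\<lambda>n x. \<bar>F n x - f x\<bar>) (\<lambda>_. 0)"
    using assms(2) by (simp add: L2conv_iff) (simp add: square_integrable_def)
  moreover have one: "L2conv M (\<lambda>_ _. 1) (\<lambda>_. 1)"
    by (rule L2conv_const) (auto intro: square_integrable_bounded)
  ultimately have "(\<lambda>n. \<integral>x. \<bar>F n x - f x\<bar> * 1 \<partial>M) \<longlonglongrightarrow> (\<integral>x. 0 * 1 \<partial>M)"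
    by (rule L2conv_integral_mult)
  moreover have "integrable M (\<lambda>x. \<bar>F n x - f x\<bar>)" for n
    using square_integrable_mult[OF d[of n], of "\<lambda>_. 1"] one by (simp add: L2conv_iff)
  then have "(\<integral>\<^sup>+x. ennreal \<bar>F n x - f x\<bar> \<partial>M) = ennreal (\<integral>x. \<bar>F n x - f x\<bar> \<partial>M)" for n
    by (intro nn_integral_eq_integral) auto
  ultimately show ?thesis by (simp flip: ennreal_0 add: tendsto_ennreal_iff)
qed

lemma limit_zero_of_ennreal_bound:
  assumes "X \<longlonglongrightarrow> (L::real)" "\<And>n. ennreal \<bar>X n\<bar> \<le> c * Y n" "Y \<longlonglongrightarrow> 0" "c < top"
  shows "L = 0"
proof -
  have "(\<lambda>n. c * Y n) \<longlonglongrightarrow> c * 0"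
    using assms(3,4) by (intro ennreal_tendsto_cmult) auto
  moreover have "(\<lambda>n. ennreal \<bar>X n\<bar>) \<longlonglongrightarrow> ennreal \<bar>L\<bar>"
    using assms(1) by (intro tendsto_intros)
  ultimately have "ennreal \<bar>L\<bar> \<le> 0"
    using assms(2) by (intro LIMSEQ_le[where X="\<lambda>n. ennreal \<bar>X n\<bar>"]) auto
  then show ?thesis by simp
qed

text \<open>At the boundary points of almost every line g = 0, hence |\<phi> n| = |\<phi> n - g|
  there. The slicing bound then tends to 0 with the arc-length integral of |\<phi> n - g|.\<close>

lemma integral_directional_derivative_zero:
  assumes \<omega>: "open \<omega>" "bounded \<omega>" "lipschitz_boundary \<omega>"
    and ab: "norm a = 1" "norm b = 1" "a \<bullet> b = 0"
    and v: "trace_approx \<omega> v W g \<phi>"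
    and g: "AE t in lborel. \<forall>x\<in>frontier \<omega>. b \<bullet> x = t \<longrightarrow> g x = 0"
  shows "(LINT x|lebesgue_on \<omega>. (\<Sum>\<alpha>\<in>UNIV. a $ \<alpha> * W \<alpha> x)) = 0"
proof -
  have C: "C1 (\<phi> n)" for n using v by (simp add: trace_approx_def)
  have conv: "L2conv (arc_length \<omega>) \<phi> g" using v by (simp add: trace_approx_def)
  have "L2conv (lebesgue_on \<omega>) (\<lambda>_ _. 1) (\<lambda>_. 1)"
    using \<omega> by (intro L2conv_const square_integrable_lebesgue_on) auto
  from L2conv_integral_mult[OF trace_approx_directional[OF v, of a] this]
  have "(\<lambda>n. LINT x|lebesgue_on \<omega>. (\<Sum>\<alpha>\<in>UNIV. a $ \<alpha> * partial \<alpha> (\<phi> n) x)) \<longlonglongrightarrow>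
      (LINT x|lebesgue_on \<omega>. (\<Sum>\<alpha>\<in>UNIV. a $ \<alpha> * W \<alpha> x))" by simp
  moreover have "ennreal \<bar>LINT x|lebesgue_on \<omega>. (\<Sum>\<alpha>\<in>UNIV. a $ \<alpha> * partial \<alpha> (\<phi> n) x)\<bar>
      \<le> 4 * (\<integral>\<^sup>+x. ennreal \<bar>\<phi> n x - g x\<bar> \<partial>arc_length \<omega>)" for n
  proof (rule slicing_bound_arc_length[OF \<omega>(1,2) ab C1_directional_derivative[OF C]])
    show "continuous_on UNIV (\<lambda>x. \<Sum>\<alpha>\<in>UNIV. a $ \<alpha> * partial \<alpha> (\<phi> n) x)"
      using C by (intro continuous_intros C1_continuous_partial)
    have "\<phi> n \<in> borel_measurable (arc_length \<omega>)" "g \<in> borel_measurable (arc_length \<omega>)"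
      using conv by (auto simp: L2conv_def dest: square_integrable_measurable)
    then show "(\<lambda>x. ennreal \<bar>\<phi> n x - g x\<bar>) \<in> borel_measurable (arc_length \<omega>)" by measurable
    show "AE t in lborel. \<forall>x\<in>frontier \<omega>. b \<bullet> x = t \<longrightarrow> ennreal \<bar>\<phi> n x\<bar> \<le> ennreal \<bar>\<phi> n x - g x\<bar>"
      using g by eventually_elim auto
  qed
  ultimately show ?thesis
    by (rule limit_zero_of_ennreal_bound)
      (use nn_integral_abs_L2conv[OF square_integrable_arc_length(1)[of "\<lambda>_. 0", OF _ \<omega>] conv] in auto)
qed

text \<open>The weight $a \cdot x$ has derivative 1 along \<open>a\<close>, so
  $\partial_a((a \cdot x) v^2) = v^2$ if $\partial_a v = 0$.\<close>

lemma AE_zero_of_directional_derivative_zero: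
  assumes \<omega>: "open \<omega>" "bounded \<omega>" "lipschitz_boundary \<omega>"
    and ab: "norm a = 1" "norm b = 1" "a \<bullet> b = 0"
    and v: "trace_approx \<omega> v W g \<phi>"
    and g: "AE t in lborel. \<forall>x\<in>frontier \<omega>. b \<bullet> x = t \<longrightarrow> g x = 0"
    and W: "AE x in lebesgue_on \<omega>. (\<Sum>\<alpha>\<in>UNIV. a $ \<alpha> * W \<alpha> x) = 0"
  shows "AE x in lebesgue_on \<omega>. v x = 0"
proof -
  let ?d = "\<lambda>n x. \<Sum>\<alpha>\<in>UNIV. a $ \<alpha> * partial \<alpha> (\<phi> n) x"
  let ?w = "\<lambda>x. \<Sum>\<alpha>\<in>UNIV. a $ \<alpha> * W \<alpha> x"
  have C: "C1 (\<phi> n)" for n using v by (simp add: trace_approx_def)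
  have conv: "L2conv (arc_length \<omega>) \<phi> g" and convL: "L2conv (lebesgue_on \<omega>) \<phi> v"
    using v by (auto simp: trace_approx_def)
  note convd = trace_approx_directional[OF v, of a]
  have cont: "continuous_on UNIV (\<lambda>x. 2 * (a \<bullet> x))" by (intro continuous_intros)
  have conv2: "L2conv (lebesgue_on \<omega>) (\<lambda>n x. 2 * (a \<bullet> x) * \<phi> n x) (\<lambda>x. 2 * (a \<bullet> x) * v x)"
    by (rule L2conv_lebesgue_on_mult[OF cont \<omega>(2,1) convL])
  obtain K where K: "0 \<le> K" "\<And>x. x \<in> closure \<omega> \<Longrightarrow> \<bar>a \<bullet> x\<bar> \<le> K"
    by (rule continuous_bounded_on_closure[of "\<lambda>x. a \<bullet> x" \<omega>]) (use \<omega>(2) in \<open>auto intro!: continuous_intros\<close>)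
  have int: "integrable (lebesgue_on \<omega>) (\<lambda>x. (\<phi> n x)\<^sup>2)"
      "integrable (lebesgue_on \<omega>) (\<lambda>x. 2 * (a \<bullet> x) * \<phi> n x * ?d n x)" for n
    using convL conv2 convd square_integrable_mult[of "\<lambda>x. 2 * (a \<bullet> x) * \<phi> n x" _ "?d n"]
    by (auto simp: L2conv_def square_integrable_def[of "lebesgue_on \<omega>"])
  have "(\<lambda>n. (LINT x|lebesgue_on \<omega>. (\<phi> n x)\<^sup>2) + (LINT x|lebesgue_on \<omega>. 2 * (a \<bullet> x) * \<phi> n x * ?d n x)) \<longlonglongrightarrow>
      (LINT x|lebesgue_on \<omega>. (v x)\<^sup>2) + (LINT x|lebesgue_on \<omega>. 2 * (a \<bullet> x) * v x * ?w x)"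
    by (intro tendsto_add L2conv_integral_square[OF convL] L2conv_integral_mult[OF conv2 convd])
  moreover have "(LINT x|lebesgue_on \<omega>. 2 * (a \<bullet> x) * v x * ?w x) = 0"
    using W by (intro integral_eq_zero_AE) (auto elim: eventually_mono)
  ultimately have lim: "(\<lambda>n. LINT x|lebesgue_on \<omega>. (\<phi> n x)\<^sup>2 + 2 * (a \<bullet> x) * \<phi> n x * ?d n x) \<longlonglongrightarrow>
      (LINT x|lebesgue_on \<omega>. (v x)\<^sup>2)"
    using int by simp
  have bound: "ennreal \<bar>LINT x|lebesgue_on \<omega>. (\<phi> n x)\<^sup>2 + 2 * (a \<bullet> x) * \<phi> n x * ?d n x\<bar>
      \<le> (4 * ennreal K) * (\<integral>\<^sup>+x. ennreal ((\<phi> n x - g x)\<^sup>2) \<partial>arc_length \<omega>)" for n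
  proof -
    have m: "\<phi> n \<in> borel_measurable (arc_length \<omega>)" "g \<in> borel_measurable (arc_length \<omega>)"
      using conv by (auto simp: L2conv_def dest: square_integrable_measurable)
    have "ennreal \<bar>LINT x|lebesgue_on \<omega>. (\<phi> n x)\<^sup>2 + 2 * (a \<bullet> x) * \<phi> n x * ?d n x\<bar>
      \<le> 4 * (\<integral>\<^sup>+x. ennreal K * ennreal ((\<phi> n x - g x)\<^sup>2) \<partial>arc_length \<omega>)"
    proof (rule slicing_bound_arc_length[OF \<omega>(1,2) ab, where F="\<lambda>x. (a \<bullet> x) * (\<phi> n x)\<^sup>2"])
      have "a \<bullet> a = 1" using ab(1) by (simp add: norm_eq_1)
      then show "((\<lambda>h. (a \<bullet> (x + h *\<^sub>R a)) * (\<phi> n (x + h *\<^sub>R a))\<^sup>2) has_real_derivative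
          (\<phi> n x)\<^sup>2 + 2 * (a \<bullet> x) * \<phi> n x * ?d n x) (at 0)" for x
        unfolding inner_add_right inner_scaleR_right
        by (auto intro!: derivative_eq_intros C1_directional_derivative[OF C] simp: algebra_simps)
      show "continuous_on UNIV (\<lambda>x. (\<phi> n x)\<^sup>2 + 2 * (a \<bullet> x) * \<phi> n x * ?d n x)"
        using C by (intro continuous_intros C1_continuous_partial C1_continuous)
      show "(\<lambda>x. ennreal K * ennreal ((\<phi> n x - g x)\<^sup>2)) \<in> borel_measurable (arc_length \<omega>)"
        using m by measurable
      \<comment> \<open>Where g vanishes, the square of \<phi> n is that of \<phi> n - g, so the
        quadratic choice of \<open>F\<close> matches the mean-square convergence to the
        trace.\<close>
      show "AE t in lborel. \<forall>x\<in>frontier \<omega>. b \<bullet> x = t \<longrightarrow>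
          ennreal \<bar>(a \<bullet> x) * (\<phi> n x)\<^sup>2\<bar> \<le> ennreal K * ennreal ((\<phi> n x - g x)\<^sup>2)"
        using g
      proof eventually_elim
        case (elim t)
        then show ?case
          using K by (auto simp: abs_mult frontier_def ennreal_mult[symmetric] intro!: ennreal_leI mult_right_mono)
      qed
    qed
    also have "(\<integral>\<^sup>+x. ennreal K * ennreal ((\<phi> n x - g x)\<^sup>2) \<partial>arc_length \<omega>)
        = ennreal K * (\<integral>\<^sup>+x. ennreal ((\<phi> n x - g x)\<^sup>2) \<partial>arc_length \<omega>)"
      using m by (intro nn_integral_cmult) measurable
    finally show ?thesis by (simp add: mult.assoc)
  qed
  have "(LINT x|lebesgue_on \<omega>. (v x)\<^sup>2) = 0"
    using lim bound
  proof (rule limit_zero_of_ennreal_bound)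
    show "(\<lambda>n. \<integral>\<^sup>+x. ennreal ((\<phi> n x - g x)\<^sup>2) \<partial>arc_length \<omega>) \<longlonglongrightarrow> 0"
      using conv by (simp add: L2conv_def tendsto_L2_def)
    show "4 * ennreal K < top" by (simp add: ennreal_mult_less_top)
  qed
  then show ?thesis
    using convL by (intro square_integral_zero_AE) (auto simp: L2conv_def)
qed

section \<open>Closability of the directional derivative\<close>

text \<open>Boxes are stable under intersection and generate the Borel sets, so the vanishing
  spreads to all Borel sets by a Dynkin argument. The integral over the whole space, needed for
  complements, is a limit over growing boxes.\<close>

lemma AE_zero_of_box_integrals:
  fixes f :: "'a::euclidean_space \<Rightarrow> real"
  assumes f: "integrable lborel f" and box: "\<And>l u. (LINT x:box l u|lborel. f x) = 0"
  shows "AE x in lborel. f x = 0"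
proof -
  have si: "set_integrable lborel A f" if "A \<in> sets borel" for A
    using f that unfolding set_integrable_def by (intro integrable_mult_indicator) auto
  have UNIV: "(LINT x|lborel. f x) = 0"
  proof -
    let ?A = "\<lambda>n::nat. box (- (real n *\<^sub>R One)) (real n *\<^sub>R One) :: 'a set"
    have A: "incseq ?A" "(\<Union>n. ?A n) = UNIV"
      by (auto simp: incseq_def UN_box_eq_UNIV intro!: subset_box_imp)
    then have "(\<lambda>n. LINT x:?A n|lborel. f x) \<longlonglongrightarrow> (LINT x:(\<Union>n. ?A n)|lborel. f x)"
      using si[of "\<Union>n. ?A n"] by (intro set_integral_cont_up) auto
    then have "(LINT x:UNIV|lborel. f x) = 0"
      unfolding A(2) box by (simp add: LIMSEQ_const_iff)
    then show ?thesis by (simp add: set_lebesgue_integral_def)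
  qed
  have "(LINT x:A|lborel. f x) = 0" if A: "A \<in> sets borel" for A
  proof -
    have "Int_stable (range (\<lambda>(a, b). box a b :: 'a set))"
      by (auto simp: Int_stable_def box_Int_box)
    moreover have "range (\<lambda>(a, b). box a b :: 'a set) \<subseteq> Pow UNIV" by simp
    moreover have "A \<in> sigma_sets UNIV (range (\<lambda>(a, b). box a b :: 'a set))"
      using A by (simp add: borel_eq_box)
    ultimately show ?thesis
    proof (induction rule: sigma_sets_induct_disjoint)
      case (basic A)
      then show ?case using box by auto
    next
      case empty
      then show ?case by (simp add: set_lebesgue_integral_def)
    next
      case (compl A)
      then have A: "A \<in> sets borel" by (simp add: borel_eq_box)
      have "(LINT x:A|lborel. f x) + (LINT x:UNIV - A|lborel. f x) = (LINT x:A \<union> (UNIV - A)|lborel. f x)"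
        using A by (intro set_integral_Un[symmetric] si) auto
      then show ?case using compl UNIV by (simp add: set_lebesgue_integral_def)
    next
      case (union A)
      then have A: "A i \<in> sets borel" for i by (auto simp: borel_eq_box)
      have "(LINT x:(\<Union>i. A i)|lborel. f x) = (\<Sum>i. LINT x:A i|lborel. f x)"
        using union(1) A by (intro lebesgue_integral_countable_add si) (auto simp: disjoint_family_on_def)
      then show ?case using union by simp
    qed
  qed
  then show ?thesis
    using f by (intro density_unique_real[where f'="\<lambda>_. 0"]) (auto simp: set_lebesgue_integral_def)
qed

lemma has_real_derivative_pos_part_square:
  "((\<lambda>y::real. (max 0 y)\<^sup>2) has_real_derivative 2 * max 0 y) (at y)"
proof -
  consider "y < 0" | "y = 0" | "0 < y" by linarith
  then show ?thesis
  proof cases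
    case 1
    have "((\<lambda>y::real. 0) has_real_derivative 2 * max 0 y) (at y)" using 1 by simp
    then show ?thesis
      by (rule has_field_derivative_transform_within_open[of _ _ _ "{..<0}"]) (use 1 in auto)
  next
    case 2
    \<comment> \<open>The square makes the value at most h^2, which is o(h): the kink of the
      positive part disappears.\<close>
    have "norm ((max 0 h)\<^sup>2) \<le> e * \<bar>h\<bar>" if "\<bar>h\<bar> < e" for h e :: real
      using that by (auto simp: max_def power2_eq_square mult_right_mono mult_le_0_iff)
    then show ?thesis
      unfolding has_field_derivative_def has_derivative_at_alt 2
      by (auto intro!: exI[of _ "_::real"] simp: bounded_linear_mult_right) 
  next
    case 3
    have "((\<lambda>y::real. y\<^sup>2) has_real_derivative 2 * max 0 y) (at y)"
      using 3 by (auto intro!: derivative_eq_intros)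
    then show ?thesis
      by (rule has_field_derivative_transform_within_open[of _ _ _ "{0<..}"]) (use 3 in auto)
  qed
qed

text \<open>The function m is continuously differentiable along \<open>b\<close>, positive in the
  box and 0 elsewhere. Hence k m / (1 + k m) increases to the indicator of the box while keeping a
  continuous derivative along \<open>b\<close>.\<close>

lemma box_bump:
  fixes l u b :: "real^2"
  assumes lu: "\<And>i. l $ i < u $ i"
  obtains \<psi> D :: "nat \<Rightarrow> real^2 \<Rightarrow> real" where
    "\<And>k. continuous_on UNIV (\<psi> k)" "\<And>k. continuous_on UNIV (D k)"
    "\<And>k x. ((\<lambda>h. \<psi> k (x + h *\<^sub>R b)) has_real_derivative D k x) (at 0)"
    "\<And>k x. x \<notin> box l u \<Longrightarrow> \<psi> k x = 0" "\<And>k x. \<bar>\<psi> k x\<bar> \<le> 1"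
    "\<And>x. (\<lambda>k. \<psi> k x) \<longlonglongrightarrow> indicator (box l u) x"
proof -
  define q where "q i x = (x $ i - l $ i) * (u $ i - x $ i)" for i and x :: "real^2"
  define dq where "dq i x = b $ i * (u $ i - x $ i) - (x $ i - l $ i) * b $ i" for i and x :: "real^2"
  define m where "m x = (max 0 (q 1 x))\<^sup>2 * (max 0 (q 2 x))\<^sup>2" for x
  define dm where "dm x = 2 * max 0 (q 1 x) * dq 1 x * (max 0 (q 2 x))\<^sup>2
     + (max 0 (q 1 x))\<^sup>2 * (2 * max 0 (q 2 x) * dq 2 x)" for x
  have q: "((\<lambda>h. q i (x + h *\<^sub>R b)) has_real_derivative dq i x) (at 0)" for i x
    unfolding q_def dq_def by (auto intro!: derivative_eq_intros)
  have t: "((\<lambda>h. (max 0 (q i (x + h *\<^sub>R b)))\<^sup>2) has_real_derivative 2 * max 0 (q i x) * dq i x) (at 0)" for i x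
    using DERIV_chain2[OF has_real_derivative_pos_part_square q] by simp
  have m: "((\<lambda>h. m (x + h *\<^sub>R b)) has_real_derivative dm x) (at 0)" for x
    using DERIV_mult[OF t[of 1 x] t[of 2 x]] by (simp add: m_def dm_def algebra_simps)
  have m0: "0 \<le> m x" for x by (simp add: m_def)
  have pos: "0 < q i x \<longleftrightarrow> l $ i < x $ i \<and> x $ i < u $ i" for i x
    using lu[of i] by (auto simp: q_def zero_less_mult_iff)
  have mpos: "0 < m x \<longleftrightarrow> x \<in> box l u" for x
    using pos[of 1 x] pos[of 2 x] by (auto simp: m_def mem_box_cart forall_2 max_def zero_less_mult_iff)
  define \<psi> where "\<psi> k x = real k * m x / (1 + real k * m x)" for k :: nat and x
  have den: "0 < 1 + real k * m x" for k :: nat and x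
    using m0[of x] by (simp add: add_pos_nonneg)
  have mc: "continuous_on UNIV m" unfolding m_def q_def by (intro continuous_intros)
  show ?thesis
  proof (rule that[of \<psi> "\<lambda>k x. real k * dm x / (1 + real k * m x)\<^sup>2"])
    fix k :: nat
    show "continuous_on UNIV (\<psi> k)"
      unfolding \<psi>_def using den[of k] by (intro continuous_intros mc) (auto simp: less_imp_neq[symmetric])
    show "continuous_on UNIV (\<lambda>x. real k * dm x / (1 + real k * m x)\<^sup>2)"
      unfolding dm_def dq_def q_def
      using den[of k] by (intro continuous_intros mc) (auto simp: less_imp_neq[symmetric])
    show "((\<lambda>h. \<psi> k (x + h *\<^sub>R b)) has_real_derivative real k * dm x / (1 + real k * m x)\<^sup>2) (at 0)" for x
      unfolding \<psi>_def using den[of k x]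
      by (auto intro!: derivative_eq_intros m simp: power2_eq_square algebra_simps)
    show "\<bar>\<psi> k x\<bar> \<le> 1" for x
      using den[of k x] m0[of x] by (simp add: \<psi>_def)
    show "\<psi> k x = 0" if "x \<notin> box l u" for x
      using that mpos[of x] m0[of x] by (simp add: \<psi>_def)
  next
    fix x
    show "(\<lambda>k. \<psi> k x) \<longlonglongrightarrow> indicator (box l u) x"
    proof (cases "x \<in> box l u")
      case True
      then have mx: "0 < m x" using mpos by blast
      have "(\<lambda>k. 1 - inverse (1 + real k * m x)) \<longlonglongrightarrow> 1 - 0"
        by (intro tendsto_intros tendsto_inverse_0_at_top filterlim_tendsto_add_at_top[OF tendsto_const]
            filterlim_at_top_mult_tendsto_pos[OF tendsto_const mx] filterlim_real_sequentially)
      moreover have "1 - inverse (1 + real k * m x) = \<psi> k x" for k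
        using den[of k x] by (simp add: \<psi>_def field_simps)
      ultimately show ?thesis using True by simp
    next
      case False
      then have "m x = 0" using mpos[of x] m0[of x] by linarith
      then show ?thesis using False by (simp add: \<psi>_def)
    qed
  qed
qed

text \<open>Integration by parts: the product of \<psi> and \<phi> n vanishes on the frontier, so
  the slicing bound for its derivative is 0. In the limit the term containing v drops out as
  well.\<close>

lemma integral_test_directional_derivative_zero:
  assumes \<omega>: "open \<omega>" "bounded \<omega>"
    and ab: "norm a = 1" "norm b = 1" "a \<bullet> b = 0"
    and v: "trace_approx \<omega> v W g \<phi>" and v0: "AE x in lebesgue_on \<omega>. v x = 0"
    and \<psi>: "continuous_on UNIV \<psi>" "continuous_on UNIV D"
      "\<And>x. ((\<lambda>h. \<psi> (x + h *\<^sub>R a)) has_real_derivative D x) (at 0)" "\<And>x. x \<in> frontier \<omega> \<Longrightarrow> \<psi> x = 0"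
  shows "(LINT x|lebesgue_on \<omega>. \<psi> x * (\<Sum>\<alpha>\<in>UNIV. a $ \<alpha> * W \<alpha> x)) = 0"
proof -
  let ?d = "\<lambda>n x. \<Sum>\<alpha>\<in>UNIV. a $ \<alpha> * partial \<alpha> (\<phi> n) x"
  let ?w = "\<lambda>x. \<Sum>\<alpha>\<in>UNIV. a $ \<alpha> * W \<alpha> x"
  have C: "C1 (\<phi> n)" for n using v by (simp add: trace_approx_def)
  have conv: "L2conv (lebesgue_on \<omega>) \<phi> v" using v by (simp add: trace_approx_def)
  note convd = trace_approx_directional[OF v, of a]
  have conv\<psi>: "L2conv (lebesgue_on \<omega>) (\<lambda>_. \<psi>) \<psi>" "L2conv (lebesgue_on \<omega>) (\<lambda>_. D) D"
    using \<psi> \<omega> by (auto intro!: L2conv_const square_integrable_lebesgue_on)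
  have int: "integrable (lebesgue_on \<omega>) (\<lambda>x. \<psi> x * ?d n x)" "integrable (lebesgue_on \<omega>) (\<lambda>x. D x * \<phi> n x)" for n
    using conv\<psi> conv convd by (auto simp: L2conv_def intro!: square_integrable_mult)
  have "(\<lambda>n. (LINT x|lebesgue_on \<omega>. \<psi> x * ?d n x) + (LINT x|lebesgue_on \<omega>. D x * \<phi> n x)) \<longlonglongrightarrow>
      (LINT x|lebesgue_on \<omega>. \<psi> x * ?w x) + (LINT x|lebesgue_on \<omega>. D x * v x)"
    by (intro tendsto_add L2conv_integral_mult conv\<psi> conv convd)
  moreover have "(LINT x|lebesgue_on \<omega>. D x * v x) = 0"
    using v0 by (intro integral_eq_zero_AE) (auto elim: eventually_mono)
  moreover have "(LINT x|lebesgue_on \<omega>. \<psi> x * ?d n x) + (LINT x|lebesgue_on \<omega>. D x * \<phi> n x) = 0" for n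
  proof -
    have "ennreal \<bar>LINT x|lebesgue_on \<omega>. \<psi> x * ?d n x + D x * \<phi> n x\<bar> \<le> 4 * (\<integral>\<^sup>+x. 0 \<partial>arc_length \<omega>)"
    proof (rule slicing_bound_arc_length[OF \<omega> ab, where F="\<lambda>x. \<psi> x * \<phi> n x"])
      show "((\<lambda>h. \<psi> (x + h *\<^sub>R a) * \<phi> n (x + h *\<^sub>R a)) has_real_derivative \<psi> x * ?d n x + D x * \<phi> n x) (at 0)" for x
        by (auto intro!: derivative_eq_intros C1_directional_derivative[OF C] \<psi>(3))
      show "continuous_on UNIV (\<lambda>x. \<psi> x * ?d n x + D x * \<phi> n x)"
        by (intro continuous_intros C1_continuous_partial[OF C] C1_continuous[OF C] \<psi>)
    qed (use \<psi>(4) in auto)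
    then show ?thesis using int by simp
  qed
  ultimately show ?thesis by (simp add: LIMSEQ_const_iff)
qed

text \<open>Closability: if \<phi> n tends to 0, the limit of its directional derivatives is
  orthogonal to all the cutoffs, hence has zero integral over every box inside the domain.\<close>

lemma AE_directional_derivative_zero:
  assumes \<omega>: "open \<omega>" "bounded \<omega>"
    and ab: "norm a = 1" "norm b = 1" "a \<bullet> b = 0"
    and v: "trace_approx \<omega> v W g \<phi>" and v0: "AE x in lebesgue_on \<omega>. v x = 0"
  shows "AE x in lebesgue_on \<omega>. (\<Sum>\<alpha>\<in>UNIV. a $ \<alpha> * W \<alpha> x) = 0"
proof -
  let ?w = "\<lambda>x. \<Sum>\<alpha>\<in>UNIV. a $ \<alpha> * W \<alpha> x"
  have "L2conv (lebesgue_on \<omega>) (\<lambda>_ _. 1) (\<lambda>_. 1)"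
    using \<omega> by (intro L2conv_const square_integrable_lebesgue_on) auto
  then have intw: "integrable (lebesgue_on \<omega>) ?w"
    using trace_approx_directional[OF v, of a] square_integrable_mult[of "\<lambda>_. 1" _ ?w]
    by (auto simp: L2conv_def)
  have box0: "(LINT x|lebesgue_on \<omega>. indicator (box l u) x * ?w x) = 0" if sub: "box l u \<subseteq> \<omega>" for l u
  proof (cases "box l u = {}")
    case False
    then have lu: "l $ i < u $ i" for i
      by (auto simp: mem_box_cart) (meson less_trans)
    obtain \<psi> D :: "nat \<Rightarrow> real^2 \<Rightarrow> real" where \<psi>: "\<And>k. continuous_on UNIV (\<psi> k)" "\<And>k. continuous_on UNIV (D k)"
      "\<And>k x. ((\<lambda>h. \<psi> k (x + h *\<^sub>R a)) has_real_derivative D k x) (at 0)"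
      "\<And>k x. x \<notin> box l u \<Longrightarrow> \<psi> k x = 0" "\<And>k x. \<bar>\<psi> k x\<bar> \<le> 1"
      "\<And>x. (\<lambda>k. \<psi> k x) \<longlonglongrightarrow> indicator (box l u) x"
      using box_bump[OF lu, of a] by blast
    have fr: "\<psi> k x = 0" if "x \<in> frontier \<omega>" for k x
      using that sub \<omega>(1) by (intro \<psi>(4)) (auto simp: frontier_def interior_open)
    have "(\<lambda>k. LINT x|lebesgue_on \<omega>. \<psi> k x * ?w x) \<longlonglongrightarrow> (LINT x|lebesgue_on \<omega>. indicator (box l u) x * ?w x)"
    proof (rule integral_dominated_convergence[where w="\<lambda>x. \<bar>?w x\<bar>"])
      show "integrable (lebesgue_on \<omega>) (\<lambda>x. \<bar>?w x\<bar>)" using intw by (rule integrable_abs)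
      have "\<psi> k \<in> borel_measurable (lebesgue_on \<omega>)" for k
        using \<psi>(1) \<omega> by (intro square_integrable_measurable square_integrable_lebesgue_on)
      then show "(\<lambda>x. \<psi> k x * ?w x) \<in> borel_measurable (lebesgue_on \<omega>)" for k
        using intw by (intro borel_measurable_times) auto
      have "indicator (box l u) \<in> borel_measurable (lebesgue_on \<omega>)"
        by (intro measurable_restrict_space1 borel_measurable_indicator) auto
      then show "(\<lambda>x. indicator (box l u) x * ?w x) \<in> borel_measurable (lebesgue_on \<omega>)"
        using intw by (intro borel_measurable_times) auto
      show "AE x in lebesgue_on \<omega>. (\<lambda>k. \<psi> k x * ?w x) \<longlonglongrightarrow> indicator (box l u) x * ?w x"
        by (intro AE_I2 tendsto_mult \<psi>(6) tendsto_const)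
      show "AE x in lebesgue_on \<omega>. norm (\<psi> k x * ?w x) \<le> \<bar>?w x\<bar>" for k
        using \<psi>(5)[of k] by (intro AE_I2) (simp add: abs_mult mult_left_le_one_le)
    qed
    moreover have "(LINT x|lebesgue_on \<omega>. \<psi> k x * ?w x) = 0" for k
      by (rule integral_test_directional_derivative_zero[OF \<omega> ab v v0 \<psi>(1-3) fr])
    ultimately show ?thesis by (simp add: LIMSEQ_const_iff)
  qed simp
  have \<omega>m: "\<omega> \<in> sets borel" using \<omega> by simp
  have f: "integrable lebesgue (\<lambda>x. indicator \<omega> x * ?w x)"
    using intw \<omega>m by (subst (asm) integrable_restrict_space) auto
  \<comment> \<open>The box criterion is about \<open>lborel\<close>, whereas the integrand is only
    Lebesgue measurable; a Borel representative bridges the two.\<close>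
  then obtain f' where f': "f' \<in> borel_measurable lborel" "AE x in lborel. indicator \<omega> x * ?w x = f' x"
    using completion_ex_borel_measurable_real[of "\<lambda>x. indicator \<omega> x * ?w x" lborel] by blast
  have AEf': "AE x in lebesgue. indicator \<omega> x * ?w x = f' x"
    using f'(2) by (rule AE_completion)
  have "integrable lebesgue f'"
    using f AEf' measurable_completion[OF f'(1)]
    by (subst integrable_cong_AE[symmetric, where f="\<lambda>x. indicator \<omega> x * ?w x"]) auto
  then have intf': "integrable lborel f'"
    using f'(1) by (simp add: integrable_completion)
  \<comment> \<open>Only boxes inside the domain are under control. Cutting \<open>f'\<close> off to
    one such box turns every test box into its intersection with it, again a box inside the
    domain.\<close>
  have Q: "AE x in lborel. x \<in> box c d \<longrightarrow> f' x = 0" if sub: "box c d \<subseteq> \<omega>" for c d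
  proof -
    have "AE x in lborel. indicator (box c d) x *\<^sub>R f' x = 0"
    proof (rule AE_zero_of_box_integrals)
      show "integrable lborel (\<lambda>x. indicator (box c d) x *\<^sub>R f' x)"
        using intf' by (intro integrable_mult_indicator) auto
      fix l u :: "real^2"
      obtain l' u' where eq: "box l u \<inter> box c d = box l' u'"
        by (rule that[OF box_Int_box])
      have "(LINT x:box l u|lborel. indicator (box c d) x *\<^sub>R f' x) = (LINT x|lborel. indicator (box l' u') x * f' x)"
        unfolding set_lebesgue_integral_def eq[symmetric] by (simp add: indicator_inter_arith mult.assoc)
      also have "\<dots> = (LINT x|lebesgue. indicator (box l' u') x * f' x)"
        using f'(1) by (intro integral_completion[symmetric]) auto
      also have "\<dots> = (LINT x|lebesgue. indicator \<omega> x * (indicator (box l' u') x * ?w x))"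
      proof (rule integral_cong_AE)
        show "AE x in lebesgue. indicator (box l' u') x * f' x = indicator \<omega> x * (indicator (box l' u') x * ?w x)"
          using AEf' by eventually_elim (auto simp: indicator_def)
        show "(\<lambda>x. indicator (box l' u') x * f' x) \<in> borel_measurable lebesgue"
          using f'(1) by (intro measurable_completion borel_measurable_times) auto
        have "indicator (box l' u') \<in> borel_measurable lebesgue"
          by (intro borel_measurable_indicator) auto
        then have "(\<lambda>x. indicator (box l' u') x * (indicator \<omega> x * ?w x)) \<in> borel_measurable lebesgue"
          by (rule borel_measurable_times[OF _ borel_measurable_integrable[OF f]])
        then show "(\<lambda>x. indicator \<omega> x * (indicator (box l' u') x * ?w x)) \<in> borel_measurable lebesgue"
          by (simp add: mult.left_commute)
      qed
      also have "\<dots> = (LINT x|lebesgue_on \<omega>. indicator (box l' u') x * ?w x)"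
        using \<omega>m by (subst integral_restrict_space) auto
      also have "\<dots> = 0" using sub eq by (intro box0) blast
      finally show "(LINT x:box l u|lborel. indicator (box c d) x *\<^sub>R f' x) = 0" .
    qed
    then show ?thesis by eventually_elim auto
  qed
  obtain B where B: "countable B" "\<And>X. X \<in> B \<Longrightarrow> X \<subseteq> \<omega>" "\<And>X. X \<in> B \<Longrightarrow> \<exists>c d. X = box c d" "\<Union>B = \<omega>"
    using open_countable_Union_open_box[OF \<omega>(1)] by (metis PowD subsetD)
  have "AE x in lborel. \<forall>X\<in>B. x \<in> X \<longrightarrow> f' x = 0"
    using Q B(2,3) by (subst AE_ball_countable[OF B(1)]) metis
  then have "AE x in lborel. x \<in> \<omega> \<longrightarrow> f' x = 0"
    by eventually_elim (use B(4) in blast)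
  then have "AE x in lebesgue. x \<in> \<omega> \<longrightarrow> f' x = 0" by (rule AE_completion)
  with AEf' have "AE x in lebesgue. x \<in> \<omega> \<longrightarrow> ?w x = 0"
    by eventually_elim auto
  then show ?thesis using \<omega>m by (subst AE_restrict_space_iff) auto
qed

section \<open>Rigidity\<close>

text \<open>With P \<alpha> \<beta> the \<alpha>-derivative of the \<beta>-component and p the
  gradient of the vertical one, this is twice the strain contracted with c and d. Both orders occur
  because the strain sees only the symmetric part of P.\<close>

lemma bilinear_strain_zero:
  fixes P :: "2 \<Rightarrow> 2 \<Rightarrow> real" and p :: "2 \<Rightarrow> real"
  assumes "\<And>\<alpha> \<beta>. P \<alpha> \<beta> + P \<beta> \<alpha> + p \<alpha> * p \<beta> = 0"
  shows "(\<Sum>\<alpha>\<in>UNIV. c $ \<alpha> * (\<Sum>\<beta>\<in>UNIV. d $ \<beta> * P \<alpha> \<beta>)) + (\<Sum>\<alpha>\<in>UNIV. d $ \<alpha> * (\<Sum>\<beta>\<in>UNIV. c $ \<beta> * P \<alpha> \<beta>))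
    + (\<Sum>\<alpha>\<in>UNIV. c $ \<alpha> * p \<alpha>) * (\<Sum>\<alpha>\<in>UNIV. d $ \<alpha> * p \<alpha>) = 0"
proof -
  have "P 2 1 = - P 1 2 - p 1 * p 2" "P 1 1 = - (p 1 * p 1) / 2" "P 2 2 = - (p 2 * p 2) / 2"
    using assms[of 1 2] assms[of 1 1] assms[of 2 2] by linarith+
  then show ?thesis
    by (simp add: sum_2) (simp add: field_simps)
qed

lemma orthonormal_components_zero:
  fixes a b :: "real^2" and w :: "2 \<Rightarrow> real"
  assumes ab: "norm a = 1" "norm b = 1" "a \<bullet> b = 0"
    and "(\<Sum>\<alpha>\<in>UNIV. a $ \<alpha> * w \<alpha>) = 0" "(\<Sum>\<alpha>\<in>UNIV. b $ \<alpha> * w \<alpha>) = 0"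
  shows "w \<alpha> = 0"
proof -
  have "a \<bullet> (\<chi> \<alpha>. w \<alpha>) = 0" "b \<bullet> (\<chi> \<alpha>. w \<alpha>) = 0"
    using assms(4,5) by (auto simp: inner_vec_def)
  then have "(\<chi> \<alpha>. w \<alpha>) = 0"
    using orthonormal_expansion[OF ab, of "\<chi> \<alpha>. w \<alpha>"] by simp
  then show ?thesis by (metis vec_lambda_beta zero_index)
qed

theorem theorem6:
  fixes \<omega> :: "(real^2) set"
    and \<nu> :: "real^2 \<Rightarrow> real^2"
    and V\<^sub>H :: "(2 \<Rightarrow> real^2 \<Rightarrow> real) set"
    and V\<^sub>3 :: "(real^2 \<Rightarrow> real) set"
    and V :: "((2 \<Rightarrow> real^2 \<Rightarrow> real) \<times> (real^2 \<Rightarrow> real)) set"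
  assumes "open \<omega>" and "bounded \<omega>" and "connected \<omega>" and "lipschitz_boundary \<omega>"
    and "outer_unit_normal_field \<omega> \<nu>"
    and "V = V\<^sub>H \<times> V\<^sub>3"
    and "V\<^sub>H \<subseteq> {v. \<forall>\<alpha>. v \<alpha> \<in> sobolev 1 \<omega>}" and "V\<^sub>3 \<subseteq> sobolev 2 \<omega>"
    and "\<And>u\<^sub>3. u\<^sub>3 \<in> V\<^sub>3 \<Longrightarrow> (\<And>\<alpha>. AE y in lebesgue_on \<omega>. weak_partial \<omega> \<alpha> u\<^sub>3 y = 0)
           \<Longrightarrow> AE y in lebesgue_on \<omega>. u\<^sub>3 y = 0"
    and "\<exists>e :: real^2. e \<noteq> 0 \<and>
           (\<forall>v\<in>V\<^sub>H. \<forall>\<alpha>. \<exists>g. has_trace \<omega> (v \<alpha>) g \<and>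
              (AE y in arc_length \<omega>. g y * (\<nu> y $ 1 * e $ 1 + \<nu> y $ 2 * e $ 2) = 0))"
  shows "\<forall>u\<in>V. (AE y in lebesgue_on \<omega>. strain \<omega> u y = 0) \<longrightarrow>
           (\<forall>\<alpha>. AE y in lebesgue_on \<omega>. fst u \<alpha> y = 0) \<and> (AE y in lebesgue_on \<omega>. snd u y = 0)"
proof (intro ballI impI)
  fix u assume "u \<in> V" and strain: "AE y in lebesgue_on \<omega>. strain \<omega> u y = 0"
  obtain v u\<^sub>3 where u: "u = (v, u\<^sub>3)" by (cases u)
  have v: "v \<in> V\<^sub>H" and u\<^sub>3: "u\<^sub>3 \<in> V\<^sub>3" using \<open>u \<in> V\<close> assms(6) u by auto
  note \<omega> = assms(1,2,4)
  obtain e :: "real^2" where "e \<noteq> 0" and e: "\<And>v \<alpha>. v \<in> V\<^sub>H \<Longrightarrow> \<exists>g. has_trace \<omega> (v \<alpha>) g \<and>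
      (AE y in arc_length \<omega>. g y * (\<nu> y $ 1 * e $ 1 + \<nu> y $ 2 * e $ 2) = 0)"
    using assms(10) by blast
  define a where "a = (1 / norm e) *\<^sub>R e"
  \<comment> \<open>The unit vector \<open>a\<close> turned by a right angle.\<close>
  define b :: "real^2" where "b = (\<chi> i. if i = 1 then - a $ 2 else a $ 1)"
  have ab: "norm a = 1" "norm b = 1" "a \<bullet> b = 0"
  proof -
    show a: "norm a = 1" using \<open>e \<noteq> 0\<close> by (simp add: a_def)
    show "a \<bullet> b = 0" by (simp add: inner_vec_def sum_2 b_def)
    have "b \<bullet> b = a \<bullet> a" by (simp add: inner_vec_def sum_2 b_def)
    then show "norm b = 1" using a by (simp add: norm_eq_1)
  qed
  have ba: "b \<bullet> a = 0" using ab(3) by (simp add: inner_commute)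
  have "\<forall>\<alpha>. \<exists>g. has_trace \<omega> (v \<alpha>) g \<and>
      (AE y in arc_length \<omega>. g y * (\<nu> y $ 1 * e $ 1 + \<nu> y $ 2 * e $ 2) = 0)"
    using e[OF v] by blast
  from choice[OF this] obtain g where g: "\<And>\<alpha>. has_trace \<omega> (v \<alpha>) (g \<alpha>)"
      "\<And>\<alpha>. AE y in arc_length \<omega>. g \<alpha> y * (\<nu> y $ 1 * e $ 1 + \<nu> y $ 2 * e $ 2) = 0"
    by blast
  have g0: "AE t in lborel. \<forall>x\<in>frontier \<omega>. b \<bullet> x = t \<longrightarrow> g \<alpha> x = 0" for \<alpha>
  proof (rule trace_vanishes_on_lines[OF \<omega> assms(5) ab])
    show "AE y in arc_length \<omega>. g \<alpha> y * (\<nu> y \<bullet> a) = 0"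
      using g(2)[of \<alpha>]
    proof eventually_elim
      case (elim y)
      have "\<nu> y \<bullet> a = (\<nu> y $ 1 * e $ 1 + \<nu> y $ 2 * e $ 2) / norm e"
        by (simp add: a_def inner_vec_def sum_2 add_divide_distrib)
      then show ?case using elim by auto
    qed
  qed
  define P where "P \<alpha> \<beta> = weak_partial \<omega> \<alpha> (v \<beta>)" for \<alpha> \<beta>
  define p where "p \<alpha> = weak_partial \<omega> \<alpha> u\<^sub>3" for \<alpha>
  \<comment> \<open>\<open>trace_approx\<close> takes a function of the direction of differentiation
    with the component fixed, hence the exchanged order of the indices of P.\<close>
  have "\<forall>\<alpha>. \<exists>\<phi>. trace_approx \<omega> (v \<alpha>) (\<lambda>\<beta>. P \<beta> \<alpha>) (g \<alpha>) \<phi>"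
    using trace_approxI[OF \<omega> g(1)] unfolding P_def by blast
  from choice[OF this] obtain \<phi> where \<phi>: "\<And>\<alpha>. trace_approx \<omega> (v \<alpha>) (\<lambda>\<beta>. P \<beta> \<alpha>) (g \<alpha>) (\<phi> \<alpha>)"
    by blast
  note approx = trace_approx_lincomb[where I=UNIV and v=v and W="\<lambda>\<alpha> \<beta>. P \<beta> \<alpha>" and g=g and \<phi>=\<phi>, OF \<phi>]
  have gc: "AE t in lborel. \<forall>x\<in>frontier \<omega>. b \<bullet> x = t \<longrightarrow> (\<Sum>\<alpha>\<in>UNIV. c $ \<alpha> * g \<alpha> x) = 0" for c :: "real^2"
    using g0[of 1] g0[of 2] by eventually_elim (auto simp: sum_2)
  \<comment> \<open>\<open>?p c\<close> is the derivative of the vertical component along c,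
    \<open>?v c\<close> the horizontal component along c, and \<open>?W c d\<close> the derivative
    along c of the component along d.\<close>
  let ?p = "\<lambda>c x. \<Sum>\<alpha>\<in>UNIV. c $ \<alpha> * p \<alpha> x"
  let ?v = "\<lambda>c x. \<Sum>\<alpha>\<in>UNIV. c $ \<alpha> * v \<alpha> x"
  let ?W = "\<lambda>c d x. \<Sum>\<alpha>\<in>UNIV. c $ \<alpha> * (\<Sum>\<beta>\<in>UNIV. d $ \<beta> * P \<alpha> \<beta> x)"
  have p_sq: "?p c \<in> square_integrable (lebesgue_on \<omega>)" for c :: "real^2"
  proof -
    have "u\<^sub>3 \<in> sobolev (Suc (Suc 0)) \<omega>" using u\<^sub>3 assms(8) by (auto simp: numeral_2_eq_2)
    then have "p \<alpha> \<in> square_integrable (lebesgue_on \<omega>)" for \<alpha> by (auto simp: p_def)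
    then show ?thesis by (intro square_integrable_sum square_integrable_scale)
  qed
  \<comment> \<open>The contraction is pointwise algebra, so one null set serves all vectors c and
    d.\<close>
  have E: "AE x in lebesgue_on \<omega>. \<forall>c d :: real^2. ?W c d x + ?W d c x + ?p c x * ?p d x = 0"
    using strain
  proof eventually_elim
    case (elim x)
    have "P \<alpha> \<beta> x + P \<beta> \<alpha> x + p \<alpha> x * p \<beta> x = 0" for \<alpha> \<beta>
      using arg_cong[OF elim, of "\<lambda>m. m $ \<alpha> $ \<beta>"] by (simp add: strain_def u P_def p_def)
    then show ?case using bilinear_strain_zero[of "\<lambda>\<alpha> \<beta>. P \<alpha> \<beta> x" "\<lambda>\<alpha>. p \<alpha> x"] by blast
  qed
  have "(LINT x|lebesgue_on \<omega>. ?W a a x) = 0"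
    by (rule integral_directional_derivative_zero[OF \<omega> ab approx gc])
  moreover have "(LINT x|lebesgue_on \<omega>. (?p a x)\<^sup>2) = (LINT x|lebesgue_on \<omega>. - 2 * ?W a a x)"
  proof (rule integral_cong_AE)
    show "AE x in lebesgue_on \<omega>. (?p a x)\<^sup>2 = - 2 * ?W a a x"
      using E by eventually_elim (auto simp: power2_eq_square dest!: spec[of _ a])
    show "(\<lambda>x. (?p a x)\<^sup>2) \<in> borel_measurable (lebesgue_on \<omega>)"
      using p_sq[of a] by (auto simp: square_integrable_def)
    have "?W a a \<in> borel_measurable (lebesgue_on \<omega>)"
      using trace_approx_directional[OF approx[of "\<lambda>\<alpha>. a $ \<alpha>"], of a] by (auto simp: L2conv_def dest: square_integrable_measurable)
    then show "(\<lambda>x. - 2 * ?W a a x) \<in> borel_measurable (lebesgue_on \<omega>)" by (rule borel_measurable_times[OF borel_measurable_const])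
  qed
  ultimately have "(LINT x|lebesgue_on \<omega>. (?p a x)\<^sup>2) = 0" by simp
  then have pa: "AE x in lebesgue_on \<omega>. ?p a x = 0"
    by (rule square_integral_zero_AE[OF p_sq])
  have Waa: "AE x in lebesgue_on \<omega>. ?W a a x = 0"
    using E pa by eventually_elim (auto dest!: spec[of _ a])
  have va: "AE x in lebesgue_on \<omega>. ?v a x = 0"
    by (rule AE_zero_of_directional_derivative_zero[OF \<omega> ab approx gc Waa])
  \<comment> \<open>The roles of \<open>a\<close> and \<open>b\<close> are exchanged here:
    closability is applied to the derivative along \<open>b\<close> of the component along
    \<open>a\<close>, which is already known to vanish.\<close>
  have Wba: "AE x in lebesgue_on \<omega>. ?W b a x = 0"
    by (rule AE_directional_derivative_zero[OF \<omega>(1,2) ab(2,1) ba approx va])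
  have Wab: "AE x in lebesgue_on \<omega>. ?W a b x = 0"
    using E Wba pa
  proof eventually_elim
    case (elim x)
    have "?W a b x + ?W b a x + ?p a x * ?p b x = 0" using elim(1) by blast
    then show ?case using elim(2,3) by simp
  qed
  have vb: "AE x in lebesgue_on \<omega>. ?v b x = 0"
    by (rule AE_zero_of_directional_derivative_zero[OF \<omega> ab approx gc Wab])
  \<comment> \<open>Closability once more along \<open>b\<close>; the last strain component then
    reduces to the square of \<open>?p b\<close>.\<close>
  have Wbb: "AE x in lebesgue_on \<omega>. ?W b b x = 0"
    by (rule AE_directional_derivative_zero[OF \<omega>(1,2) ab(2,1) ba approx vb])
  have pb: "AE x in lebesgue_on \<omega>. ?p b x = 0"
    using E Wbb
  proof eventually_elim
    case (elim x)
    have "?W b b x + ?W b b x + ?p b x * ?p b x = 0" using elim(1) by blast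
    then show ?case using elim(2) by simp
  qed
  have "AE x in lebesgue_on \<omega>. p \<alpha> x = 0" for \<alpha>
    using pa pb by eventually_elim (rule orthonormal_components_zero[OF ab])
  then have "AE x in lebesgue_on \<omega>. u\<^sub>3 x = 0"
    unfolding p_def by (rule assms(9)[OF u\<^sub>3])
  moreover have "AE x in lebesgue_on \<omega>. v \<alpha> x = 0" for \<alpha>
    using va vb by eventually_elim (rule orthonormal_components_zero[OF ab])
  ultimately show "(\<forall>\<alpha>. AE y in lebesgue_on \<omega>. fst u \<alpha> y = 0) \<and> (AE y in lebesgue_on \<omega>. snd u y = 0)"
    by (simp add: u)
qed

end
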